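(* Consider the two-dimensional setting described in the context ($\Omega \subset \mathbb{R}^2$, coefficients $\mu_t, \mu_s, p$, sets $\Omega_0$, $\Gamma_\pm$, $D$, $\overline{D}$, and line segments $L_1, \dots, L_K$ with $K \ge 1$ and directions $\xi^{(j)}_\pm$). Let the boundary data $I_0$, a function on $\Gamma_-$, be bounded and satisfy at least one of the following two conditions: 1. $I_0(x, \cdot)$ is continuous on $\Gamma_{-,x}$ for almost all $x \in \partial\Omega$; 2. $I_0(\cdot, \xi)$ is continuous on $\Gamma_{-,\xi}$ for almost all $\xi \in S^1$. Let $I$ be the solution to the boundary value problem with boundary data $I_0$. Then $I$ can be extended up to $\Gamma_+$, the extension being denoted by $\overline{I}$, by $$\overline{I}(x,\xi) := \begin{cases} I(x,\xi), & (x,\xi) \in D,\\ \lim_{t\downarrow 0} I(x - t\xi,\xi), & (x,\xi) \in \Gamma_+.\end{cases}$$ Moreover, $$\operatorname{disc}(\overline{I}) \subset \overline{\operatorname{disc}_B} \cup \overline{\operatorname{disc}_C},$$ where $$\overline{\operatorname{disc}_B} := \{ (x_* + t\xi_*, \xi_* ) \mid (x_*, \xi_* ) \in \operatorname{disc}(I_0),\ 0 \leq t \leq \tau_+(x_*, \xi_* ) \}$$ and $$\overline{\operatorname{disc}_C} := \bigcup_{j=1}^K \{ (x + t\xi^{(j)}_\pm, \xi^{(j)}_\pm) \mid x \in L_j,\ 0 \leq t \leq \tau_+(x, \xi^{(j)}_\pm) \},$$ both signs $\pm$ being included in the union (the overlines on $\operatorname{disc}_B$, $\operatorname{disc}_C$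 are notation for the sets just displayed).
   Context: Domain. $\Omega \subset \mathbb{R}^2$ is a bounded convex domain with $C^1$ boundary, and $n(x)$ is the outer unit normal at $x \in \partial\Omega$. $S^1$ is the unit circle with Lebesgue measure $d\sigma$. Suppose $\overline{\Omega} = \bigcup_{j=1}^N \overline{\Omega_j}$, where $\Omega_1, \dots, \Omega_N$ are disjoint subdomains of $\Omega$ with piecewise $C^1$ boundaries, and put $\Omega_0 := \bigcup_{j=1}^N \Omega_j$. Line segments in the interfaces. It is assumed that $\partial\Omega_0 \setminus \partial\Omega$ contains at most a finite number of (open) line segments, denoted $L_1, \dots, L_K$, and only the case $K \ge 1$ is considered. (This assumption replaces the generalized convexity condition, i.e. the requirement that half lines $\{x - t\xi \mid t \ge 0\}$ meet $\partial\Omega_0$ in a uniformly bounded finite number of points, which is not assumed.) For $1 \le j \le K$, $\xi^{(j)}_+ \in S^1$ is a direction of $L_j$ (for any $x \in L_j$ there is $t>0$ with $x + t\xi^{(j)}_+ \in L_j$), and $\xi^{(j)}_- := -\xi^{(j)}_+$. Coefficients. $\mu_t$ and $\mu_s$ are nonnegative bounded functions with $\mu_t \ge \mu_s$ on $\Omega$, all of whose discontinuity points in $\Omega$ are contained in $\partial\Omega_0$ (so they are continuous on $\Omega_0$), and they are reset to $0$ on $\mathbb{R}^2 \setminus \Omega_0$. $p$ is a nonnegative bounded function on $\mathbb{R}^2 \times S^1 \times S^1$, continuous on $\Omega_0 \times S^1 \times S^1$, equal to $0$ on $(\mathbb{R}^2 \setminus \Omega_0) \times S^1 \times S^1$, and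 satisfying $\int_{S^1} p(x,\xi,\xi')\,d\sigma_{\xi'} = 1$ for all $(x,\xi) \in \Omega_0 \times S^1$. Notation. $\Gamma_\pm := \{(x,\xi) \in \partial\Omega \times S^1 \mid \pm n(x)\cdot\xi > 0\}$; $\Gamma_{-,\xi} := \{x \in \partial\Omega \mid n(x)\cdot\xi < 0\}$ for $\xi \in S^1$; $\Gamma_{-,x} := \{\xi \in S^1 \mid n(x)\cdot\xi<0\}$ for $x \in \partial\Omega$; $D := (\Omega \times S^1) \cup \Gamma_-$ and $\overline{D} := D \cup \Gamma_+$. For $(x,\xi) \in \overline{D}$, $\tau_\pm(x,\xi) := \inf\{t>0 \mid x \pm t\xi \notin \Omega\}$ and $P(x,\xi) := x - \tau_-(x,\xi)\xi$. For a function $f$, $\operatorname{disc}(f)$ denotes the set of all discontinuous points of $f$. Boundary value problem. The problem is the stationary transport equation $$\xi\cdot\nabla_x I(x,\xi) + \mu_t(x) I(x,\xi) = \mu_s(x)\int_{S^1} p(x,\xi,\xi') I(x,\xi')\,d\sigma_{\xi'}$$ in $\Omega\times S^1$ with $I = I_0$ on $\Gamma_-$. A solution is by definition a bounded measurable function $I$ on $D$ such that for all $(x,\xi) \in D$ $$I(x,\xi) = e^{-M_t(x,\xi;\tau_-(x,\xi))} I_0(P(x,\xi),\xi) + \int_0^{\tau_-(x,\xi)} \mu_s(x-s\xi)\, e^{-M_t(x,\xi;s)} \int_{S^1} p(x-s\xi,\xi,\xi') I(x-s\xi,\xi')\,d\sigma_{\xi'}\,ds,$$ where $M_t(x,\xi;s)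 := \int_0^s \mu_t(x-r\xi)\,dr$. For the boundary data $I_0$ considered here, such a solution exists and is unique.
   Formalization: It is additionally assumed that every line meets the part of ∂Ω_0 \ ∂Ω outside the segments L_1,…,L_K in a set of length zero; otherwise an interface without segments can meet a line in a fat Cantor set and the inclusion for disc(Ī) fails. *)

theory Defs
  imports "HOL-Analysis.Analysis"
begin

definition disc :: "'a::t2_space set \<Rightarrow> ('a \<Rightarrow> 'b::topological_space) \<Rightarrow> 'a set" where
  "disc S f = {x \<in> S. \<not> continuous (at x within S) f}"


subsection \<open>The unit circle and its measure\<close>

abbreviation S1 :: "(real^2) set" where
  "S1 \<equiv> sphere 0 1"

text \<open>Arc length on the unit circle, regarded as a (complete) measure on the whole plane
  concentrated on \<open>S1\<close>. The completion makes all Lebesgue measurable functions on the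
  circle measurable.\<close>

definition circle_measure :: "(real^2) measure" where
  "circle_measure =
     completion (distr (restrict_space lborel {0..<2*pi}) borel (\<lambda>\<theta>. vector [cos \<theta>, sin \<theta>]))"


subsection \<open>Boundaries\<close>

text \<open>In the orthonormal frame \<open>(u, v)\<close> and inside the ball of radius \<open>r\<close> about \<open>x\<close>,
  the set \<open>S\<close> is the region strictly below the graph of the C1 function \<open>g\<close>.\<close>

definition C1_graph_at ::
  "(real^2) set \<Rightarrow> real^2 \<Rightarrow> real \<Rightarrow> real^2 \<Rightarrow> real^2 \<Rightarrow> (real \<Rightarrow> real) \<Rightarrow> (real \<Rightarrow> real) \<Rightarrow> bool" where
  "C1_graph_at S x r u v g g' \<longleftrightarrow>
     r > 0 \<and> norm u = 1 \<and> norm v = 1 \<and> u \<bullet> v = 0 \<and>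
     (\<forall>s. (g has_real_derivative g' s) (at s)) \<and> continuous_on UNIV g' \<and>
     (\<forall>y\<in>ball x r. y \<in> S \<longleftrightarrow> y \<bullet> v < g (y \<bullet> u))"

definition C1_boundary :: "(real^2) set \<Rightarrow> bool" where
  "C1_boundary S \<longleftrightarrow> (\<forall>x\<in>frontier S. \<exists>r u v g g'. C1_graph_at S x r u v g g')"

definition outer_normal :: "(real^2) set \<Rightarrow> real^2 \<Rightarrow> real^2" where
  "outer_normal S x =
     (THE n. \<exists>r u v g g'. C1_graph_at S x r u v g g' \<and>
        n = (1 / sqrt (1 + (g' (x \<bullet> u))\<^sup>2)) *\<^sub>R (v - g' (x \<bullet> u) *\<^sub>R u))"

text \<open>A subset of a C1 boundary has arc length zero iff it is a null set in every graph chart.\<close>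

definition boundary_null :: "(real^2) set \<Rightarrow> (real^2) set \<Rightarrow> bool" where
  "boundary_null S N \<longleftrightarrow>
     (\<forall>x\<in>frontier S. \<forall>r u v g g'. C1_graph_at S x r u v g g' \<longrightarrow>
        negligible {s. s *\<^sub>R u + g s *\<^sub>R v \<in> N \<inter> ball x r})"

definition piecewise_C1_boundary :: "(real^2) set \<Rightarrow> bool" where
  "piecewise_C1_boundary S \<longleftrightarrow>
     (\<exists>A. finite A \<and>
        (\<forall>\<gamma>\<in>A. arc \<gamma> \<and> \<gamma> C1_differentiable_on {0..1} \<and>
           (\<forall>t\<in>{0..1}. vector_derivative \<gamma> (at t) \<noteq> 0)) \<and>
        frontier S = (\<Union>\<gamma>\<in>A. path_image \<gamma>))"


subsection \<open>Phase space\<close>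

definition Gamma_plus :: "(real^2) set \<Rightarrow> ((real^2) \<times> (real^2)) set" where
  "Gamma_plus \<Omega> = {(x, \<xi>). x \<in> frontier \<Omega> \<and> \<xi> \<in> S1 \<and> outer_normal \<Omega> x \<bullet> \<xi> > 0}"

definition Gamma_minus :: "(real^2) set \<Rightarrow> ((real^2) \<times> (real^2)) set" where
  "Gamma_minus \<Omega> = {(x, \<xi>). x \<in> frontier \<Omega> \<and> \<xi> \<in> S1 \<and> outer_normal \<Omega> x \<bullet> \<xi> < 0}"

definition Gamma_minus_dir :: "(real^2) set \<Rightarrow> real^2 \<Rightarrow> (real^2) set" where
  "Gamma_minus_dir \<Omega> \<xi> = {x \<in> frontier \<Omega>. outer_normal \<Omega> x \<bullet> \<xi> < 0}"

definition Gamma_minus_pt :: "(real^2) set \<Rightarrow> real^2 \<Rightarrow> (real^2) set" where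
  "Gamma_minus_pt \<Omega> x = {\<xi> \<in> S1. outer_normal \<Omega> x \<bullet> \<xi> < 0}"

definition phase_D :: "(real^2) set \<Rightarrow> ((real^2) \<times> (real^2)) set" where
  "phase_D \<Omega> = (\<Omega> \<times> S1) \<union> Gamma_minus \<Omega>"

definition phase_D_bar :: "(real^2) set \<Rightarrow> ((real^2) \<times> (real^2)) set" where
  "phase_D_bar \<Omega> = phase_D \<Omega> \<union> Gamma_plus \<Omega>"

definition tau_plus :: "(real^2) set \<Rightarrow> real^2 \<Rightarrow> real^2 \<Rightarrow> real" where
  "tau_plus \<Omega> x \<xi> = Inf {t. t > 0 \<and> x + t *\<^sub>R \<xi> \<notin> \<Omega>}"

definition tau_minus :: "(real^2) set \<Rightarrow> real^2 \<Rightarrow> real^2 \<Rightarrow> real" where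
  "tau_minus \<Omega> x \<xi> = Inf {t. t > 0 \<and> x - t *\<^sub>R \<xi> \<notin> \<Omega>}"

definition entry_pt :: "(real^2) set \<Rightarrow> real^2 \<Rightarrow> real^2 \<Rightarrow> real^2" where
  "entry_pt \<Omega> x \<xi> = x - tau_minus \<Omega> x \<xi> *\<^sub>R \<xi>"


subsection \<open>Segments in the interfaces\<close>

text \<open>\<open>F\<close> stands for the part of the interfaces inside the domain and \<open>L 1, \<dots>, L K\<close> for the
  finitely many open line segments it contains. As every segment contains infinitely many smaller
  ones, this can only be meant up to subsegments.\<close>

definition segments_of :: "(real^2) set \<Rightarrow> nat \<Rightarrow> (nat \<Rightarrow> (real^2) set) \<Rightarrow> bool" where
  "segments_of F K L \<longleftrightarrow>
     (\<forall>j\<in>{1..K}. L j \<subseteq> F \<and> (\<exists>a b. a \<noteq> b \<and> L j = open_segment a b)) \<and>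
     (\<forall>a b. a \<noteq> b \<and> open_segment a b \<subseteq> F \<longrightarrow> (\<exists>j\<in>{1..K}. open_segment a b \<subseteq> L j))"

text \<open>Apart from the \<open>L j\<close>, \<open>F\<close> has no straight parts: every line meets the rest of \<open>F\<close> in a set
  of length zero. This does not follow from \<open>segments_of\<close>, since a C1 curve containing no segment
  may still meet a line in a Cantor set of positive length. Along such a line the attenuation
  can differ from that along nearby parallel lines, so the solution can be discontinuous there and
  the line has to be excluded.\<close>

definition no_other_straight_parts :: "(real^2) set \<Rightarrow> nat \<Rightarrow> (nat \<Rightarrow> (real^2) set) \<Rightarrow> bool" where
  "no_other_straight_parts F K L \<longleftrightarrow>
     (\<forall>x. \<forall>\<xi>\<in>S1. negligible {t. x + t *\<^sub>R \<xi> \<in> F - (\<Union>j\<in>{1..K}. L j)})"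

definition direction_of :: "(real^2) set \<Rightarrow> real^2 \<Rightarrow> bool" where
  "direction_of A \<xi> \<longleftrightarrow> \<xi> \<in> S1 \<and> (\<forall>x\<in>A. \<exists>t>0. x + t *\<^sub>R \<xi> \<in> A)"


subsection \<open>The transport equation\<close>

definition optical_depth :: "(real^2 \<Rightarrow> real) \<Rightarrow> real^2 \<Rightarrow> real^2 \<Rightarrow> real \<Rightarrow> real" where
  "optical_depth \<mu>t x \<xi> s = (LINT r:{0..s}|lebesgue. \<mu>t (x - r *\<^sub>R \<xi>))"

definition scattering ::
  "(real^2 \<Rightarrow> real^2 \<Rightarrow> real^2 \<Rightarrow> real) \<Rightarrow> ((real^2) \<times> (real^2) \<Rightarrow> real) \<Rightarrow> real^2 \<Rightarrow> real^2 \<Rightarrow> real" where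
  "scattering p I x \<xi> = (LINT \<xi>'|circle_measure. p x \<xi> \<xi>' * I (x, \<xi>'))"

text \<open>Measurability is Lebesgue measurability on \<open>D\<close>. As integrals of non-integrable functions
  are 0 by convention, the existence of the integrals is required explicitly.\<close>

definition is_solution ::
  "(real^2) set \<Rightarrow> (real^2 \<Rightarrow> real) \<Rightarrow> (real^2 \<Rightarrow> real) \<Rightarrow> (real^2 \<Rightarrow> real^2 \<Rightarrow> real^2 \<Rightarrow> real) \<Rightarrow>
   ((real^2) \<times> (real^2) \<Rightarrow> real) \<Rightarrow> ((real^2) \<times> (real^2) \<Rightarrow> real) \<Rightarrow> bool" where
  "is_solution \<Omega> \<mu>t \<mu>s p I0 I \<longleftrightarrow>
     bounded (I ` phase_D \<Omega>) \<and>
     I \<in> borel_measurable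
           (restrict_space (completion (lborel \<Otimes>\<^sub>M circle_measure)) (phase_D \<Omega>)) \<and>
     (\<forall>x\<in>\<Omega>. \<forall>\<xi>\<in>S1. integrable circle_measure (\<lambda>\<xi>'. p x \<xi> \<xi>' * I (x, \<xi>'))) \<and>
     (\<forall>(x, \<xi>)\<in>phase_D \<Omega>.
        set_integrable lebesgue {0..tau_minus \<Omega> x \<xi>}
          (\<lambda>s. \<mu>s (x - s *\<^sub>R \<xi>) * exp (- optical_depth \<mu>t x \<xi> s) * scattering p I (x - s *\<^sub>R \<xi>) \<xi>) \<and>
        I (x, \<xi>) =
          exp (- optical_depth \<mu>t x \<xi> (tau_minus \<Omega> x \<xi>)) * I0 (entry_pt \<Omega> x \<xi>, \<xi>) +
          (LINT s:{0..tau_minus \<Omega> x \<xi>}|lebesgue.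
             \<mu>s (x - s *\<^sub>R \<xi>) * exp (- optical_depth \<mu>t x \<xi> s) * scattering p I (x - s *\<^sub>R \<xi>) \<xi>))"

text \<open>Only meaningful on \<open>phase_D_bar\<close>, and on \<open>Gamma_plus\<close> only if the limit exists.\<close>

definition extension ::
  "(real^2) set \<Rightarrow> ((real^2) \<times> (real^2) \<Rightarrow> real) \<Rightarrow> ((real^2) \<times> (real^2) \<Rightarrow> real)" where
  "extension \<Omega> I = (\<lambda>(x, \<xi>).
     if (x, \<xi>) \<in> phase_D \<Omega> then I (x, \<xi>)
     else Lim (at_right 0) (\<lambda>t. I (x - t *\<^sub>R \<xi>, \<xi>)))"

definition disc_B :: "(real^2) set \<Rightarrow> ((real^2) \<times> (real^2) \<Rightarrow> real) \<Rightarrow> ((real^2) \<times> (real^2)) set" where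
  "disc_B \<Omega> I0 =
     {(x + t *\<^sub>R \<xi>, \<xi>) | x \<xi> t. (x, \<xi>) \<in> disc (Gamma_minus \<Omega>) I0 \<and> 0 \<le> t \<and> t \<le> tau_plus \<Omega> x \<xi>}"

definition disc_C ::
  "(real^2) set \<Rightarrow> nat \<Rightarrow> (nat \<Rightarrow> (real^2) set) \<Rightarrow> (nat \<Rightarrow> real^2) \<Rightarrow> ((real^2) \<times> (real^2)) set" where
  "disc_C \<Omega> K L \<xi>p =
     (\<Union>j\<in>{1..K}. \<Union>\<xi>\<in>{\<xi>p j, - \<xi>p j}.
        {(x + t *\<^sub>R \<xi>, \<xi>) | x t. x \<in> L j \<and> 0 \<le> t \<and> t \<le> tau_plus \<Omega> x \<xi>})"

end

theory Submission
  imports Defs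
begin

text \<open>
  Write \<open>S(x, \<xi>)\<close> for the scattering integral. The oscillation of \<open>S\<close> on \<open>\<Omega>0 \<times> S1\<close>, measured along
  sequences, is a fixed number at most \<open>2 M\<close>. If it is bounded by \<open>W\<close>, the integral equation bounds the
  oscillation of the solution in \<open>x\<close>, for almost every direction, by \<open>\<kappa> W\<close> with
  \<open>\<kappa> = 1 - exp (- C R) < 1\<close>, because \<open>\<mu>s \<le> \<mu>t\<close>; averaging over directions bounds the oscillation of \<open>S\<close> by
  \<open>\<kappa> W\<close> as well. Hence \<open>S\<close> is continuous, without any Neumann series or uniqueness argument. Continuity
  of the right-hand side of the integral equation then follows by dominated convergence at every point whose
  line meets the interfaces in length zero and whose entry point is a continuity point of \<open>I0\<close>.

  When \<open>I0\<close> is only continuous in the direction, the average over directions is first rewritten as an integral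
  over the boundary, so that the entry point does not move with \<open>x\<close>.
\<close>

section \<open>Rays in a convex domain with C1 boundary\<close>

text \<open>Two obstacles shape the argument. Without generalized convexity a ray may cross the
  interfaces infinitely often, so nothing can be done piece by piece along a ray. All that is used
  is that the crossings have length zero: the coefficients are continuous on
  \<open>\<Omega>0\<close> and vanish near every point outside its closure. A ray that runs along a
  segment \<open>L j\<close> violates even this, but such rays have only finitely many directions,
  which an average over the circle does not see. So \<open>S\<close> is continuous on
  \<open>\<Omega>0\<close> although \<open>I\<close> may jump. Secondly, \<open>S\<close> itself may
  jump at an interface. This does no harm, because in the integral equation it is multiplied by
  \<open>\<mu>s\<close>, which vanishes outside \<open>\<Omega>0\<close>; its oscillation is needed
  at points of \<open>\<Omega>0\<close> only. The constant \<kappa> bounds the probability of a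
  collision along a ray: the integral of \<open>\<mu>t\<close> times its attenuation is 1 minus the
  exponential of minus the optical depth, and the depth is at most \<open>C * R\<close>, with
  \<open>C\<close> a bound for \<open>\<mu>t\<close> and \<open>R\<close> the diameter. The limit at
  \<open>Gamma_plus\<close> exists for every direction, because a shift along the ray keeps the
  entry point and slides any segment contained in the ray along itself.\<close>

lemma line_between:
  fixes \<Omega> :: "(real^2) set"
  assumes "open \<Omega>" "convex \<Omega>" "x - t0 *\<^sub>R \<xi> \<in> \<Omega>" "x - s *\<^sub>R \<xi> \<in> closure \<Omega>"
    and "t0 \<le> t \<and> t < s \<or> s < t \<and> t \<le> t0"
  shows "x - t *\<^sub>R \<xi> \<in> \<Omega>"
proof -
  have ns: "s \<noteq> t0" using assms(5) by auto
  \<comment> \<open>The fraction of the way from the interior point at \<open>t0\<close> to the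
    closure point at \<open>s\<close>. Signs cancel in the quotient, so both orders are treated at
    once; excluding \<open>t = s\<close> gives \<open>w < 1\<close>, which keeps the point in the
    interior.\<close>
  define w where "w = (t - t0) / (s - t0)"
  have w: "0 \<le> w" "w < 1" using assms(5) ns by (auto simp: w_def field_simps)
  have t: "t = t0 + w * (s - t0)" using ns by (simp add: w_def)
  have "(x - s *\<^sub>R \<xi>) - (1 - w) *\<^sub>R ((x - s *\<^sub>R \<xi>) - (x - t0 *\<^sub>R \<xi>)) \<in> interior \<Omega>"
    using mem_interior_closure_convex_shrink[OF assms(2), of "x - t0 *\<^sub>R \<xi>" "x - s *\<^sub>R \<xi>" "1 - w"] assms w
    by (simp add: interior_open)
  also have "(x - s *\<^sub>R \<xi>) - (1 - w) *\<^sub>R ((x - s *\<^sub>R \<xi>) - (x - t0 *\<^sub>R \<xi>)) = x - t *\<^sub>R \<xi>"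
    by (simp add: t algebra_simps)
  finally show ?thesis using assms(1) by (simp add: interior_open)
qed

text \<open>\<open>Inf\<close> of the empty set of reals has no useful value, so lower bounds on
  \<open>tau_plus\<close> and \<open>tau_minus\<close> need an exit time to exist. Far out on the
  ray the norm exceeds any bound for the domain.\<close>

lemma exits_nonempty:
  fixes \<Omega> :: "(real^2) set"
  assumes "bounded \<Omega>" "\<xi> \<noteq> 0"
  shows "\<exists>t>0. x - t *\<^sub>R \<xi> \<notin> \<Omega>"
proof -
  obtain B where B: "B > 0" "\<And>y. y \<in> \<Omega> \<Longrightarrow> norm y \<le> B" using assms(1) bounded_pos by metis
  define t where "t = (B + norm x + 1) / norm \<xi>"
  have t: "t > 0" "t * norm \<xi> = B + norm x + 1"
    using assms(2) B(1) by (auto simp: t_def intro!: divide_pos_pos add_pos_nonneg)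
  have "norm (t *\<^sub>R \<xi>) \<le> norm (x - t *\<^sub>R \<xi>) + norm x"
    using norm_triangle_ineq4[of x "x - t *\<^sub>R \<xi>"] by simp
  then have "norm (x - t *\<^sub>R \<xi>) > B" using t by simp
  then have "x - t *\<^sub>R \<xi> \<notin> \<Omega>" using B(2) by fastforce
  with t show ?thesis by blast
qed

lemma le_tau_plus:
  fixes \<Omega> :: "(real^2) set"
  assumes "bounded \<Omega>" "\<xi> \<in> S1" "\<And>t. 0 < t \<Longrightarrow> t < s \<Longrightarrow> y + t *\<^sub>R \<xi> \<in> \<Omega>"
  shows "s \<le> tau_plus \<Omega> y \<xi>"
  unfolding tau_plus_def
proof (rule cInf_greatest)
  show "{t. t > 0 \<and> y + t *\<^sub>R \<xi> \<notin> \<Omega>} \<noteq> {}"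
    using exits_nonempty[OF assms(1), of "- \<xi>" y] assms(2) by force
  show "s \<le> t" if "t \<in> {t. t > 0 \<and> y + t *\<^sub>R \<xi> \<notin> \<Omega>}" for t
    using that assms(3)[of t] by force
qed

locale convex_domain =
  fixes \<Omega> :: "(real^2) set"
  assumes op: "open \<Omega>" and bdd: "bounded \<Omega>" and conv: "convex \<Omega>"
begin

text \<open>The pairs of a point and a direction whose line runs through the domain; by
  \<open>phase_D_bar_eq\<close> below this is \<open>phase_D_bar\<close> when the boundary is C1.\<close>

definition through :: "real^2 \<Rightarrow> real^2 \<Rightarrow> bool" where
  "through x \<xi> \<longleftrightarrow> x \<in> closure \<Omega> \<and> \<xi> \<in> S1 \<and> (\<exists>t. x - t *\<^sub>R \<xi> \<in> \<Omega>)"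

lemma through_Omega: "x \<in> \<Omega> \<Longrightarrow> \<xi> \<in> S1 \<Longrightarrow> through x \<xi>"
  unfolding through_def using closure_subset by (auto intro!: exI[of _ 0])

lemma exits:
  assumes "\<xi> \<in> S1"
  shows "{t. t > 0 \<and> x - t *\<^sub>R \<xi> \<notin> \<Omega>} \<noteq> {}"
  using exits_nonempty[OF bdd, of \<xi> x] assms by force

lemma tau_minus_nonneg: "\<xi> \<in> S1 \<Longrightarrow> 0 \<le> tau_minus \<Omega> x \<xi>"
  unfolding tau_minus_def using exits by (intro cInf_greatest) auto

lemma before_tau_minus:
  assumes "0 < s" "s < tau_minus \<Omega> x \<xi>"
  shows "x - s *\<^sub>R \<xi> \<in> \<Omega>"
proof (rule ccontr)
  assume "x - s *\<^sub>R \<xi> \<notin> \<Omega>"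
  then have "tau_minus \<Omega> x \<xi> \<le> s" unfolding tau_minus_def
    using assms by (intro cInf_lower bdd_belowI[of _ 0]) auto
  with assms show False by simp
qed

text \<open>The infimum only marks the first exit; convexity excludes a return. An exit time
  \<open>t < s\<close> lies between 0 and the interior parameter \<open>t0\<close>, or between
  \<open>t0\<close> and \<open>s\<close>, and \<open>line_between\<close> refutes both. An interior
  point on the line is essential: along a flat piece of the boundary \<open>tau_minus\<close> is 0
  while the ray stays in the closure.\<close>

lemma after_tau_minus:
  assumes "through x \<xi>" "tau_minus \<Omega> x \<xi> < s"
  shows "x - s *\<^sub>R \<xi> \<notin> closure \<Omega>"
proof
  assume s: "x - s *\<^sub>R \<xi> \<in> closure \<Omega>"
  have "\<xi> \<in> S1" using assms(1) through_def by blast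
  from cInf_lessD[OF exits[OF this] assms(2)[unfolded tau_minus_def]]
  obtain t where t: "t > 0" "x - t *\<^sub>R \<xi> \<notin> \<Omega>" "t < s" by auto
  obtain t0 where t0: "x - t0 *\<^sub>R \<xi> \<in> \<Omega>" "x \<in> closure \<Omega>" using assms(1) through_def by blast
  show False
  proof (cases "t0 \<le> t")
    case True
    then show False using line_between[OF op conv t0(1) s, of t] t by auto
  next
    case False
    then show False using line_between[OF op conv t0(1), of 0 t] t0(2) t by auto
  qed
qed

lemma le_tau_minus:
  assumes "through x \<xi>" "x - s *\<^sub>R \<xi> \<in> closure \<Omega>"
  shows "s \<le> tau_minus \<Omega> x \<xi>"
  using after_tau_minus[OF assms(1), of s] assms(2) by force

lemma entry_frontier:
  assumes "through x \<xi>"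
  shows "entry_pt \<Omega> x \<xi> \<in> frontier \<Omega>" "\<exists>t>0. entry_pt \<Omega> x \<xi> + t *\<^sub>R \<xi> \<in> \<Omega>"
proof -
  let ?\<tau> = "tau_minus \<Omega> x \<xi>"
  have S1: "\<xi> \<in> S1" and xc: "x \<in> closure \<Omega>" using assms through_def by auto
  have nn: "0 \<le> ?\<tau>" using tau_minus_nonneg S1 by blast
  have cl: "entry_pt \<Omega> x \<xi> \<in> closure \<Omega>"
  \<comment> \<open>This happens at incoming boundary points, which are their own entry points;
    there is then no ray segment from which to approach the entry point.\<close>
  proof (cases "?\<tau> = 0")
    case True then show ?thesis using xc by (simp add: entry_pt_def)
  next
    case False
    then have pos: "0 < ?\<tau>" using nn by simp
    have "((\<lambda>s. x - s *\<^sub>R \<xi>) \<longlongrightarrow> x - ?\<tau> *\<^sub>R \<xi>) (at_left ?\<tau>)"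
      by (intro tendsto_intros)
    moreover have "\<forall>\<^sub>F s in at_left ?\<tau>. x - s *\<^sub>R \<xi> \<in> closure \<Omega>"
      using eventually_at_left_real[OF pos]
      by eventually_elim (use before_tau_minus closure_subset in \<open>force\<close>)
    ultimately show ?thesis unfolding entry_pt_def
      by (intro Lim_in_closed_set[OF closed_closure, where F="at_left ?\<tau>"]) auto
  qed
  have nin: "entry_pt \<Omega> x \<xi> \<notin> \<Omega>"
  proof
    assume "entry_pt \<Omega> x \<xi> \<in> \<Omega>"
    moreover have "((\<lambda>s. x - s *\<^sub>R \<xi>) \<longlongrightarrow> x - ?\<tau> *\<^sub>R \<xi>) (at_right ?\<tau>)"
      by (intro tendsto_intros)
    ultimately have "\<forall>\<^sub>F s in at_right ?\<tau>. x - s *\<^sub>R \<xi> \<in> \<Omega>"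
      using topological_tendstoD op unfolding entry_pt_def by blast
    moreover have "\<forall>\<^sub>F s in at_right ?\<tau>. ?\<tau> < s" by (simp add: eventually_at_filter)
    ultimately have "\<forall>\<^sub>F s in at_right ?\<tau>. False"
      by eventually_elim (use after_tau_minus[OF assms] closure_subset in auto)
    then show False by simp
  qed
  show "entry_pt \<Omega> x \<xi> \<in> frontier \<Omega>" using cl nin op by (simp add: frontier_def interior_open)
  obtain t0 where t0: "x - t0 *\<^sub>R \<xi> \<in> \<Omega>" using assms(1) through_def by blast
  then have "t0 \<le> ?\<tau>" using le_tau_minus[OF assms] closure_subset by auto
  moreover have "t0 \<noteq> ?\<tau>" using t0 nin entry_pt_def by metis
  moreover have "entry_pt \<Omega> x \<xi> + (?\<tau> - t0) *\<^sub>R \<xi> = x - t0 *\<^sub>R \<xi>"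
    by (simp add: entry_pt_def algebra_simps)
  ultimately show "\<exists>t>0. entry_pt \<Omega> x \<xi> + t *\<^sub>R \<xi> \<in> \<Omega>"
    using t0 by (intro exI[of _ "?\<tau> - t0"]) auto
qed

text \<open>Both bounds are open conditions: just before the exit time the ray is in the open
  domain, just after it the ray is outside the closure, and each persists for nearby rays. The
  second half fails for tangential limit rays.\<close>

lemma tau_minus_tendsto:
  assumes th: "through x \<xi>" and "\<And>n. through (X n) (Z n)" "(X \<longlongrightarrow> x) F" "(Z \<longlongrightarrow> \<xi>) F"
  shows "((\<lambda>n. tau_minus \<Omega> (X n) (Z n)) \<longlongrightarrow> tau_minus \<Omega> x \<xi>) F"
proof (rule order_tendstoI)
  have lim: "((\<lambda>n. X n - t *\<^sub>R Z n) \<longlongrightarrow> x - t *\<^sub>R \<xi>) F" for t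
    by (intro tendsto_intros assms)
  have nn: "0 \<le> tau_minus \<Omega> (X n) (Z n)" for n
    using tau_minus_nonneg assms(2)[of n] through_def by blast
  show "\<forall>\<^sub>F n in F. t < tau_minus \<Omega> (X n) (Z n)" if t: "t < tau_minus \<Omega> x \<xi>" for t
  proof (cases "t < 0")
    case True
    then show ?thesis using nn by (intro always_eventually) (meson less_le_trans)
  next
    case False
    obtain t' where t': "t < t'" "t' < tau_minus \<Omega> x \<xi>" using t dense by blast
    then have "x - t' *\<^sub>R \<xi> \<in> \<Omega>" using before_tau_minus False by auto
    with lim op have "\<forall>\<^sub>F n in F. X n - t' *\<^sub>R Z n \<in> \<Omega>" by (rule topological_tendstoD)
    then show ?thesis
    proof eventually_elim
      case (elim n)
      then have "t' \<le> tau_minus \<Omega> (X n) (Z n)" using le_tau_minus assms(2) closure_subset by blast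
      with t' show ?case by simp
    qed
  qed
  show "\<forall>\<^sub>F n in F. tau_minus \<Omega> (X n) (Z n) < t" if t: "tau_minus \<Omega> x \<xi> < t" for t
  proof -
    obtain t' where t': "t' < t" "tau_minus \<Omega> x \<xi> < t'" using t dense by blast
    have pos: "0 < t'" using tau_minus_nonneg[of \<xi> x] t' th through_def by auto
    have "x - t' *\<^sub>R \<xi> \<in> - closure \<Omega>" using after_tau_minus[OF th t'(2)] by simp
    then have "\<forall>\<^sub>F n in F. X n - t' *\<^sub>R Z n \<in> - closure \<Omega>"
      using topological_tendstoD[OF lim] by blast
    then show ?thesis
    proof eventually_elim
      case (elim n)
      then have "\<not> t' < tau_minus \<Omega> (X n) (Z n)"
        using before_tau_minus[OF pos, of "X n" "Z n"] closure_subset by auto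
      with t' show ?case by simp
    qed
  qed
qed

lemma entry_pt_tendsto:
  assumes "through x \<xi>" and "\<And>n. through (X n) (Z n)" "(X \<longlongrightarrow> x) F" "(Z \<longlongrightarrow> \<xi>) F"
  shows "((\<lambda>n. entry_pt \<Omega> (X n) (Z n)) \<longlongrightarrow> entry_pt \<Omega> x \<xi>) F"
  unfolding entry_pt_def by (intro tendsto_intros tau_minus_tendsto assms)

lemma tau_minus_le_tau_plus:
  assumes "through x \<xi>"
  shows "tau_minus \<Omega> x \<xi> \<le> tau_plus \<Omega> (entry_pt \<Omega> x \<xi>) \<xi>"
proof (rule le_tau_plus[OF bdd])
  show "\<xi> \<in> S1" using assms through_def by blast
  fix t assume "0 < t" "t < tau_minus \<Omega> x \<xi>"
  then show "entry_pt \<Omega> x \<xi> + t *\<^sub>R \<xi> \<in> \<Omega>"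
    using before_tau_minus[of "tau_minus \<Omega> x \<xi> - t" x \<xi>]
    by (simp add: entry_pt_def algebra_simps)
qed

lemma le_tau_plus_closure:
  assumes "\<xi> \<in> S1" "y \<in> \<Omega>" "0 \<le> s" "y + s *\<^sub>R \<xi> \<in> closure \<Omega>"
  shows "s \<le> tau_plus \<Omega> y \<xi>"
proof (rule le_tau_plus[OF bdd assms(1)])
  fix t assume "0 < t" "t < s"
  then show "y + t *\<^sub>R \<xi> \<in> \<Omega>"
    using line_between[OF op conv, of y 0 "- \<xi>" s t] assms by simp
qed

lemma tau_minus_le:
  assumes th: "through x \<xi>" and R: "\<And>y z. y \<in> \<Omega> \<Longrightarrow> z \<in> \<Omega> \<Longrightarrow> dist y z \<le> R"
  shows "tau_minus \<Omega> x \<xi> \<le> R"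
proof -
  have S1: "\<xi> \<in> S1" and xc: "x \<in> closure \<Omega>" using th through_def by auto
  have ec: "entry_pt \<Omega> x \<xi> \<in> closure \<Omega>" using entry_frontier(1)[OF th] frontier_def by blast
  have 1: "dist y z \<le> R" if "y \<in> \<Omega>" "z \<in> closure \<Omega>" for y z
    using continuous_le_on_closure[OF continuous_on_dist[OF continuous_on_const continuous_on_id] that(2), of y R] R that(1)
    by simp
  have "dist x (entry_pt \<Omega> x \<xi>) \<le> R"
    using continuous_le_on_closure[OF continuous_on_dist[OF continuous_on_id continuous_on_const] xc, of "entry_pt \<Omega> x \<xi>" R] 1 ec
    by simp
  then show ?thesis using S1 tau_minus_nonneg[OF S1, of x] by (simp add: entry_pt_def dist_norm)
qed

end

section \<open>Local graphs and the outer normal\<close>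

lemma C1_graph_frontier:
  assumes "open S" "z \<in> frontier S" "C1_graph_at S x r u v g g'" "z \<in> ball x r"
  shows "z \<bullet> v = g (z \<bullet> u)"
proof -
  have c: "r > 0" "\<And>s. (g has_real_derivative g' s) (at s)"
    "\<And>y. y \<in> ball x r \<Longrightarrow> y \<in> S \<longleftrightarrow> y \<bullet> v < g (y \<bullet> u)"
    using assms(3) unfolding C1_graph_at_def by auto
  show ?thesis
  proof (rule antisym)
    have "z \<notin> S" using assms(1,2) by (simp add: frontier_def interior_open)
    then show "g (z \<bullet> u) \<le> z \<bullet> v" using c(3)[OF assms(4)] by auto
    have "z \<in> closure S" using assms(2) by (simp add: frontier_def)
    then obtain y where y: "\<And>k. y k \<in> S" "y \<longlonglongrightarrow> z" by (metis closure_sequential)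
    have ev: "\<forall>\<^sub>F k in sequentially. y k \<bullet> v \<le> g (y k \<bullet> u)"
      using topological_tendstoD[OF y(2) open_ball assms(4)]
      by (rule eventually_mono) (use c(3) y(1) in \<open>fastforce simp: less_imp_le\<close>)
    have "isCont g (z \<bullet> u)" using c(2) DERIV_isCont by blast
    then have "(\<lambda>k. g (y k \<bullet> u)) \<longlonglongrightarrow> g (z \<bullet> u)"
      by (rule isCont_tendsto_compose) (intro tendsto_intros y)
    moreover have "(\<lambda>k. y k \<bullet> v) \<longlonglongrightarrow> z \<bullet> v" by (intro tendsto_intros y)
    ultimately show "z \<bullet> v \<le> g (z \<bullet> u)" by (rule tendsto_le[OF sequentially_bot _ _ ev])
  qed
qed

text \<open>The vector \<open>n\<close> is the normalised gradient of the defining function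
  \<open>y \<bullet> v - g (y \<bullet> u)\<close> of the chart. Along the ray this function is
  \<open>\<phi>\<close>, which starts at 0 with a derivative of the same sign as
  \<open>d \<bullet> n\<close>.\<close>

lemma C1_graph_dir:
  assumes "open S" "x \<in> frontier S" "C1_graph_at S x r u v g g'"
  defines "n \<equiv> (1 / sqrt (1 + (g' (x \<bullet> u))\<^sup>2)) *\<^sub>R (v - g' (x \<bullet> u) *\<^sub>R u)"
  shows "norm n = 1"
    and "d \<bullet> n < 0 \<Longrightarrow> \<forall>\<^sub>F t in at_right 0. x + t *\<^sub>R d \<in> S"
    and "d \<bullet> n > 0 \<Longrightarrow> \<forall>\<^sub>F t in at_right 0. x + t *\<^sub>R d \<notin> S"
proof -
  let ?m = "g' (x \<bullet> u)"
  have c: "r > 0" "norm u = 1" "norm v = 1" "u \<bullet> v = 0"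
    "\<And>s. (g has_real_derivative g' s) (at s)"
    "\<And>y. y \<in> ball x r \<Longrightarrow> y \<in> S \<longleftrightarrow> y \<bullet> v < g (y \<bullet> u)"
    using assms(3) unfolding C1_graph_at_def by auto
  have uu: "u \<bullet> u = 1" "v \<bullet> v = 1" using c by (simp_all add: norm_eq_1)
  have pos: "1 + ?m\<^sup>2 > 0" by (simp add: add_pos_nonneg)
  have "(v - ?m *\<^sub>R u) \<bullet> (v - ?m *\<^sub>R u) = 1 + ?m\<^sup>2"
    using uu c(4) by (simp add: inner_diff_left inner_diff_right inner_commute power2_eq_square)
  then have "norm (v - ?m *\<^sub>R u) = sqrt (1 + ?m\<^sup>2)" by (simp add: norm_eq_sqrt_inner)
  then show "norm n = 1" using pos by (simp add: n_def)
  have gx: "x \<bullet> v = g (x \<bullet> u)"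
    using C1_graph_frontier[OF assms(1-3)] c(1) by simp
  define \<phi> where "\<phi> t = (x + t *\<^sub>R d) \<bullet> v - g ((x + t *\<^sub>R d) \<bullet> u)" for t
  have \<phi>0: "\<phi> 0 = 0" by (simp add: \<phi>_def gx)
  have "((\<lambda>t. g (x \<bullet> u + t * (d \<bullet> u))) has_real_derivative ?m * (d \<bullet> u)) (at 0)"
    by (rule DERIV_chain2[where g="\<lambda>t. x \<bullet> u + t * (d \<bullet> u)"])
       (use c(5)[of "x \<bullet> u"] in \<open>auto intro!: derivative_eq_intros\<close>)
  then have D: "(\<phi> has_real_derivative d \<bullet> v - ?m * (d \<bullet> u)) (at 0)"
    unfolding \<phi>_def by (auto intro!: derivative_eq_intros simp: inner_add_left)
  have dn: "d \<bullet> n = (1 / sqrt (1 + ?m\<^sup>2)) * (d \<bullet> v - ?m * (d \<bullet> u))"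
    by (simp add: n_def inner_diff_right)
  have sg: "(d \<bullet> n < 0) = (d \<bullet> v - ?m * (d \<bullet> u) < 0)" "(d \<bullet> n > 0) = (d \<bullet> v - ?m * (d \<bullet> u) > 0)"
    unfolding dn using pos by (auto simp: divide_less_0_iff zero_less_divide_iff)
  have inb: "\<forall>\<^sub>F t in at_right 0. x + t *\<^sub>R d \<in> ball x r"
  proof -
    have "((\<lambda>t. x + t *\<^sub>R d) \<longlongrightarrow> x + 0 *\<^sub>R d) (at_right 0)" by (intro tendsto_intros)
    then show ?thesis using topological_tendstoD[OF _ open_ball, of _ x _ x r] c(1) by auto
  qed
  show "\<forall>\<^sub>F t in at_right 0. x + t *\<^sub>R d \<in> S" if dn0: "d \<bullet> n < 0"
  proof -
    obtain e where e: "e > 0" "\<And>h. 0 < h \<Longrightarrow> h < e \<Longrightarrow> \<phi> h < 0"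
      using DERIV_neg_dec_right[OF D] dn0 sg(1) \<phi>0 by auto
    have "\<forall>\<^sub>F t in at_right 0. t \<in> {0<..<e}" using eventually_at_right_real[OF e(1)] .
    with inb show ?thesis by eventually_elim (use e c(6) \<phi>_def in force)
  qed
  show "\<forall>\<^sub>F t in at_right 0. x + t *\<^sub>R d \<notin> S" if dn0: "d \<bullet> n > 0"
  proof -
    obtain e where e: "e > 0" "\<And>h. 0 < h \<Longrightarrow> h < e \<Longrightarrow> \<phi> h > 0"
      using DERIV_pos_inc_right[OF D] dn0 sg(2) \<phi>0 by auto
    have "\<forall>\<^sub>F t in at_right 0. t \<in> {0<..<e}" using eventually_at_right_real[OF e(1)] .
    with inb show ?thesis
    proof eventually_elim
      case (elim t)
      then have "\<phi> t > 0" using e by auto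
      then show ?case using c(6)[OF elim(1)] by (simp add: \<phi>_def)
    qed
  qed
qed

locale C1_convex_domain = convex_domain +
  assumes C1: "C1_boundary \<Omega>"
begin

text \<open>The description operator in \<open>outer_normal\<close> has to be justified across all
  charts at \<open>x\<close>. If two charts gave different unit normals \<open>n1\<close> and
  \<open>n2\<close>, the direction \<open>n2 - n1\<close> would point into the domain according to
  the first and out of it according to the second.\<close>

lemma outer_normal_props:
  assumes x: "x \<in> frontier \<Omega>"
  shows "d \<bullet> outer_normal \<Omega> x < 0 \<Longrightarrow> \<forall>\<^sub>F t in at_right 0. x + t *\<^sub>R d \<in> \<Omega>"
    and "d \<bullet> outer_normal \<Omega> x > 0 \<Longrightarrow> \<forall>\<^sub>F t in at_right 0. x + t *\<^sub>R d \<notin> \<Omega>"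
    and "norm (outer_normal \<Omega> x) = 1"
proof -
  let ?P = "\<lambda>n. \<exists>r u v g g'. C1_graph_at \<Omega> x r u v g g' \<and>
        n = (1 / sqrt (1 + (g' (x \<bullet> u))\<^sup>2)) *\<^sub>R (v - g' (x \<bullet> u) *\<^sub>R u)"
  have props: "norm n = 1" "d \<bullet> n < 0 \<Longrightarrow> \<forall>\<^sub>F t in at_right 0. x + t *\<^sub>R d \<in> \<Omega>"
     "d \<bullet> n > 0 \<Longrightarrow> \<forall>\<^sub>F t in at_right 0. x + t *\<^sub>R d \<notin> \<Omega>" if "?P n" for n d
    using that C1_graph_dir[OF op x] by blast+
  have uniq: "n1 = n2" if n: "?P n1" "?P n2" for n1 n2
  proof (rule ccontr)
    assume ne: "n1 \<noteq> n2"
    have u: "n1 \<bullet> n1 = 1" "n2 \<bullet> n2 = 1" using props(1) n by (simp_all add: norm_eq_1)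
    have "(n1 - n2) \<bullet> (n1 - n2) > 0" using ne by simp
    then have lt: "n1 \<bullet> n2 < 1" using u by (simp add: inner_diff_left inner_diff_right inner_commute)
    have "\<forall>\<^sub>F t in at_right 0. x + t *\<^sub>R (n2 - n1) \<in> \<Omega>"
      using lt u by (intro props(2)[OF n(1)]) (simp add: inner_diff_left inner_diff_right inner_commute)
    moreover have "\<forall>\<^sub>F t in at_right 0. x + t *\<^sub>R (n2 - n1) \<notin> \<Omega>"
      using lt u by (intro props(3)[OF n(2)]) (simp add: inner_diff_left inner_diff_right inner_commute)
    ultimately have "\<forall>\<^sub>F t in at_right (0::real). False" by eventually_elim auto
    then show False by simp
  qed
  have ex: "\<exists>n. ?P n" using C1 x unfolding C1_boundary_def by blast
  have "?P (outer_normal \<Omega> x)" unfolding outer_normal_def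
    using ex uniq by (intro theI'[of ?P]) blast
  then show "d \<bullet> outer_normal \<Omega> x < 0 \<Longrightarrow> \<forall>\<^sub>F t in at_right 0. x + t *\<^sub>R d \<in> \<Omega>"
    and "d \<bullet> outer_normal \<Omega> x > 0 \<Longrightarrow> \<forall>\<^sub>F t in at_right 0. x + t *\<^sub>R d \<notin> \<Omega>"
    and "norm (outer_normal \<Omega> x) = 1"
    using props by blast+
qed

text \<open>First-order information decides nothing for tangent directions. If \<open>d\<close> did
  not point inward but reached an interior point, a slight tilt of \<open>d\<close> towards the
  normal would still reach one, by openness, while the tilted ray starts outside the domain;
  convexity forbids that.\<close>

lemma outer_normal_less_iff:
  assumes x: "x \<in> frontier \<Omega>"
  shows "outer_normal \<Omega> x \<bullet> d < 0 \<longleftrightarrow> (\<exists>t>0. x + t *\<^sub>R d \<in> \<Omega>)"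
proof
  assume "outer_normal \<Omega> x \<bullet> d < 0"
  then have "\<forall>\<^sub>F t in at_right 0. x + t *\<^sub>R d \<in> \<Omega>"
    using outer_normal_props(1)[OF x] by (simp add: inner_commute)
  moreover have "\<forall>\<^sub>F t in at_right (0::real). 0 < t" by (simp add: eventually_at_filter)
  ultimately have "\<forall>\<^sub>F t in at_right (0::real). 0 < t \<and> x + t *\<^sub>R d \<in> \<Omega>" by eventually_elim auto
  from eventually_happens'[OF trivial_limit_at_right_real this]
  show "\<exists>t>0. x + t *\<^sub>R d \<in> \<Omega>" by auto
next
  assume "\<exists>t>0. x + t *\<^sub>R d \<in> \<Omega>"
  then obtain t where t: "t > 0" "x + t *\<^sub>R d \<in> \<Omega>" by blast
  have xc: "x \<in> closure \<Omega>" using x by (simp add: frontier_def)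
  show "outer_normal \<Omega> x \<bullet> d < 0"
  proof (rule ccontr)
    assume neg: "\<not> outer_normal \<Omega> x \<bullet> d < 0"
    have "((\<lambda>e. x + t *\<^sub>R (d + e *\<^sub>R outer_normal \<Omega> x)) \<longlongrightarrow> x + t *\<^sub>R (d + 0 *\<^sub>R outer_normal \<Omega> x)) (at_right 0)"
      by (intro tendsto_intros)
    then have "\<forall>\<^sub>F e in at_right 0. x + t *\<^sub>R (d + e *\<^sub>R outer_normal \<Omega> x) \<in> \<Omega>"
      using topological_tendstoD[OF _ op] t(2) by fastforce
    moreover have "\<forall>\<^sub>F t in at_right (0::real). 0 < t" by (simp add: eventually_at_filter)
    ultimately have "\<forall>\<^sub>F e in at_right (0::real). 0 < e \<and> x + t *\<^sub>R (d + e *\<^sub>R outer_normal \<Omega> x) \<in> \<Omega>"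
      by eventually_elim auto
    from eventually_happens'[OF trivial_limit_at_right_real this] obtain e
      where e: "e > 0" "x + t *\<^sub>R (d + e *\<^sub>R outer_normal \<Omega> x) \<in> \<Omega>" by blast
    define d' where "d' = d + e *\<^sub>R outer_normal \<Omega> x"
    have "d' \<bullet> outer_normal \<Omega> x > 0"
      using neg e(1) outer_normal_props(3)[OF x]
      by (simp add: d'_def inner_add_left inner_commute[of d] norm_eq_1 add_nonneg_pos)
    then have "\<forall>\<^sub>F s in at_right 0. x + s *\<^sub>R d' \<notin> \<Omega>" by (rule outer_normal_props(2)[OF x])
    moreover have "\<forall>\<^sub>F s in at_right 0. s \<in> {0<..<t}" using eventually_at_right_real[OF t(1)] .
    ultimately have "\<forall>\<^sub>F s in at_right (0::real). False"
    proof eventually_elim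
      case (elim s)
      then show ?case using line_between[OF op conv, of x t "- d'" 0 s] e(2)[folded d'_def] xc by auto
    qed
    then show False by simp
  qed
qed

lemma Gamma_minus_iff:
  "(x, \<xi>) \<in> Gamma_minus \<Omega> \<longleftrightarrow> x \<in> frontier \<Omega> \<and> \<xi> \<in> S1 \<and> (\<exists>t>0. x + t *\<^sub>R \<xi> \<in> \<Omega>)"
  unfolding Gamma_minus_def using outer_normal_less_iff by auto

lemma Gamma_plus_iff:
  "(x, \<xi>) \<in> Gamma_plus \<Omega> \<longleftrightarrow> x \<in> frontier \<Omega> \<and> \<xi> \<in> S1 \<and> (\<exists>t>0. x - t *\<^sub>R \<xi> \<in> \<Omega>)"
  unfolding Gamma_plus_def using outer_normal_less_iff[of x "- \<xi>"] by auto

lemma phase_D_bar_eq: "(x, \<xi>) \<in> phase_D_bar \<Omega> \<longleftrightarrow> through x \<xi>"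
proof
  assume "(x, \<xi>) \<in> phase_D_bar \<Omega>"
  then consider "x \<in> \<Omega>" "\<xi> \<in> S1" | "(x, \<xi>) \<in> Gamma_minus \<Omega>" | "(x, \<xi>) \<in> Gamma_plus \<Omega>"
    by (auto simp: phase_D_bar_def phase_D_def)
  then show "through x \<xi>"
  proof cases
    case 1 then show ?thesis by (rule through_Omega)
  next
    case 2
    then obtain t where "x \<in> frontier \<Omega>" "\<xi> \<in> S1" "x - (-t) *\<^sub>R \<xi> \<in> \<Omega>"
      by (auto simp: Gamma_minus_iff)
    then show ?thesis unfolding through_def frontier_def by blast
  next
    case 3
    then show ?thesis unfolding through_def Gamma_plus_iff frontier_def by blast
  qed
next
  assume th: "through x \<xi>"
  show "(x, \<xi>) \<in> phase_D_bar \<Omega>"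
  proof (cases "x \<in> \<Omega>")
    case True then show ?thesis using th by (auto simp: phase_D_bar_def phase_D_def through_def)
  next
    case False
    then have x: "x \<in> frontier \<Omega>" "\<xi> \<in> S1" using th op
      by (simp_all add: frontier_def interior_open through_def)
    obtain t where t: "x - t *\<^sub>R \<xi> \<in> \<Omega>" using th through_def by blast
    have "t \<noteq> 0" using t False by auto
    \<comment> \<open>The interior point lies behind \<open>x\<close> at an outgoing boundary point
      and ahead of it at an incoming one.\<close>
    then consider "t > 0" | "- t > 0" by linarith
    then show ?thesis
    proof cases
      case 1 then show ?thesis using t x Gamma_plus_iff by (auto simp: phase_D_bar_def)
    next
      case 2 
      have "(x, \<xi>) \<in> Gamma_minus \<Omega>" using t x 2 Gamma_minus_iff by (metis diff_minus_eq_add minus_minus scaleR_minus_left)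
      then show ?thesis by (auto simp: phase_D_bar_def phase_D_def)
    qed
  qed
qed

lemma entry_Gamma_minus: "through x \<xi> \<Longrightarrow> (entry_pt \<Omega> x \<xi>, \<xi>) \<in> Gamma_minus \<Omega>"
  using entry_frontier[of x \<xi>] by (auto simp: Gamma_minus_iff through_def)

end

section \<open>Integration lemmas\<close>

text \<open>Dominated convergence for a limit that is known only up to the error \<open>c\<close>.
  It is applied to the excess \<open>h\<close>, the part of the distance beyond \<open>c\<close>,
  which does tend to 0.\<close>

lemma integral_limsup_le:
  fixes f :: "nat \<Rightarrow> 'q \<Rightarrow> real"
  assumes int: "\<And>n. integrable M (f n)" "integrable M g" "integrable M c" "integrable M B"
    and bound: "\<And>n. AE q in M. \<bar>f n q\<bar> \<le> B q"
    and lim: "AE q in M. \<forall>\<epsilon>>0. \<forall>\<^sub>F n in sequentially. \<bar>f n q - g q\<bar> \<le> c q + \<epsilon>"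
    and \<epsilon>: "\<epsilon> > 0"
  shows "\<forall>\<^sub>F n in sequentially. \<bar>(\<integral>q. f n q \<partial>M) - (\<integral>q. g q \<partial>M)\<bar> \<le> (\<integral>q. c q \<partial>M) + \<epsilon>"
proof -
  define h where "h n q = max 0 (\<bar>f n q - g q\<bar> - c q)" for n q
  have h_int: "integrable M (h n)" for n unfolding h_def using int by (intro integrable_max) auto
  have "(\<lambda>n. \<integral>q. h n q \<partial>M) \<longlonglongrightarrow> (\<integral>q. 0 \<partial>M)"
  proof (rule integral_dominated_convergence[where w="\<lambda>q. B q + \<bar>g q\<bar> + \<bar>c q\<bar>"])
    show "integrable M (\<lambda>q. B q + \<bar>g q\<bar> + \<bar>c q\<bar>)" using int by auto
    show "h n \<in> borel_measurable M" for n using h_int by auto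
    show "AE q in M. norm (h n q) \<le> B q + \<bar>g q\<bar> + \<bar>c q\<bar>" for n
      using bound[of n] by eventually_elim (auto simp: h_def)
    show "AE q in M. (\<lambda>n. h n q) \<longlonglongrightarrow> 0"
      using lim
    proof eventually_elim
      case (elim q)
      show ?case
      proof (rule tendstoI)
        fix e :: real assume "e > 0"
        then have "\<forall>\<^sub>F n in sequentially. \<bar>f n q - g q\<bar> \<le> c q + e/2" using elim by auto
        then show "\<forall>\<^sub>F n in sequentially. dist (h n q) 0 < e"
          by eventually_elim (use \<open>e > 0\<close> in \<open>auto simp: h_def dist_real_def\<close>)
      qed
    qed
  qed auto
  then have "\<forall>\<^sub>F n in sequentially. (\<integral>q. h n q \<partial>M) < \<epsilon>" using \<epsilon> by (intro order_tendstoD) auto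
  then show ?thesis
  proof eventually_elim
    case (elim n)
    have "\<bar>(\<integral>q. f n q \<partial>M) - (\<integral>q. g q \<partial>M)\<bar> = \<bar>\<integral>q. f n q - g q \<partial>M\<bar>" using int by simp
    also have "\<dots> \<le> (\<integral>q. \<bar>f n q - g q\<bar> \<partial>M)" by (rule integral_abs_bound)
    also have "\<dots> \<le> (\<integral>q. c q + h n q \<partial>M)"
      using int h_int by (intro integral_mono) (auto simp: h_def)
    also have "\<dots> = (\<integral>q. c q \<partial>M) + (\<integral>q. h n q \<partial>M)" using int h_int by simp
    finally show ?case using elim by simp
  qed
qed

text \<open>Formally \<open>exp (- H)\<close> has derivative \<open>- h * exp (- H)\<close>, but
  \<open>h\<close> is only bounded and measurable, so \<open>H\<close> need not be differentiable
  everywhere. The sum \<open>\<Phi>\<close> of the integral and \<open>exp (- H)\<close>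
  nevertheless has increments of second order, hence derivative 0 at every point, and is
  constant.\<close>

lemma integral_attenuation:
  fixes h :: "real \<Rightarrow> real"
  assumes [measurable]: "h \<in> borel_measurable lebesgue"
    and h: "\<And>t. 0 \<le> h t" "\<And>t. h t \<le> C" and T: "0 \<le> T"
  defines "H \<equiv> \<lambda>t. LINT r:{0..t}|lebesgue. h r"
  shows "(LINT s:{0..T}|lebesgue. h s * exp (- H s)) = 1 - exp (- H T)"
proof -
  have C: "0 \<le> C" using h[of 0] by linarith
  have lm [simp]: "{a<..b} \<in> lmeasurable" for a b :: real
    by (rule bounded_set_imp_lmeasurable)
      (auto intro: bounded_subset[OF bounded_closed_interval[of a b]])
  have bdd_int: "set_integrable lebesgue A f"
    if "f \<in> borel_measurable lebesgue" "A \<in> lmeasurable" "\<And>s. \<bar>f s\<bar> \<le> C" for f :: "real \<Rightarrow> real" and A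
  proof -
    have m: "A \<in> sets lebesgue" using that(2) by auto
    have "set_integrable lebesgue A (\<lambda>_. C)" using that(2) m
      by (simp add: set_integrable_def integrable_mult_left fmeasurable_def)
    then show ?thesis
      by (rule set_integrable_bound) (use that m in \<open>auto simp: set_borel_measurable_def intro!: AE_I2 intro: order_trans[OF _ abs_ge_self]\<close>)
  qed
  have h_int: "set_integrable lebesgue A h" if "A \<in> lmeasurable" for A
    by (rule bdd_int) (use that h in auto)
  have split: "(LINT r:{0..b}|lebesgue. f r) = (LINT r:{0..a}|lebesgue. f r) + (LINT r:{a<..b}|lebesgue. f r)"
    if "0 \<le> a" "a \<le> b" "\<And>A. A \<in> lmeasurable \<Longrightarrow> set_integrable lebesgue A f" for a b and f :: "real \<Rightarrow> real"
  proof -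
    have "{0..b} = {0..a} \<union> {a<..b}" using that(1,2) by auto
    moreover have "{0..a} \<inter> {a<..b} = {}" by auto
    moreover have "set_integrable lebesgue {0..a} f" "set_integrable lebesgue {a<..b} f"
      using that(3) by simp_all
    ultimately show ?thesis using set_integral_Un by metis
  qed
  have Hdiff: "H b - H a = (LINT r:{a<..b}|lebesgue. h r)" if "0 \<le> a" "a \<le> b" for a b
    unfolding H_def by (subst split[OF that h_int]) simp_all
  have c_int: "(LINT r:{a<..b}|lebesgue. c) = c * (b - a)" if "a \<le> b" for a b c :: real
    using that by (simp add: set_lebesgue_integral_def)
  have Hb: "0 \<le> H b - H a" "H b - H a \<le> C * (b - a)" if "0 \<le> a" "a \<le> b" for a b
  proof -
    show "0 \<le> H b - H a" unfolding Hdiff[OF that] set_lebesgue_integral_def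
      by (rule integral_nonneg_AE) (auto simp: h)
    have "(LINT r:{a<..b}|lebesgue. h r) \<le> (LINT r:{a<..b}|lebesgue. C)"
      by (rule set_integral_mono) (use h h_int bdd_int C in auto)
    then show "H b - H a \<le> C * (b - a)" using Hdiff[OF that] c_int that by simp
  qed
  have null0: "(LINT s:{0..0::real}|lebesgue. f s) = 0" for f :: "real \<Rightarrow> real"
  proof -
    have "AE s in lebesgue. s \<noteq> (0::real)" by (intro AE_completion AE_lborel_singleton)
    then have "AE s in lebesgue. indicator {0..0::real} s *\<^sub>R f s = 0" by eventually_elim auto
    then show ?thesis unfolding set_lebesgue_integral_def by (rule integral_eq_zero_AE)
  qed
  have H0: "H 0 = 0" unfolding H_def by (rule null0)
  \<comment> \<open>Clamping the argument of \<open>H\<close> at 0 makes the attenuation monotone on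
    the whole line by \<open>Hb\<close>, hence Borel measurable.\<close>
  define k where "k s = h s * exp (- H (max 0 s))" for s
  have H_mono: "H (max 0 a) \<le> H (max 0 b)" if "a \<le> b" for a b
    using Hb(1)[of "max 0 a" "max 0 b"] that by auto
  have [measurable]: "(\<lambda>s. H (max 0 s)) \<in> borel_measurable borel"
    by (rule borel_measurable_mono) (use H_mono in \<open>auto simp: mono_def\<close>)
  then have [measurable]: "(\<lambda>s. H (max 0 s)) \<in> borel_measurable lebesgue"
    by (simp add: measurable_completion)
  have k_meas: "k \<in> borel_measurable lebesgue" unfolding k_def by measurable
  have e1: "exp (- H (max 0 s)) \<le> 1" for s using H_mono[of "min 0 s" s] H0 by auto
  have k_bd: "\<bar>k s\<bar> \<le> C" for s
    using mult_mono[OF h(2)[of s] e1[of s]] h C by (simp add: k_def abs_mult)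
  have k_int: "set_integrable lebesgue A k" if "A \<in> lmeasurable" for A
    by (rule bdd_int[OF k_meas that k_bd])
  define \<Phi> where "\<Phi> t = (LINT s:{0..t}|lebesgue. k s) + exp (- H t)" for t
  \<comment> \<open>The integral of \<open>k\<close> over the interval and the drop of
    \<open>exp (- H)\<close> both lie between \<open>exp (- H b)\<close> and
    \<open>exp (- H a)\<close> times the increment of \<open>H\<close>. Their difference is
    therefore at most a product of two quantities of first order.\<close>
  have est: "\<bar>\<Phi> b - \<Phi> a\<bar> \<le> C\<^sup>2 * (b - a)\<^sup>2" if ab: "0 \<le> a" "a \<le> b" for a b
  proof -
    let ?\<delta> = "H b - H a" and ?J = "LINT s:{a<..b}|lebesgue. k s"
    have hs: "k s \<le> exp (- H a) * h s" "exp (- H b) * h s \<le> k s" if "s \<in> {a<..b}" for s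
    proof -
      have "H a \<le> H (max 0 s)" "H (max 0 s) \<le> H b"
        using H_mono[of a s] H_mono[of s b] that ab by auto
      then have "exp (- H (max 0 s)) \<le> exp (- H a)" "exp (- H b) \<le> exp (- H (max 0 s))" by auto
      from this[THEN mult_right_mono, OF h(1)[of s]]
      show "k s \<le> exp (- H a) * h s" "exp (- H b) * h s \<le> k s"
        by (simp_all add: k_def mult.commute)
    qed
    have up: "?J \<le> (LINT s:{a<..b}|lebesgue. exp (- H a) * h s)"
      by (intro set_integral_mono k_int set_integrable_mult_right h_int hs) auto
    have lo: "?J \<ge> (LINT s:{a<..b}|lebesgue. exp (- H b) * h s)"
      by (intro set_integral_mono k_int set_integrable_mult_right h_int hs) auto
    have J: "exp (- H b) * ?\<delta> \<le> ?J" "?J \<le> exp (- H a) * ?\<delta>"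
      using up lo Hdiff[OF ab] by simp_all
    have "exp (- H b) * (1 + ?\<delta>) \<le> exp (- H b) * exp ?\<delta>"
      by (intro mult_left_mono exp_ge_add_one_self) auto
    then have E1: "exp (- H b) * ?\<delta> \<le> exp (- H a) - exp (- H b)"
      by (simp add: exp_add[symmetric] distrib_left)
    have "exp (- H a) * (1 + - ?\<delta>) \<le> exp (- H a) * exp (- ?\<delta>)"
      by (intro mult_left_mono exp_ge_add_one_self) auto
    then have E2: "exp (- H a) - exp (- H b) \<le> exp (- H a) * ?\<delta>"
      by (simp add: exp_add[symmetric] algebra_simps)
    have ea: "exp (- H a) \<le> 1" using e1[of a] ab by simp
    have d: "0 \<le> ?\<delta>" using Hb[OF ab] by simp
    have "exp (- H a) - exp (- H b) \<le> ?\<delta>"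
      using E2 mult_right_mono[OF ea d] by simp
    then have "(exp (- H a) - exp (- H b)) * ?\<delta> \<le> ?\<delta> * ?\<delta>" by (rule mult_right_mono[OF _ d])
    moreover have "\<bar>\<Phi> b - \<Phi> a\<bar> \<le> (exp (- H a) - exp (- H b)) * ?\<delta>"
      using J E1 E2 split[OF ab k_int] by (simp add: \<Phi>_def left_diff_distrib abs_le_iff)
    moreover have "?\<delta> * ?\<delta> \<le> (C * (b - a)) * (C * (b - a))"
      using Hb[OF ab] C ab by (intro mult_mono) auto
    ultimately show ?thesis by (simp add: power2_eq_square algebra_simps)
  qed
  have est': "\<bar>\<Phi> b - \<Phi> a\<bar> \<le> C\<^sup>2 * (b - a)\<^sup>2" if "0 \<le> a" "0 \<le> b" for a b
  proof (cases "a \<le> b")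
    case False
    then show ?thesis using est[of b a] that by (simp add: abs_minus_commute power2_commute[of a])
  qed (use est that in simp)
  have "(\<Phi> has_field_derivative 0) (at a within {0..})" if a: "a \<in> {0..}" for a
    unfolding has_field_derivative_iff
  proof (rule tendsto_rabs_zero_cancel, rule tendsto_sandwich[OF _ _ tendsto_const])
    show "\<forall>\<^sub>F b in at a within {0..}. 0 \<le> \<bar>(\<Phi> b - \<Phi> a) / (b - a)\<bar>" by simp
    show "\<forall>\<^sub>F b in at a within {0..}. \<bar>(\<Phi> b - \<Phi> a) / (b - a)\<bar> \<le> C\<^sup>2 * \<bar>b - a\<bar>"
      unfolding eventually_at_filter
    proof (intro always_eventually allI impI)
      fix b assume b: "b \<noteq> a" "b \<in> {0..}"
      have "\<bar>(\<Phi> b - \<Phi> a) / (b - a)\<bar> = \<bar>\<Phi> b - \<Phi> a\<bar> / \<bar>b - a\<bar>" by simp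
      also have "\<dots> \<le> C\<^sup>2 * (b - a)\<^sup>2 / \<bar>b - a\<bar>"
        using est'[of a b] a b by (intro divide_right_mono) auto
      also have "\<dots> = C\<^sup>2 * \<bar>b - a\<bar>"
        using b by (cases "a < b") (simp_all add: power2_eq_square, simp add: field_simps)
      finally show "\<bar>(\<Phi> b - \<Phi> a) / (b - a)\<bar> \<le> C\<^sup>2 * \<bar>b - a\<bar>" .
    qed
    have "((\<lambda>b. C\<^sup>2 * \<bar>b - a\<bar>) \<longlongrightarrow> C\<^sup>2 * \<bar>a - a\<bar>) (at a within {0..})"
      by (intro tendsto_intros)
    then show "((\<lambda>b. C\<^sup>2 * \<bar>b - a\<bar>) \<longlongrightarrow> 0) (at a within {0..})" by simp
  qed
  then have "\<exists>c. \<forall>x\<in>{0..}. \<Phi> x = c"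
    by (intro has_field_derivative_zero_constant) auto
  then have "\<Phi> T = \<Phi> 0" using T by auto
  moreover have "\<Phi> 0 = 1" by (simp only: \<Phi>_def H0 null0) simp
  moreover have "(LINT s:{0..T}|lebesgue. k s) = (LINT s:{0..T}|lebesgue. h s * exp (- H s))"
    by (rule set_lebesgue_integral_cong) (auto simp: k_def)
  ultimately show ?thesis by (simp add: \<Phi>_def)
qed

section \<open>Arc length on the circle in terms of the polar angle\<close>

definition dirv :: "real \<Rightarrow> real^2" where
  "dirv \<theta> = vector [cos \<theta>, sin \<theta>]"

lemma dirv_nth [simp]: "dirv \<theta> $ 1 = cos \<theta>" "dirv \<theta> $ 2 = sin \<theta>"
  by (simp_all add: dirv_def)

lemma norm_dirv [simp]: "norm (dirv \<theta>) = 1"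
  by (simp add: norm_eq_sqrt_inner inner_vec_def sum_2)

lemma dirv_S1 [simp]: "dirv \<theta> \<in> S1"
  by simp

lemma continuous_dirv: "continuous_on UNIV dirv"
proof -
  have eq: "dirv = (\<lambda>\<theta>. \<chi> i. if i = 1 then cos \<theta> else sin \<theta>)"
    by (simp add: fun_eq_iff vec_eq_iff forall_2)
  have cont: "continuous_on UNIV (\<lambda>\<theta>. if i = 1 then cos \<theta> else sin \<theta> :: real)" for i :: 2
    by (cases "i = 1") (auto intro!: continuous_intros)
  show ?thesis unfolding eq by (intro continuous_on_vec_lambda cont)
qed

lemma dirv_measurable [measurable]: "dirv \<in> borel_measurable borel"
  by (rule borel_measurable_continuous_onI[OF continuous_dirv])

lemma circle_measure_eq:
  "circle_measure = completion (distr (restrict_space lborel {0..<2*pi}) borel dirv)"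
  by (simp add: circle_measure_def dirv_def[abs_def])

lemma dirv_measurable' [measurable]:
  "dirv \<in> restrict_space lborel {0..<2*pi} \<rightarrow>\<^sub>M borel"
  by (rule measurable_restrict_space1) simp

lemma AE_circle_measure_S1: "AE \<xi> in circle_measure. \<xi> \<in> S1"
proof -
  have "{x \<in> space borel. x \<in> (S1 :: (real^2) set)} \<in> sets borel"
    using closed_sphere[of "0 :: real^2" 1] by (simp add: borel_closed)
  then show ?thesis unfolding circle_measure_eq
    by (intro AE_completion) (simp add: AE_distr_iff del: mem_sphere_0)
qed

lemma finite_circle_measure: "finite_measure circle_measure"
proof
  have "emeasure circle_measure (space circle_measure)
      = emeasure (restrict_space lborel {0..<2*pi}) {0..<2*pi}"
    by (simp add: circle_measure_eq emeasure_distr space_restrict_space)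
  also have "\<dots> = ennreal (2 * pi)" by (subst emeasure_restrict_space) auto
  finally show "emeasure circle_measure (space circle_measure) \<noteq> \<infinity>" by simp
qed

lemma dirv_inj: "inj_on dirv {0..<2*pi}"
proof (rule inj_onI)
  fix a b assume ab: "a \<in> {0..<2*pi}" "b \<in> {0..<2*pi}" "dirv a = dirv b"
  have "cos a = cos b" "sin a = sin b" using ab(3) dirv_nth by metis+
  then have "exp (\<i> * complex_of_real a) = exp (\<i> * complex_of_real b)"
    by (simp only: exp_Euler cos_of_real sin_of_real)
  moreover have "Arg2pi (exp (\<i> * complex_of_real c)) = c" if "c \<in> {0..<2*pi}" for c
    by (subst Arg2pi_exp) (use that in auto)
  ultimately show "a = b" using ab(1,2) by metis
qed

lemma AE_circle_measure_finite:
  assumes "finite A"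
  shows "AE \<xi> in circle_measure. \<xi> \<notin> A"
proof -
  have "finite (dirv -` A \<inter> {0..<2*pi})"
    using finite_vimage_IntI[OF assms dirv_inj] .
  then have "emeasure lborel (dirv -` A \<inter> {0..<2*pi}) = 0" by (intro emeasure_lborel_countable countable_finite)
  moreover have "emeasure (distr (restrict_space lborel {0..<2*pi}) borel dirv) A
      = emeasure (restrict_space lborel {0..<2*pi}) (dirv -` A \<inter> {0..<2*pi})"
    using assms by (subst emeasure_distr) (auto simp: space_restrict_space finite_imp_closed)
  ultimately have "emeasure (distr (restrict_space lborel {0..<2*pi}) borel dirv) A = 0"
    using emeasure_restrict_space[of "{0..<2*pi}" lborel "dirv -` A \<inter> {0..<2*pi}"] by simp
  then have "A \<in> null_sets (distr (restrict_space lborel {0..<2*pi}) borel dirv)"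
    using assms by (auto intro!: null_setsI simp: finite_imp_closed)
  then show ?thesis unfolding circle_measure_eq by (intro AE_completion AE_not_in)
qed

text \<open>As \<open>circle_measure\<close> is a completion, \<open>f\<close> is replaced by a
  Borel function \<open>f'\<close> equal to it almost everywhere before it is pulled back along
  \<open>dirv\<close>. The angle 0 is dropped from the interval because it is the branch cut of
  \<open>Arg2pi\<close> in the later change of variables.\<close>

lemma circle_measure_integral:
  fixes f :: "real^2 \<Rightarrow> real"
  assumes "integrable circle_measure f"
  shows "(\<lambda>\<theta>. f (dirv \<theta>)) absolutely_integrable_on {0<..<2*pi}"
    and "integral {0<..<2*pi} (\<lambda>\<theta>. f (dirv \<theta>)) = (\<integral>\<xi>. f \<xi> \<partial>circle_measure)"
proof -
  let ?N = "distr (restrict_space lborel {0..<2*pi}) borel dirv"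
  obtain f' where f': "f' \<in> borel_measurable ?N" "AE x in ?N. f x = f' x"
    using completion_ex_borel_measurable_real[of f ?N] assms
    unfolding circle_measure_eq by blast
  then have f'b [measurable]: "f' \<in> borel_measurable borel" by simp
  have ae: "AE x in circle_measure. f x = f' x"
    unfolding circle_measure_eq using f'(2) by (rule AE_completion)
  have m: "f' \<in> borel_measurable circle_measure"
    unfolding circle_measure_eq using f'(1) by (rule measurable_completion)
  have "integrable circle_measure f'"
    using assms integrable_cong_AE[OF _ m ae] by auto
  then have "integrable ?N f'" 
    unfolding circle_measure_eq by (subst (asm) integrable_completion) (use f' in auto)
  then have "integrable (restrict_space lborel {0..<2*pi}) (\<lambda>\<theta>. f' (dirv \<theta>))"
    by (subst (asm) integrable_distr_eq) auto
  then have i1: "set_integrable lborel {0..<2*pi} (\<lambda>\<theta>. f' (dirv \<theta>))"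
    by (subst (asm) integrable_restrict_space) (auto simp: set_integrable_def)
  have bm: "(\<lambda>\<theta>. indicator {0..<2*pi} \<theta> *\<^sub>R f' (dirv \<theta>)) \<in> borel_measurable lborel" by measurable
  have i2: "(\<lambda>\<theta>. f' (dirv \<theta>)) absolutely_integrable_on {0..<2*pi}"
    using i1 bm by (simp add: set_integrable_def integrable_completion)
  have "(\<integral>\<xi>. f \<xi> \<partial>circle_measure) = (\<integral>\<xi>. f' \<xi> \<partial>circle_measure)"
    using assms m ae by (intro integral_cong_AE) auto
  also have "\<dots> = (\<integral>\<xi>. f' \<xi> \<partial>?N)"
    unfolding circle_measure_eq using f' by (simp add: integral_completion)
  also have "\<dots> = (\<integral>\<theta>. f' (dirv \<theta>) \<partial>restrict_space lborel {0..<2*pi})"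
    by (rule integral_distr) auto
  also have "\<dots> = (LINT \<theta>:{0..<2*pi}|lborel. f' (dirv \<theta>))"
    by (subst integral_restrict_space) (auto simp: set_lebesgue_integral_def)
  also have "\<dots> = (LINT \<theta>:{0..<2*pi}|lebesgue. f' (dirv \<theta>))"
    unfolding set_lebesgue_integral_def using bm by (simp add: integral_completion)
  also have "\<dots> = integral {0..<2*pi} (\<lambda>\<theta>. f' (dirv \<theta>))"
    using i2 by (rule set_lebesgue_integral_eq_integral)
  finally have I: "(\<integral>\<xi>. f \<xi> \<partial>circle_measure) = integral {0..<2*pi} (\<lambda>\<theta>. f' (dirv \<theta>))" .
  have "AE \<theta> in restrict_space lborel {0..<2*pi}. f (dirv \<theta>) = f' (dirv \<theta>)"
    using f'(2) by (rule AE_distrD[rotated]) measurable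
  then have "AE \<theta> in lborel. \<theta> \<in> {0..<2*pi} \<longrightarrow> f (dirv \<theta>) = f' (dirv \<theta>)"
    by (subst (asm) AE_restrict_space_iff) auto
  then have "AE \<theta> in lebesgue. \<theta> \<in> {0..<2*pi} \<longrightarrow> f (dirv \<theta>) = f' (dirv \<theta>)"
    by (rule AE_completion)
  then have neg: "negligible {\<theta> \<in> {0..<2*pi}. f (dirv \<theta>) \<noteq> f' (dirv \<theta>)}"
    unfolding eventually_ae_filter_negligible by (auto intro: negligible_subset)
  have i3: "(\<lambda>\<theta>. f (dirv \<theta>)) absolutely_integrable_on {0..<2*pi}"
    by (rule absolutely_integrable_spike[OF i2 neg]) auto
  show "(\<lambda>\<theta>. f (dirv \<theta>)) absolutely_integrable_on {0<..<2*pi}"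
    by (rule set_integrable_subset[OF i3]) auto
  have "integral {0<..<2*pi} (\<lambda>\<theta>. f (dirv \<theta>)) = integral {0..<2*pi} (\<lambda>\<theta>. f (dirv \<theta>))"
    by (rule integral_spike_set) (auto intro: negligible_subset[of "{0}"])
  also have "\<dots> = integral {0..<2*pi} (\<lambda>\<theta>. f' (dirv \<theta>))"
    by (rule integral_spike[OF neg]) auto
  finally show "integral {0<..<2*pi} (\<lambda>\<theta>. f (dirv \<theta>)) = (\<integral>\<xi>. f \<xi> \<partial>circle_measure)"
    using I by simp
qed

section \<open>The mild formulation\<close>

text \<open>A product rule for oscillations: a convergent factor merely multiplies the oscillation
  of the other factor by its limit. It serves both for kernel times scattering term and for phase
  function times solution.\<close>

lemma limsup_mult_le:
  fixes a S :: "nat \<Rightarrow> real"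
  assumes a: "a \<longlonglongrightarrow> a0" "0 \<le> a0" and S: "\<forall>\<^sub>F n in sequentially. \<bar>S n\<bar> \<le> B"
    and W: "\<And>\<epsilon>. \<epsilon> > 0 \<Longrightarrow> \<forall>\<^sub>F n in sequentially. \<bar>S n - S0\<bar> \<le> W + \<epsilon>"
    and \<epsilon>: "\<epsilon> > 0"
  shows "\<forall>\<^sub>F n in sequentially. \<bar>a n * S n - a0 * S0\<bar> \<le> a0 * W + \<epsilon>"
proof -
  \<comment> \<open>The added 1, here and in \<open>\<eta>\<close>, keeps the denominators positive
    when \<open>a0\<close> or \<open>B\<close> is 0.\<close>
  define \<delta> where "\<delta> = \<epsilon> / (2 * (a0 + 1))"
  have \<delta>: "\<delta> > 0" "a0 * \<delta> \<le> \<epsilon> / 2" using a(2) \<epsilon> by (auto simp: \<delta>_def field_simps)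
  define \<eta> where "\<eta> = \<epsilon> / (2 * (\<bar>B\<bar> + 1))"
  have \<eta>: "\<eta> > 0" "\<eta> * \<bar>B\<bar> \<le> \<epsilon> / 2" using \<epsilon> by (auto simp: \<eta>_def field_simps)
  have "\<forall>\<^sub>F n in sequentially. dist (a n) a0 < \<eta>" using tendstoD[OF a(1) \<eta>(1)] .
  with W[OF \<delta>(1)] S show ?thesis
  proof eventually_elim
    case (elim n)
    have "a n * S n - a0 * S0 = (a n - a0) * S n + a0 * (S n - S0)" by (simp add: algebra_simps)
    then have "\<bar>a n * S n - a0 * S0\<bar> \<le> \<bar>a n - a0\<bar> * \<bar>S n\<bar> + a0 * \<bar>S n - S0\<bar>"
      using abs_triangle_ineq[of "(a n - a0) * S n" "a0 * (S n - S0)"] a(2) by (simp add: abs_mult)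
    also have "\<dots> \<le> \<eta> * \<bar>B\<bar> + a0 * (W + \<delta>)"
      using elim a(2) by (intro add_mono mult_mono mult_left_mono) (auto simp: dist_real_def)
    also have "\<dots> \<le> a0 * W + \<epsilon>" using \<eta>(2) \<delta>(2) by (simp add: distrib_left)
    finally show ?case .
  qed
qed

lemma two_points_on_segment:
  fixes a b :: "'a::real_vector"
  assumes "x \<in> open_segment a b" "y \<in> open_segment a b"
  obtains c where "y - x = c *\<^sub>R (b - a)"
proof -
  obtain u v where uv: "x = (1 - u) *\<^sub>R a + u *\<^sub>R b" "y = (1 - v) *\<^sub>R a + v *\<^sub>R b"
    using assms by (auto simp: in_segment)
  have "y - x = (v - u) *\<^sub>R (b - a)" unfolding uv by (simp add: algebra_simps)
  then show thesis by (rule that)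
qed

lemma integrable_indicator_const: "integrable lebesgue (\<lambda>r. indicator {a..b::real} r * (c::real))"
  by (intro integrable_mult_left integrable_real_indicator) (auto simp: emeasure_lborel_Icc_eq)

lemma integrable_indicator_bounded:
  fixes h :: "real \<Rightarrow> real"
  assumes "h \<in> borel_measurable lebesgue" "\<And>t. \<bar>h t\<bar> \<le> C"
  shows "integrable lebesgue (\<lambda>r. indicator {a..b} r * h r)"
proof (rule Bochner_Integration.integrable_bound[OF integrable_indicator_const[of a b C]])
  show "(\<lambda>r. indicator {a..b} r * h r) \<in> borel_measurable lebesgue"
    by (intro borel_measurable_times borel_measurable_indicator assms) auto
  show "AE r in lebesgue. norm (indicator {a..b} r * h r) \<le> norm (indicator {a..b} r * C)"
    using assms(2) by (intro AE_I2) (auto simp: indicator_def intro: order_trans[OF _ abs_ge_self])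
qed

lemma mono_attenuation:
  fixes h :: "real \<Rightarrow> real"
  assumes [measurable]: "h \<in> borel_measurable lebesgue" and h: "\<And>t. 0 \<le> h t" "\<And>t. h t \<le> C"
  shows "mono (\<lambda>s. LINT r:{0..s}|lebesgue. h r)"
proof (rule monoI)
  fix a b :: real assume "a \<le> b"
  have int: "integrable lebesgue (\<lambda>r. indicator {0..s} r * h r)" for s
    by (rule integrable_indicator_bounded[where C=C]) (use h in auto)
  show "(LINT r:{0..a}|lebesgue. h r) \<le> (LINT r:{0..b}|lebesgue. h r)"
    unfolding set_lebesgue_integral_def real_scaleR_def
    by (intro integral_mono int) (use \<open>a \<le> b\<close> h in \<open>auto simp: indicator_def\<close>)
qed

text \<open>The numbers \<open>R\<close>, \<open>C\<close>, \<open>Cp\<close> and \<open>M\<close>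
  stand for the diameter of the domain and for bounds of \<open>\<mu>t\<close>, \<open>p\<close> and
  the solution. The comparison of the coefficients can be imposed on the whole plane because both
  vanish outside \<open>\<Omega>0\<close>.\<close>

locale transport = C1_convex_domain +
  fixes \<Omega>0 :: "(real^2) set" and L :: "nat \<Rightarrow> (real^2) set" and K :: nat and \<xi>p :: "nat \<Rightarrow> real^2"
    and \<mu>t \<mu>s :: "real^2 \<Rightarrow> real"
    and p :: "real^2 \<Rightarrow> real^2 \<Rightarrow> real^2 \<Rightarrow> real"
    and I0 I :: "(real^2) \<times> (real^2) \<Rightarrow> real"
    and R C Cp M :: real
  assumes Omega0: "open \<Omega>0" "\<Omega>0 \<subseteq> \<Omega>"
    and segments: "segments_of (frontier \<Omega>0 - frontier \<Omega>) K L"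
    and straight_parts: "no_other_straight_parts (frontier \<Omega>0 - frontier \<Omega>) K L"
    and directions: "\<And>j. j \<in> {1..K} \<Longrightarrow> direction_of (L j) (\<xi>p j)"
    and R: "\<And>y z. y \<in> \<Omega> \<Longrightarrow> z \<in> \<Omega> \<Longrightarrow> dist y z \<le> R" "0 \<le> R"
    and mut: "\<And>x. 0 \<le> \<mu>t x" "\<And>x. \<mu>t x \<le> C" "\<And>x. x \<in> \<Omega>0 \<Longrightarrow> isCont \<mu>t x"
      "\<And>x. x \<notin> \<Omega>0 \<Longrightarrow> \<mu>t x = 0"
    and mus: "\<And>x. 0 \<le> \<mu>s x" "\<And>x. \<mu>s x \<le> \<mu>t x" "\<And>x. x \<in> \<Omega>0 \<Longrightarrow> isCont \<mu>s x"
    and p: "\<And>x \<xi> \<xi>'. \<xi> \<in> S1 \<Longrightarrow> \<xi>' \<in> S1 \<Longrightarrow> 0 \<le> p x \<xi> \<xi>'"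
      "\<And>x \<xi> \<xi>'. \<xi> \<in> S1 \<Longrightarrow> \<xi>' \<in> S1 \<Longrightarrow> p x \<xi> \<xi>' \<le> Cp"
      "continuous_on (\<Omega>0 \<times> S1 \<times> S1) (\<lambda>(x, \<xi>, \<xi>'). p x \<xi> \<xi>')"
      "\<And>x \<xi> \<xi>'. x \<notin> \<Omega>0 \<Longrightarrow> \<xi> \<in> S1 \<Longrightarrow> \<xi>' \<in> S1 \<Longrightarrow> p x \<xi> \<xi>' = 0"
      "\<And>x \<xi>. x \<in> \<Omega>0 \<Longrightarrow> \<xi> \<in> S1 \<Longrightarrow> (LINT \<xi>'|circle_measure. p x \<xi> \<xi>') = 1"
    and M: "\<And>z. z \<in> phase_D \<Omega> \<Longrightarrow> \<bar>I z\<bar> \<le> M"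
    and solution: "is_solution \<Omega> \<mu>t \<mu>s p I0 I"
begin

abbreviation Sc :: "real^2 \<Rightarrow> real^2 \<Rightarrow> real" where "Sc \<equiv> scattering p I"
abbreviation OD :: "real^2 \<Rightarrow> real^2 \<Rightarrow> real \<Rightarrow> real" where "OD \<equiv> optical_depth \<mu>t"
abbreviation entry :: "real^2 \<Rightarrow> real^2 \<Rightarrow> real^2" where "entry \<equiv> entry_pt \<Omega>"

lemma mus': "\<mu>s x \<le> C" "x \<notin> \<Omega>0 \<Longrightarrow> \<mu>s x = 0"
  using mus[of x] mut[of x] by auto

lemma C_nonneg: "0 \<le> C" using mut(1,2)[of undefined] by linarith

lemma in_D: "x \<in> \<Omega> \<Longrightarrow> \<xi> \<in> S1 \<Longrightarrow> (x, \<xi>) \<in> phase_D \<Omega>"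
  by (simp add: phase_D_def)

lemma through_D: "(x, \<xi>) \<in> phase_D \<Omega> \<Longrightarrow> through x \<xi>"
  using phase_D_bar_eq by (auto simp: phase_D_bar_def)

lemma M_nonneg: "x \<in> \<Omega> \<Longrightarrow> 0 \<le> M"
  using M[OF in_D[of x "dirv 0"]] by force

lemma mut_measurable [measurable]: "\<mu>t \<in> borel_measurable borel"
  and mus_measurable [measurable]: "\<mu>s \<in> borel_measurable borel"
proof -
  have "\<mu>t = (\<lambda>x. indicator \<Omega>0 x *\<^sub>R \<mu>t x)" "\<mu>s = (\<lambda>x. indicator \<Omega>0 x *\<^sub>R \<mu>s x)"
    using mut(4) mus'(2) by (auto simp: fun_eq_iff indicator_def)
  moreover have "continuous_on \<Omega>0 \<mu>t" "continuous_on \<Omega>0 \<mu>s"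
    using mut(3) mus(3) by (auto intro: continuous_at_imp_continuous_on)
  ultimately show "\<mu>t \<in> borel_measurable borel" "\<mu>s \<in> borel_measurable borel"
    using borel_measurable_continuous_on_indicator[of \<Omega>0] Omega0(1)
    by (metis borel_open)+
qed

lemma line_measurable [measurable]: "(\<lambda>r. (x :: real^2) - r *\<^sub>R \<xi>) \<in> lebesgue \<rightarrow>\<^sub>M borel"
proof -
  have "(\<lambda>r. x - r *\<^sub>R \<xi>) \<in> borel_measurable borel"
    by (intro borel_measurable_continuous_onI continuous_intros)
  then show ?thesis by (simp add: measurable_completion)
qed

lemma mut_line [measurable]: "(\<lambda>r. \<mu>t (x - r *\<^sub>R \<xi>)) \<in> borel_measurable lebesgue"
  by (rule measurable_compose[OF line_measurable]) measurable

lemma mus_line [measurable]: "(\<lambda>r. \<mu>s (x - r *\<^sub>R \<xi>)) \<in> borel_measurable lebesgue"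
  by (rule measurable_compose[OF line_measurable]) measurable

lemma OD_mono: "mono (OD x \<xi>)"
  unfolding optical_depth_def
  by (rule mono_attenuation[where C=C]) (use mut in auto)

lemma OD_measurable [measurable]: "OD x \<xi> \<in> borel_measurable lebesgue"
  by (rule measurable_completion) (simp add: borel_measurable_mono OD_mono)

lemma OD_nonneg: "0 \<le> OD x \<xi> s"
  unfolding optical_depth_def set_lebesgue_integral_def
  by (rule integral_nonneg_AE) (use mut in auto)

lemma OD_le: "0 \<le> s \<Longrightarrow> OD x \<xi> s \<le> C * s"
proof -
  assume s: "0 \<le> s"
  have int: "integrable lebesgue (\<lambda>r. indicator {0..s} r * \<mu>t (x - r *\<^sub>R \<xi>))"
    by (rule integrable_indicator_bounded[where C=C]) (use mut in \<open>auto simp: mut_line\<close>)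
  have "OD x \<xi> s \<le> (\<integral>r. indicator {0..s} r * C \<partial>lebesgue)"
    unfolding optical_depth_def set_lebesgue_integral_def real_scaleR_def
    by (intro integral_mono int integrable_indicator_const) (use mut in \<open>auto simp: indicator_def\<close>)
  then show ?thesis using s by (simp add: mult.commute)
qed

text \<open>At points of \<open>\<Omega>0\<close> the coefficient is continuous; at other points of
  the ray \<open>leave\<close> makes it vanish along the sequence. That hypothesis isolates what is
  needed of the geometry and is met in two ways: by rays that cross the interfaces in length zero,
  and by shifts of a point along its own ray.\<close>

lemma OD_tendsto:
  assumes X: "X \<longlonglongrightarrow> x" "Z \<longlonglongrightarrow> \<xi>"
    and leave: "AE s in lebesgue. 0 \<le> s \<longrightarrow> x - s *\<^sub>R \<xi> \<notin> \<Omega>0 \<longrightarrow> (\<forall>\<^sub>F n in sequentially. X n - s *\<^sub>R Z n \<notin> \<Omega>0)"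
  shows "(\<lambda>n. OD (X n) (Z n) t) \<longlonglongrightarrow> OD x \<xi> t"
  unfolding optical_depth_def set_lebesgue_integral_def real_scaleR_def
proof (rule integral_dominated_convergence[where w="\<lambda>r. indicator {0..t} r * C"])
  show "AE r in lebesgue. (\<lambda>n. indicator {0..t} r * \<mu>t (X n - r *\<^sub>R Z n)) \<longlonglongrightarrow> indicator {0..t} r * \<mu>t (x - r *\<^sub>R \<xi>)"
    using leave
  proof eventually_elim
    case (elim r)
    show ?case
    proof (cases "x - r *\<^sub>R \<xi> \<in> \<Omega>0")
      case True
      have "(\<lambda>n. X n - r *\<^sub>R Z n) \<longlonglongrightarrow> x - r *\<^sub>R \<xi>" by (intro tendsto_intros X)
      then have "(\<lambda>n. \<mu>t (X n - r *\<^sub>R Z n)) \<longlonglongrightarrow> \<mu>t (x - r *\<^sub>R \<xi>)"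
        using isCont_tendsto_compose[OF mut(3)[OF True]] by blast
      then show ?thesis by (intro tendsto_intros)
    next
      case False
      show ?thesis
      proof (cases "0 \<le> r")
        case True
        with elim False have "\<forall>\<^sub>F n in sequentially. \<mu>t (X n - r *\<^sub>R Z n) = 0"
          by (auto elim!: eventually_mono intro: mut(4))
        then have "(\<lambda>n. \<mu>t (X n - r *\<^sub>R Z n)) \<longlonglongrightarrow> 0" by (rule tendsto_eventually)
        then have "(\<lambda>n. indicator {0..t} r * \<mu>t (X n - r *\<^sub>R Z n)) \<longlonglongrightarrow> indicator {0..t} r * 0"
          by (intro tendsto_intros)
        then show ?thesis using False mut(4) by simp
      qed auto
    qed
  qed
  have m: "(\<lambda>r. indicator {0..t} r * \<mu>t (y - r *\<^sub>R \<zeta>)) \<in> borel_measurable lebesgue" for y \<zeta>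
    by (intro borel_measurable_times borel_measurable_indicator mut_line) auto
  show "(\<lambda>r. indicator {0..t} r * \<mu>t (x - r *\<^sub>R \<xi>)) \<in> borel_measurable lebesgue"
    "\<And>n. (\<lambda>r. indicator {0..t} r * \<mu>t (X n - r *\<^sub>R Z n)) \<in> borel_measurable lebesgue" by (fact m)+
  show "AE r in lebesgue. norm (indicator {0..t} r * \<mu>t (X n - r *\<^sub>R Z n)) \<le> indicator {0..t} r * C" for n
    using mut by (intro AE_I2) (auto simp: indicator_def)
qed (rule integrable_indicator_const)

text \<open>Integrating up to \<open>R\<close> instead of \<open>tau_minus\<close> changes nothing,
  as the coefficients vanish once the ray has left the domain, and it gives all rays a common range
  of integration for dominated convergence.\<close>

definition kernel :: "real^2 \<Rightarrow> real^2 \<Rightarrow> real \<Rightarrow> real" where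
  "kernel x \<xi> s = indicator {0..R} s * (\<mu>s (x - s *\<^sub>R \<xi>) * exp (- OD x \<xi> s))"

lemma kernel_measurable [measurable]: "kernel x \<xi> \<in> borel_measurable lebesgue"
  unfolding kernel_def[abs_def]
  by (intro borel_measurable_times borel_measurable_indicator mus_line borel_measurable_exp
      borel_measurable_uminus OD_measurable) auto

lemma kernel_bounds: "0 \<le> kernel x \<xi> s" "kernel x \<xi> s \<le> indicator {0..R} s * C"
proof -
  show "0 \<le> kernel x \<xi> s" by (simp add: kernel_def mus)
  have "\<mu>s (x - s *\<^sub>R \<xi>) * exp (- OD x \<xi> s) \<le> C * 1"
    using OD_nonneg[of x \<xi> s] C_nonneg by (intro mult_mono mus') auto
  then show "kernel x \<xi> s \<le> indicator {0..R} s * C" by (simp add: kernel_def indicator_def)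
qed

lemma kernel_integrable: "integrable lebesgue (kernel x \<xi>)"
  by (rule Bochner_Integration.integrable_bound[OF integrable_indicator_const[of 0 R C]])
     (use kernel_bounds in \<open>auto simp: abs_of_nonneg intro!: AE_I2 intro: order_trans[OF _ abs_ge_self]\<close>)

definition \<kappa> :: real where "\<kappa> = 1 - exp (- (C * R))"

lemma \<kappa>_bounds: "0 \<le> \<kappa>" "\<kappa> < 1"
  using C_nonneg R(2) by (auto simp: \<kappa>_def)

text \<open>The hypothesis \<open>\<mu>s \<le> \<mu>t\<close> enters here and makes the scattering operator a contraction.\<close>

lemma kernel_le: "(\<integral>s. kernel x \<xi> s \<partial>lebesgue) \<le> \<kappa>"
proof -
  let ?g = "\<lambda>s. indicator {0..R} s * (\<mu>t (x - s *\<^sub>R \<xi>) * exp (- OD x \<xi> s))"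
  have b: "\<mu>t (x - s *\<^sub>R \<xi>) * exp (- OD x \<xi> s) \<le> C" for s
    using mult_mono[OF mut(2) , of "exp (- OD x \<xi> s)" 1] OD_nonneg[of x \<xi> s] C_nonneg by simp
  have "integrable lebesgue ?g"
    by (rule integrable_indicator_bounded[where C=C])
       (use b mut(1) in \<open>auto simp: abs_mult intro!: borel_measurable_times mut_line borel_measurable_exp
         borel_measurable_uminus OD_measurable\<close>)
  then have "(\<integral>s. kernel x \<xi> s \<partial>lebesgue) \<le> (\<integral>s. ?g s \<partial>lebesgue)"
    by (intro integral_mono kernel_integrable)
       (auto simp: kernel_def intro!: mult_left_mono mult_right_mono mus)
  also have "\<dots> = 1 - exp (- OD x \<xi> R)"
    using integral_attenuation[of "\<lambda>r. \<mu>t (x - r *\<^sub>R \<xi>)" C R] mut R(2)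
    by (simp add: optical_depth_def[abs_def] set_lebesgue_integral_def)
  also have "\<dots> \<le> \<kappa>" using OD_le[OF R(2), of x \<xi>] by (simp add: \<kappa>_def)
  finally show ?thesis .
qed

text \<open>The right-hand side of the integral equation. Unlike \<open>I\<close> it makes sense at
  outgoing boundary points, where it turns out to be the limit that defines the extension.\<close>

definition mild :: "real^2 \<Rightarrow> real^2 \<Rightarrow> real" where
  "mild x \<xi> = exp (- OD x \<xi> R) * I0 (entry x \<xi>, \<xi>) +
     (\<integral>s. kernel x \<xi> s * Sc (x - s *\<^sub>R \<xi>) \<xi> \<partial>lebesgue)"

text \<open>Carried along separately because a non-integrable function has integral 0 by convention.
  On \<open>phase_D\<close> it is part of being a solution; on \<open>Gamma_plus\<close> it is
  available only once \<open>Sc\<close> is known to be continuous on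
  \<open>\<Omega>0\<close>.\<close>

definition mildable :: "real^2 \<Rightarrow> real^2 \<Rightarrow> bool" where
  "mildable x \<xi> \<longleftrightarrow> integrable lebesgue (\<lambda>s. kernel x \<xi> s * Sc (x - s *\<^sub>R \<xi>) \<xi>)"

lemma outside: "through x \<xi> \<Longrightarrow> tau_minus \<Omega> x \<xi> < s \<Longrightarrow> x - s *\<^sub>R \<xi> \<notin> \<Omega>0"
  using after_tau_minus Omega0(2) closure_subset by blast

lemma solution_mild:
  assumes D: "(x, \<xi>) \<in> phase_D \<Omega>"
  shows "I (x, \<xi>) = mild x \<xi>" "mildable x \<xi>"
proof -
  let ?\<tau> = "tau_minus \<Omega> x \<xi>"
  note th = through_D[OF D]
  have \<tau>: "?\<tau> \<le> R" using tau_minus_le[OF th R(1)] .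
  have sol: "set_integrable lebesgue {0..?\<tau>}
          (\<lambda>s. \<mu>s (x - s *\<^sub>R \<xi>) * exp (- OD x \<xi> s) * Sc (x - s *\<^sub>R \<xi>) \<xi>)"
    "I (x, \<xi>) =
          exp (- OD x \<xi> ?\<tau>) * I0 (entry x \<xi>, \<xi>) +
          (LINT s:{0..?\<tau>}|lebesgue. \<mu>s (x - s *\<^sub>R \<xi>) * exp (- OD x \<xi> s) * Sc (x - s *\<^sub>R \<xi>) \<xi>)"
    using solution D unfolding is_solution_def by blast+
  have "indicator {0..?\<tau>} s * \<mu>t (x - s *\<^sub>R \<xi>) = indicator {0..R} s * \<mu>t (x - s *\<^sub>R \<xi>)"
    "indicator {0..?\<tau>} s * \<mu>s (x - s *\<^sub>R \<xi>) = indicator {0..R} s * \<mu>s (x - s *\<^sub>R \<xi>)" for s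
    using \<tau> outside[OF th, of s] mut(4) mus'(2) by (auto simp: indicator_def)
  note eq = this
  have OD: "OD x \<xi> ?\<tau> = OD x \<xi> R"
    unfolding optical_depth_def set_lebesgue_integral_def real_scaleR_def eq ..
  have k: "indicator {0..?\<tau>} s *\<^sub>R (\<mu>s (x - s *\<^sub>R \<xi>) * exp (- OD x \<xi> s) * Sc (x - s *\<^sub>R \<xi>) \<xi>)
      = kernel x \<xi> s * Sc (x - s *\<^sub>R \<xi>) \<xi>" for s
    using eq(2)[of s] by (simp add: kernel_def flip: mult.assoc)
  show "I (x, \<xi>) = mild x \<xi>" "mildable x \<xi>"
    using sol unfolding set_integrable_def set_lebesgue_integral_def k OD mild_def mildable_def by auto
qed

text \<open>A non-integrable function would have integral 0, not 1.\<close>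

lemma p_integrable: "x \<in> \<Omega>0 \<Longrightarrow> \<xi> \<in> S1 \<Longrightarrow> integrable circle_measure (p x \<xi>)"
  using p(5)[of x \<xi>] not_integrable_integral_eq[of circle_measure "p x \<xi>"] by fastforce

lemma pI_integrable:
  "x \<in> \<Omega> \<Longrightarrow> \<xi> \<in> S1 \<Longrightarrow> integrable circle_measure (\<lambda>\<xi>'. p x \<xi> \<xi>' * I (x, \<xi>'))"
  using solution unfolding is_solution_def by blast

text \<open>On \<open>\<Omega>0\<close> the function \<open>p x \<xi>\<close> is a probability
  density, so this is an average of \<open>I\<close>; elsewhere the integrand vanishes on the
  circle.\<close>

lemma Sc_bound:
  assumes "\<xi> \<in> S1" "\<Omega> \<noteq> {}"
  shows "\<bar>Sc x \<xi>\<bar> \<le> M"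
proof (cases "x \<in> \<Omega>0")
  case True
  then have x: "x \<in> \<Omega>" using Omega0 by blast
  have "\<bar>Sc x \<xi>\<bar> \<le> (\<integral>\<xi>'. \<bar>p x \<xi> \<xi>' * I (x, \<xi>')\<bar> \<partial>circle_measure)"
    unfolding scattering_def by (rule integral_abs_bound)
  also have "\<dots> \<le> (\<integral>\<xi>'. p x \<xi> \<xi>' * M \<partial>circle_measure)"
  proof (rule integral_mono_AE)
    show "AE \<xi>' in circle_measure. \<bar>p x \<xi> \<xi>' * I (x, \<xi>')\<bar> \<le> p x \<xi> \<xi>' * M"
      using AE_circle_measure_S1
      by eventually_elim (use p(1)[OF assms(1)] M[OF in_D[OF x]] in \<open>auto simp: abs_mult intro!: mult_mono\<close>)
  qed (use pI_integrable[OF x assms(1)] p_integrable[OF True assms(1)] in auto)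
  also have "\<dots> = M" using p(5)[OF True assms(1)] by simp
  finally show ?thesis .
next
  case False
  have "AE \<xi>' in circle_measure. p x \<xi> \<xi>' * I (x, \<xi>') = 0"
    using AE_circle_measure_S1 by eventually_elim (use p(4)[OF False assms(1)] in auto)
  then have "Sc x \<xi> = 0" unfolding scattering_def by (rule integral_eq_zero_AE)
  then show ?thesis using assms(2) M_nonneg by auto
qed

text \<open>The limit point is restricted to \<open>\<Omega>0\<close>, since a jump of
  \<open>Sc\<close> elsewhere is masked by \<open>\<mu>s = 0\<close>. Position and direction vary
  jointly, and the comparison is with the value at the limit point, so that the bound 0 is
  continuity.\<close>

definition osc_le :: "real \<Rightarrow> bool" where
  "osc_le W \<longleftrightarrow> (\<forall>x\<in>\<Omega>0. \<forall>\<xi>\<in>S1. \<forall>X Z. X \<longlonglongrightarrow> x \<longrightarrow> Z \<longlonglongrightarrow> \<xi> \<longrightarrow> (\<forall>n. Z n \<in> S1) \<longrightarrow>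
     (\<forall>\<epsilon>>0. \<forall>\<^sub>F n in sequentially. \<bar>Sc (X n) (Z n) - Sc x \<xi>\<bar> \<le> W + \<epsilon>))"

text \<open>Attenuation and boundary term converge, so the whole error stems from the scattering
  term, which is weighted by a kernel of mass at most \<kappa>. It is used with a running bound
  \<open>W\<close> for the contraction and with \<open>W = 0\<close> for the continuity of the
  solution.\<close>

lemma mild_limsup:
  assumes th: "through x \<xi>" "\<And>n. through (X n) (Z n)"
    and X: "X \<longlonglongrightarrow> x" "Z \<longlonglongrightarrow> \<xi>"
    and leave: "AE s in lebesgue. 0 \<le> s \<longrightarrow> x - s *\<^sub>R \<xi> \<notin> \<Omega>0 \<longrightarrow> (\<forall>\<^sub>F n in sequentially. X n - s *\<^sub>R Z n \<notin> \<Omega>0)"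
    and I0: "(\<lambda>n. I0 (entry (X n) (Z n), Z n)) \<longlonglongrightarrow> I0 (entry x \<xi>, \<xi>)"
    and mildable: "mildable x \<xi>" "\<And>n. mildable (X n) (Z n)"
    and W: "osc_le W" "0 \<le> W" and \<epsilon>: "\<epsilon> > 0"
  shows "\<forall>\<^sub>F n in sequentially. \<bar>mild (X n) (Z n) - mild x \<xi>\<bar> \<le> \<kappa> * W + \<epsilon>"
proof -
  have S1: "\<xi> \<in> S1" "Z n \<in> S1" for n using th unfolding through_def by auto
  have ne: "\<Omega> \<noteq> {}" using th(1) unfolding through_def by auto
  note OD = OD_tendsto[OF X leave]
  have "(\<lambda>n. exp (- OD (X n) (Z n) R) * I0 (entry (X n) (Z n), Z n)) \<longlonglongrightarrow> exp (- OD x \<xi> R) * I0 (entry x \<xi>, \<xi>)"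
    by (intro tendsto_intros OD I0)
  from tendstoD[OF this, of "\<epsilon>/2"] have 1: "\<forall>\<^sub>F n in sequentially.
     dist (exp (- OD (X n) (Z n) R) * I0 (entry (X n) (Z n), Z n)) (exp (- OD x \<xi> R) * I0 (entry x \<xi>, \<xi>)) < \<epsilon>/2"
    using \<epsilon> by simp
  have "\<forall>\<^sub>F n in sequentially.
     \<bar>(\<integral>s. kernel (X n) (Z n) s * Sc (X n - s *\<^sub>R Z n) (Z n) \<partial>lebesgue) - (\<integral>s. kernel x \<xi> s * Sc (x - s *\<^sub>R \<xi>) \<xi> \<partial>lebesgue)\<bar>
       \<le> (\<integral>s. kernel x \<xi> s * W \<partial>lebesgue) + \<epsilon> / 2"
  proof (rule integral_limsup_le[where B="\<lambda>s. indicator {0..R} s * (C * M)"])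
    show "AE s in lebesgue. \<bar>kernel (X n) (Z n) s * Sc (X n - s *\<^sub>R Z n) (Z n)\<bar> \<le> indicator {0..R} s * (C * M)" for n
    proof (rule AE_I2)
      fix s
      have "\<bar>kernel (X n) (Z n) s * Sc (X n - s *\<^sub>R Z n) (Z n)\<bar> \<le> (indicator {0..R} s * C) * M"
        unfolding abs_mult using kernel_bounds[of "X n" "Z n" s] Sc_bound[OF S1(2) ne, of "X n - s *\<^sub>R Z n"] C_nonneg
        by (intro mult_mono) auto
      then show "\<bar>kernel (X n) (Z n) s * Sc (X n - s *\<^sub>R Z n) (Z n)\<bar> \<le> indicator {0..R} s * (C * M)"
        by (simp add: mult.assoc)
    qed
    show "AE s in lebesgue. \<forall>\<epsilon>>0. \<forall>\<^sub>F n in sequentially.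
       \<bar>kernel (X n) (Z n) s * Sc (X n - s *\<^sub>R Z n) (Z n) - kernel x \<xi> s * Sc (x - s *\<^sub>R \<xi>) \<xi>\<bar> \<le> kernel x \<xi> s * W + \<epsilon>"
      using leave
    proof eventually_elim
      case (elim s)
      show ?case
      proof (intro allI impI)
        fix e :: real assume e: "e > 0"
        have lim: "(\<lambda>n. X n - s *\<^sub>R Z n) \<longlonglongrightarrow> x - s *\<^sub>R \<xi>" by (intro tendsto_intros X)
        show "\<forall>\<^sub>F n in sequentially.
           \<bar>kernel (X n) (Z n) s * Sc (X n - s *\<^sub>R Z n) (Z n) - kernel x \<xi> s * Sc (x - s *\<^sub>R \<xi>) \<xi>\<bar> \<le> kernel x \<xi> s * W + e"
        proof (cases "x - s *\<^sub>R \<xi> \<in> \<Omega>0")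
          case True
          have "(\<lambda>n. \<mu>s (X n - s *\<^sub>R Z n)) \<longlonglongrightarrow> \<mu>s (x - s *\<^sub>R \<xi>)"
            using isCont_tendsto_compose[OF mus(3)[OF True] lim] .
          then have "(\<lambda>n. kernel (X n) (Z n) s) \<longlonglongrightarrow> kernel x \<xi> s"
            unfolding kernel_def by (intro tendsto_intros OD)
          then show ?thesis
          proof (rule limsup_mult_le[OF _ kernel_bounds(1) _ _ e])
            show "\<forall>\<^sub>F n in sequentially. \<bar>Sc (X n - s *\<^sub>R Z n) (Z n)\<bar> \<le> M"
              using Sc_bound[OF S1(2) ne] by simp
            show "\<forall>\<^sub>F n in sequentially. \<bar>Sc (X n - s *\<^sub>R Z n) (Z n) - Sc (x - s *\<^sub>R \<xi>) \<xi>\<bar> \<le> W + \<epsilon>"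
              if "\<epsilon> > 0" for \<epsilon>
              using W(1) True lim X(2) S1 that unfolding osc_le_def by blast
          qed
        next
          case False
          show ?thesis
          proof (cases "0 \<le> s")
            case True
            with elim False have "\<forall>\<^sub>F n in sequentially. X n - s *\<^sub>R Z n \<notin> \<Omega>0" by blast
            then show ?thesis
              by eventually_elim (use False e in \<open>simp add: kernel_def mus'\<close>)
          next
            case False
            then show ?thesis using e by (simp add: kernel_def)
          qed
        qed
      qed
    qed
  qed (use mildable mildable_def kernel_integrable integrable_indicator_const \<epsilon> in auto)
  then have 2: "\<forall>\<^sub>F n in sequentially.
     \<bar>(\<integral>s. kernel (X n) (Z n) s * Sc (X n - s *\<^sub>R Z n) (Z n) \<partial>lebesgue) - (\<integral>s. kernel x \<xi> s * Sc (x - s *\<^sub>R \<xi>) \<xi> \<partial>lebesgue)\<bar>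
       \<le> \<kappa> * W + \<epsilon> / 2"
    using mult_right_mono[OF kernel_le[of x \<xi>] W(2)] by (auto elim!: eventually_mono)
  from 1 2 show ?thesis
    by eventually_elim (unfold mild_def dist_real_def, linarith)
qed

section \<open>How rays meet the interfaces\<close>

definition good :: "real^2 \<Rightarrow> real^2 \<Rightarrow> bool" where
  "good x \<xi> \<longleftrightarrow> negligible {t. 0 \<le> t \<and> x - t *\<^sub>R \<xi> \<in> frontier \<Omega>0}"

text \<open>A point outside \<open>\<Omega>0\<close> and off its frontier is outside its closure,
  which persists for nearby rays. Crossings of total length zero thus do the work of finitely many
  crossings.\<close>

lemma good_leave:
  assumes "good x \<xi>" and X: "X \<longlonglongrightarrow> x" "Z \<longlonglongrightarrow> \<xi>"
  shows "AE s in lebesgue. 0 \<le> s \<longrightarrow> x - s *\<^sub>R \<xi> \<notin> \<Omega>0 \<longrightarrow> (\<forall>\<^sub>F n in sequentially. X n - s *\<^sub>R Z n \<notin> \<Omega>0)"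
proof -
  have "AE s in lebesgue. \<not> (0 \<le> s \<and> x - s *\<^sub>R \<xi> \<in> frontier \<Omega>0)"
    using assms(1) unfolding good_def eventually_ae_filter_negligible by (auto)
  then show ?thesis
  proof eventually_elim
    case (elim s)
    show ?case
    proof (intro impI)
      assume "0 \<le> s" "x - s *\<^sub>R \<xi> \<notin> \<Omega>0"
      then have "x - s *\<^sub>R \<xi> \<in> - closure \<Omega>0"
        using elim Omega0(1) by (simp add: frontier_def interior_open)
      moreover have "(\<lambda>n. X n - s *\<^sub>R Z n) \<longlonglongrightarrow> x - s *\<^sub>R \<xi>" by (intro tendsto_intros X)
      ultimately have "\<forall>\<^sub>F n in sequentially. X n - s *\<^sub>R Z n \<in> - closure \<Omega>0"
        using topological_tendstoD[of _ _ sequentially "- closure \<Omega>0"] by auto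
      then show "\<forall>\<^sub>F n in sequentially. X n - s *\<^sub>R Z n \<notin> \<Omega>0"
        by eventually_elim (use closure_subset in auto)
    qed
  qed
qed

lemma L_Omega: "j \<in> {1..K} \<Longrightarrow> x \<in> L j \<Longrightarrow> x \<in> \<Omega>"
proof -
  assume "j \<in> {1..K}" "x \<in> L j"
  then have "x \<in> closure \<Omega>0" "x \<notin> frontier \<Omega>"
    using segments unfolding segments_of_def frontier_def by blast+
  then have "x \<in> closure \<Omega>" using closure_mono[OF Omega0(2)] by auto
  then show "x \<in> \<Omega>" using \<open>x \<notin> frontier \<Omega>\<close> op by (simp add: frontier_def interior_open)
qed

text \<open>The difference of the two hits and the direction of the segment are multiples of the
  same vector \<open>b - a\<close>. Both directions are unit vectors, so they agree up to
  sign.\<close>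

lemma line_meets_segment_twice:
  assumes j: "j \<in> {1..K}" and \<xi>: "\<xi> \<in> S1"
    and t: "t1 \<noteq> t2" "x - t1 *\<^sub>R \<xi> \<in> L j" "x - t2 *\<^sub>R \<xi> \<in> L j"
  shows "\<xi> \<in> {\<xi>p j, - \<xi>p j}"
proof -
  obtain a b where ab: "L j = open_segment a b" using segments j unfolding segments_of_def by blast
  have dir: "\<xi>p j \<in> S1" using directions[OF j] by (simp add: direction_of_def)
  obtain s where s: "s > 0" "x - t1 *\<^sub>R \<xi> + s *\<^sub>R \<xi>p j \<in> L j"
    using directions[OF j] t(2) unfolding direction_of_def by blast
  obtain c where c: "(x - t2 *\<^sub>R \<xi>) - (x - t1 *\<^sub>R \<xi>) = c *\<^sub>R (b - a)"
    using two_points_on_segment t ab by metis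
  obtain d where d: "(x - t1 *\<^sub>R \<xi> + s *\<^sub>R \<xi>p j) - (x - t1 *\<^sub>R \<xi>) = d *\<^sub>R (b - a)"
    using two_points_on_segment t s ab by metis
  have "s *\<^sub>R \<xi>p j = d *\<^sub>R (b - a)" using d by simp
  moreover have "\<xi>p j \<noteq> 0" using dir by auto
  ultimately have d: "d \<noteq> 0" using s by auto
  have "b - a = (1 / d) *\<^sub>R (d *\<^sub>R (b - a))" using d by simp
  also have "\<dots> = (1 / d) *\<^sub>R (s *\<^sub>R \<xi>p j)" using \<open>s *\<^sub>R \<xi>p j = d *\<^sub>R (b - a)\<close> by simp
  finally have ba: "b - a = (s / d) *\<^sub>R \<xi>p j" by simp
  have "(t1 - t2) *\<^sub>R \<xi> = c *\<^sub>R (b - a)" using c by (simp add: algebra_simps)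
  then have "\<xi> = (inverse (t1 - t2) * c * (s / d)) *\<^sub>R \<xi>p j"
    using t(1) ba by (metis right_minus_eq scaleR_scaleR left_inverse scaleR_one)
  then obtain e where e: "\<xi> = e *\<^sub>R \<xi>p j" by blast
  then have "\<bar>e\<bar> = 1" using \<xi> dir by simp
  then show ?thesis using e by (auto simp: abs_if split: if_splits)
qed

definition curved :: "(real^2) set" where
  "curved = frontier \<Omega>0 - frontier \<Omega> - (\<Union>j\<in>{1..K}. L j)"

lemma negligible_curved:
  assumes "\<xi> \<in> S1"
  shows "negligible {t. x - t *\<^sub>R \<xi> \<in> curved}"
proof -
  have "- \<xi> \<in> S1" using assms by simp
  then have "negligible {t. x + t *\<^sub>R (- \<xi>) \<in> curved}"
    using straight_parts unfolding no_other_straight_parts_def curved_def by blast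
  then show ?thesis by simp
qed

text \<open>A line through an open convex set can touch its boundary only at the two ends of the
  chord, so the part of the frontier of \<open>\<Omega>0\<close> on the outer boundary carries no
  length along the ray.\<close>

lemma hits_frontier:
  assumes th: "through x \<xi>" and t: "0 \<le> t" "x - t *\<^sub>R \<xi> \<in> frontier \<Omega>"
  shows "t = 0 \<or> t = tau_minus \<Omega> x \<xi>"
proof -
  have "x - t *\<^sub>R \<xi> \<in> closure \<Omega>" "x - t *\<^sub>R \<xi> \<notin> \<Omega>" using t op
    by (simp_all add: frontier_def interior_open)
  then show ?thesis using le_tau_minus[OF th, of t] before_tau_minus[of t x \<xi>] t by force
qed

text \<open>A ray that meets \<open>L j\<close> in positive length meets it twice and so has the
  direction of the segment. As \<open>L j\<close> lies inside the domain, \<open>x\<close> is then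
  downstream of one of its points, which is membership in \<open>disc_C\<close>.\<close>

lemma good_line:
  assumes th: "through x \<xi>" and nC: "(x, \<xi>) \<notin> disc_C \<Omega> K L \<xi>p"
  shows "good x \<xi>"
proof -
  have S1: "\<xi> \<in> S1" and xc: "x \<in> closure \<Omega>" using th unfolding through_def by auto
  have seg: "negligible {t. 0 \<le> t \<and> x - t *\<^sub>R \<xi> \<in> L j}" if j: "j \<in> {1..K}" for j
  proof (rule ccontr)
    assume *: "\<not> negligible {t. 0 \<le> t \<and> x - t *\<^sub>R \<xi> \<in> L j}" (is "\<not> negligible ?A")
    then obtain t1 where t1: "t1 \<in> ?A" using negligible_empty by (metis ex_in_conv)
    then obtain t2 where t2: "t2 \<in> ?A" "t2 \<noteq> t1"
      using * negligible_subset[OF negligible_sing[of t1], of ?A] by blast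
    then have \<xi>: "\<xi> \<in> {\<xi>p j, - \<xi>p j}" using line_meets_segment_twice[OF j S1, of t1 t2] t1 by auto
    let ?y = "x - t1 *\<^sub>R \<xi>"
    have "t1 \<le> tau_plus \<Omega> ?y \<xi>"
      using le_tau_plus_closure[OF S1 L_Omega[OF j], of ?y t1] t1 xc by simp
    then have "(x, \<xi>) \<in> {(x + t *\<^sub>R \<xi>, \<xi>) | x t. x \<in> L j \<and> 0 \<le> t \<and> t \<le> tau_plus \<Omega> x \<xi>}"
      using t1 by (auto intro!: exI[of _ ?y] exI[of _ t1])
    then show False using nC j \<xi> unfolding disc_C_def by blast
  qed
  have "negligible (\<Union>j\<in>{1..K}. {t. 0 \<le> t \<and> x - t *\<^sub>R \<xi> \<in> L j})"
    using seg by (intro negligible_Union) auto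
  with negligible_curved[OF S1] have "negligible ({t. x - t *\<^sub>R \<xi> \<in> curved} \<union> {0, tau_minus \<Omega> x \<xi>}
     \<union> (\<Union>j\<in>{1..K}. {t. 0 \<le> t \<and> x - t *\<^sub>R \<xi> \<in> L j}))" by (intro negligible_Un) auto
  moreover have "{t. 0 \<le> t \<and> x - t *\<^sub>R \<xi> \<in> frontier \<Omega>0} \<subseteq> {t. x - t *\<^sub>R \<xi> \<in> curved} \<union> {0, tau_minus \<Omega> x \<xi>}
     \<union> (\<Union>j\<in>{1..K}. {t. 0 \<le> t \<and> x - t *\<^sub>R \<xi> \<in> L j})"
    using hits_frontier[OF th] by (auto simp: curved_def)
  ultimately show ?thesis unfolding good_def by (rule negligible_subset)
qed

definition bad_dirs :: "(real^2) set" where "bad_dirs = (\<Union>j\<in>{1..K}. {\<xi>p j, - \<xi>p j})"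

lemma finite_bad_dirs: "finite bad_dirs" by (simp add: bad_dirs_def)

lemma good_dir: "through x \<xi> \<Longrightarrow> \<xi> \<notin> bad_dirs \<Longrightarrow> good x \<xi>"
  by (rule good_line) (auto simp: disc_C_def bad_dirs_def)

end

section \<open>Contraction of the oscillation of the scattering term\<close>

context transport
begin

text \<open>The average over directions is taken over an abstract parameter \<open>q\<close> with
  weight \<open>w\<close> and direction \<open>\<omega>\<close>, so that one estimate serves two
  parametrisations: the circle itself with weight 1, and a boundary chart with the Jacobian of the
  polar angle as weight. The first alternative in \<open>lim\<close> covers parameters outside the
  chart piece.\<close>

lemma scattering_limsup:
  fixes N :: "'q measure"
  assumes x: "x \<in> \<Omega>0" "\<And>n. X n \<in> \<Omega>0" "X \<longlonglongrightarrow> x"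
    and \<xi>: "\<xi> \<in> S1" "\<And>n. Z n \<in> S1" "Z \<longlonglongrightarrow> \<xi>"
    and int: "\<And>n. integrable N (\<lambda>q. w n q * (p (X n) (Z n) (\<omega> n q) * I (X n, \<omega> n q)))"
      "integrable N (\<lambda>q. w0 q * (p x \<xi> (\<omega>0 q) * I (x, \<omega>0 q)))"
      "integrable N (\<lambda>q. w0 q * p x \<xi> (\<omega>0 q))" "integrable N B"
    and bound: "\<And>n. AE q in N. \<bar>w n q\<bar> \<le> B q \<and> (w n q \<noteq> 0 \<longrightarrow> \<omega> n q \<in> S1)"
    and lim: "AE q in N. (\<forall>n. w n q = 0) \<and> w0 q = 0 \<or>
       (\<lambda>n. w n q) \<longlonglongrightarrow> w0 q \<and> 0 \<le> w0 q \<and> (\<forall>n. \<omega> n q \<in> S1) \<and> (\<lambda>n. \<omega> n q) \<longlonglongrightarrow> \<omega>0 q \<and> \<omega>0 q \<notin> bad_dirs \<and>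
       (\<lambda>n. I0 (entry (X n) (\<omega> n q), \<omega> n q)) \<longlonglongrightarrow> I0 (entry x (\<omega>0 q), \<omega>0 q)"
    and W: "osc_le W" "0 \<le> W" and \<epsilon>: "\<epsilon> > 0"
  shows "\<forall>\<^sub>F n in sequentially.
    \<bar>(\<integral>q. w n q * (p (X n) (Z n) (\<omega> n q) * I (X n, \<omega> n q)) \<partial>N) - (\<integral>q. w0 q * (p x \<xi> (\<omega>0 q) * I (x, \<omega>0 q)) \<partial>N)\<bar>
      \<le> \<kappa> * W * (\<integral>q. w0 q * p x \<xi> (\<omega>0 q) \<partial>N) + \<epsilon>"
proof -
  have X\<Omega>: "X n \<in> \<Omega>" "x \<in> \<Omega>" for n using x Omega0(2) by auto
  have "\<forall>\<^sub>F n in sequentially.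
    \<bar>(\<integral>q. w n q * (p (X n) (Z n) (\<omega> n q) * I (X n, \<omega> n q)) \<partial>N) - (\<integral>q. w0 q * (p x \<xi> (\<omega>0 q) * I (x, \<omega>0 q)) \<partial>N)\<bar>
      \<le> (\<integral>q. w0 q * p x \<xi> (\<omega>0 q) * (\<kappa> * W) \<partial>N) + \<epsilon>"
  proof (rule integral_limsup_le[where B="\<lambda>q. B q * (Cp * M)", OF int(1,2) _ _ _ _ \<epsilon>])
    show "integrable N (\<lambda>q. w0 q * p x \<xi> (\<omega>0 q) * (\<kappa> * W))" "integrable N (\<lambda>q. B q * (Cp * M))"
      using int(3,4) by auto
    show "AE q in N. \<bar>w n q * (p (X n) (Z n) (\<omega> n q) * I (X n, \<omega> n q))\<bar> \<le> B q * (Cp * M)" for n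
      using bound[of n]
    proof eventually_elim
      case (elim q)
      show ?case
      proof (cases "w n q = 0")
        case False
        then have "\<omega> n q \<in> S1" using elim by blast
        then show ?thesis unfolding abs_mult
          using elim p(1,2)[OF \<xi>(2)[of n], of "\<omega> n q" "X n"] M[OF in_D[OF X\<Omega>(1)]]
          by (intro mult_mono) auto
      next
        case True
        have "dirv 0 \<in> S1" by (rule dirv_S1)
        then have "0 \<le> Cp" using p(1,2)[of "dirv 0" "dirv 0" x] by linarith
        then show ?thesis using True elim M_nonneg[OF X\<Omega>(2)] by simp
      qed
    qed
    show "AE q in N. \<forall>\<epsilon>>0. \<forall>\<^sub>F n in sequentially.
       \<bar>w n q * (p (X n) (Z n) (\<omega> n q) * I (X n, \<omega> n q)) - w0 q * (p x \<xi> (\<omega>0 q) * I (x, \<omega>0 q))\<bar>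
       \<le> w0 q * p x \<xi> (\<omega>0 q) * (\<kappa> * W) + \<epsilon>"
      using lim
    proof eventually_elim
      case (elim q)
      show ?case
      proof (intro allI impI)
        fix e :: real assume e: "e > 0"
        show "\<forall>\<^sub>F n in sequentially.
           \<bar>w n q * (p (X n) (Z n) (\<omega> n q) * I (X n, \<omega> n q)) - w0 q * (p x \<xi> (\<omega>0 q) * I (x, \<omega>0 q))\<bar>
           \<le> w0 q * p x \<xi> (\<omega>0 q) * (\<kappa> * W) + e"
        proof (cases "(\<forall>n. w n q = 0) \<and> w0 q = 0")
          case True
          then show ?thesis using e by simp
        next
          case False
          with elim have *: "(\<lambda>n. w n q) \<longlonglongrightarrow> w0 q" "0 \<le> w0 q" "\<And>n. \<omega> n q \<in> S1"
            "(\<lambda>n. \<omega> n q) \<longlonglongrightarrow> \<omega>0 q" "\<omega>0 q \<notin> bad_dirs"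
            "(\<lambda>n. I0 (entry (X n) (\<omega> n q), \<omega> n q)) \<longlonglongrightarrow> I0 (entry x (\<omega>0 q), \<omega>0 q)" by auto
          have S1: "\<omega>0 q \<in> S1" using closed_sequentially[OF closed_sphere _ *(4)] *(3) by blast
          have "(\<lambda>n. (X n, Z n, \<omega> n q)) \<longlonglongrightarrow> (x, \<xi>, \<omega>0 q)" by (intro tendsto_intros x \<xi> *)
          from continuous_on_tendsto_compose[OF p(3) this]
          have "(\<lambda>n. p (X n) (Z n) (\<omega> n q)) \<longlonglongrightarrow> p x \<xi> (\<omega>0 q)"
            using x \<xi> *(3) S1 by simp
          then have a: "(\<lambda>n. w n q * p (X n) (Z n) (\<omega> n q)) \<longlonglongrightarrow> w0 q * p x \<xi> (\<omega>0 q)"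
            by (intro tendsto_intros *)
          have "\<forall>\<^sub>F n in sequentially. \<bar>w n q * p (X n) (Z n) (\<omega> n q) * I (X n, \<omega> n q) - w0 q * p x \<xi> (\<omega>0 q) * I (x, \<omega>0 q)\<bar>
              \<le> w0 q * p x \<xi> (\<omega>0 q) * (\<kappa> * W) + e"
          proof (rule limsup_mult_le[OF a _ _ _ e])
            show "0 \<le> w0 q * p x \<xi> (\<omega>0 q)" using *(2) p(1)[OF \<xi>(1) S1] by simp
            show "\<forall>\<^sub>F n in sequentially. \<bar>I (X n, \<omega> n q)\<bar> \<le> M"
              using M[OF in_D[OF X\<Omega>(1) *(3)]] by simp
            fix d :: real assume d: "d > 0"
            have th: "through x (\<omega>0 q)" "\<And>n. through (X n) (\<omega> n q)"
              using through_Omega X\<Omega> S1 *(3) by auto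
            have "\<forall>\<^sub>F n in sequentially. \<bar>mild (X n) (\<omega> n q) - mild x (\<omega>0 q)\<bar> \<le> \<kappa> * W + d"
              using solution_mild(2)[OF in_D] X\<Omega> S1 *(3)
              by (intro mild_limsup[OF th x(3) *(4) good_leave[OF good_dir[OF th(1) *(5)] x(3) *(4)] *(6) _ _ W d]) auto
            then show "\<forall>\<^sub>F n in sequentially. \<bar>I (X n, \<omega> n q) - I (x, \<omega>0 q)\<bar> \<le> \<kappa> * W + d"
              using solution_mild(1)[OF in_D] X\<Omega> S1 *(3) by simp
          qed
          then show ?thesis by (simp only: mult.assoc)
        qed
      qed
    qed
  qed
  also have "(\<integral>q. w0 q * p x \<xi> (\<omega>0 q) * (\<kappa> * W) \<partial>N) = \<kappa> * W * (\<integral>q. w0 q * p x \<xi> (\<omega>0 q) \<partial>N)"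
    by (simp add: mult.commute)
  finally show ?thesis .
qed

text \<open>Only the tail of a sequence matters, so it may be reset to \<open>x\<close> outside a
  neighbourhood. This allows all its points to keep a fixed distance from the boundary, which the
  Jacobian bounds in the charts require.\<close>

lemma osc_leI:
  assumes "\<And>x \<xi>. x \<in> \<Omega>0 \<Longrightarrow> \<xi> \<in> S1 \<Longrightarrow> \<exists>U. open U \<and> x \<in> U \<and> (\<forall>X Z \<epsilon>. (\<forall>n. X n \<in> U) \<longrightarrow> X \<longlonglongrightarrow> x \<longrightarrow>
      (\<forall>n. Z n \<in> S1) \<longrightarrow> Z \<longlonglongrightarrow> \<xi> \<longrightarrow> \<epsilon> > 0 \<longrightarrow>
      (\<forall>\<^sub>F n in sequentially. \<bar>Sc (X n) (Z n) - Sc x \<xi>\<bar> \<le> W + \<epsilon>))"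
  shows "osc_le W"
  unfolding osc_le_def
proof (intro ballI allI impI)
  fix x \<xi> X Z and \<epsilon> :: real
  assume x: "x \<in> \<Omega>0" and \<xi>: "\<xi> \<in> S1" and lim: "X \<longlonglongrightarrow> x" "Z \<longlonglongrightarrow> \<xi>" "\<forall>n. Z n \<in> S1" "\<epsilon> > 0"
  from assms[OF x \<xi>] obtain U where U: "open U" "x \<in> U"
    and est: "\<forall>X Z \<epsilon>. (\<forall>n. X n \<in> U) \<longrightarrow> X \<longlonglongrightarrow> x \<longrightarrow> (\<forall>n. Z n \<in> S1) \<longrightarrow> Z \<longlonglongrightarrow> \<xi> \<longrightarrow> \<epsilon> > 0 \<longrightarrow>
      (\<forall>\<^sub>F n in sequentially. \<bar>Sc (X n) (Z n) - Sc x \<xi>\<bar> \<le> W + \<epsilon>)"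
    by (elim exE conjE)
  define X' where "X' n = (if X n \<in> U then X n else x)" for n
  have ev: "\<forall>\<^sub>F n in sequentially. X n = X' n"
    using topological_tendstoD[OF lim(1) U] by eventually_elim (simp add: X'_def)
  have X': "X' \<longlonglongrightarrow> x" by (rule Lim_transform_eventually[OF lim(1) ev])
  have "\<forall>n. X' n \<in> U" using U(2) by (simp add: X'_def)
  then have "\<forall>\<^sub>F n in sequentially. \<bar>Sc (X' n) (Z n) - Sc x \<xi>\<bar> \<le> W + \<epsilon>"
    using est X' lim by blast
  with ev show "\<forall>\<^sub>F n in sequentially. \<bar>Sc (X n) (Z n) - Sc x \<xi>\<bar> \<le> W + \<epsilon>"
    by eventually_elim simp
qed

text \<open>With the direction fixed, the entry point moves continuously inside
  \<open>Gamma_minus_dir\<close>, so the circle can serve as parameter space directly. The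
  directions of the segments form a null set.\<close>

lemma osc_step_dir:
  assumes I0: "AE \<xi> in circle_measure. continuous_on (Gamma_minus_dir \<Omega> \<xi>) (\<lambda>x. I0 (x, \<xi>))"
    and W: "osc_le W" "0 \<le> W"
  shows "osc_le (\<kappa> * W)"
proof (rule osc_leI)
  fix x \<xi> assume x: "x \<in> \<Omega>0" and \<xi>: "\<xi> \<in> S1"
  show "\<exists>U. open U \<and> x \<in> U \<and> (\<forall>X Z \<epsilon>. (\<forall>n. X n \<in> U) \<longrightarrow> X \<longlonglongrightarrow> x \<longrightarrow>
      (\<forall>n. Z n \<in> S1) \<longrightarrow> Z \<longlonglongrightarrow> \<xi> \<longrightarrow> \<epsilon> > 0 \<longrightarrow>
      (\<forall>\<^sub>F n in sequentially. \<bar>Sc (X n) (Z n) - Sc x \<xi>\<bar> \<le> \<kappa> * W + \<epsilon>))"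
  proof (intro exI[of _ \<Omega>0] conjI allI impI Omega0(1) x)
    fix X Z and \<epsilon> :: real
    assume X: "\<forall>n. X n \<in> \<Omega>0" "X \<longlonglongrightarrow> x" "\<forall>n. Z n \<in> S1" "Z \<longlonglongrightarrow> \<xi>" and \<epsilon>: "\<epsilon> > 0"
    have X\<Omega>: "X n \<in> \<Omega>" "x \<in> \<Omega>" for n using x X(1) Omega0(2) by auto
    interpret finite_measure circle_measure by (rule finite_circle_measure)
    have "\<forall>\<^sub>F n in sequentially.
      \<bar>(\<integral>q. 1 * (p (X n) (Z n) q * I (X n, q)) \<partial>circle_measure) - (\<integral>q. 1 * (p x \<xi> q * I (x, q)) \<partial>circle_measure)\<bar>
      \<le> \<kappa> * W * (\<integral>q. 1 * p x \<xi> q \<partial>circle_measure) + \<epsilon>"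
    proof (rule scattering_limsup[OF x X(1)[rule_format] X(2) \<xi> X(3)[rule_format] X(4) _ _ _ _ _ _ W \<epsilon>])
      show "AE q in circle_measure. \<bar>1\<bar> \<le> (1::real) \<and> ((1::real) \<noteq> 0 \<longrightarrow> q \<in> S1)"
        using AE_circle_measure_S1 by eventually_elim auto
      show "AE q in circle_measure. (\<forall>n::nat. (1::real) = 0) \<and> (1::real) = 0 \<or>
       (\<lambda>n. 1::real) \<longlonglongrightarrow> 1 \<and> (0::real) \<le> 1 \<and> (\<forall>n::nat. q \<in> S1) \<and> (\<lambda>n. q) \<longlonglongrightarrow> q \<and> q \<notin> bad_dirs \<and>
       (\<lambda>n. I0 (entry (X n) q, q)) \<longlonglongrightarrow> I0 (entry x q, q)"
        using AE_circle_measure_S1 AE_circle_measure_finite[OF finite_bad_dirs] I0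
      proof eventually_elim
        case (elim q)
        have th: "through x q" "\<And>n. through (X n) q" using elim X\<Omega> through_Omega by auto
        have "entry x q \<in> Gamma_minus_dir \<Omega> q" "\<And>n. entry (X n) q \<in> Gamma_minus_dir \<Omega> q"
          using entry_Gamma_minus[OF th(1)] entry_Gamma_minus[OF th(2)]
          by (auto simp: Gamma_minus_dir_def Gamma_minus_def)
        moreover have "(\<lambda>n. entry (X n) q) \<longlonglongrightarrow> entry x q"
          by (rule entry_pt_tendsto[OF th X(2) tendsto_const])
        ultimately have "(\<lambda>n. I0 (entry (X n) q, q)) \<longlonglongrightarrow> I0 (entry x q, q)"
          by (intro continuous_on_tendsto_compose[OF elim(3)]) auto
        then show ?case using elim by auto
      qed
    qed (use pI_integrable X\<Omega> X(3) \<xi> p_integrable x in auto)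
    then show "\<forall>\<^sub>F n in sequentially. \<bar>Sc (X n) (Z n) - Sc x \<xi>\<bar> \<le> \<kappa> * W + \<epsilon>"
      using p(5)[OF x \<xi>] by (simp add: scattering_def)
  qed
qed

text \<open>The iteration starts from the bound \<open>2 * M\<close> supplied by
  \<open>Sc_bound\<close>; after \<open>k\<close> steps the oscillation is at most
  \<open>\<kappa> ^ k\<close> times this.\<close>

lemma osc_zero:
  assumes step: "\<And>W. osc_le W \<Longrightarrow> 0 \<le> W \<Longrightarrow> osc_le (\<kappa> * W)"
  shows "osc_le 0"
\<comment> \<open>For an empty domain \<open>M\<close> bounds nothing and may be negative.\<close>
proof (cases "\<Omega> = {}")
  case True
  then have "\<Omega>0 = {}" using Omega0(2) by blast
  then show ?thesis unfolding osc_le_def by blast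
next
  case False
  then have M0: "0 \<le> M" using M_nonneg by auto
  have "osc_le (2 * M)" unfolding osc_le_def
  proof (intro ballI allI impI always_eventually)
    fix x \<xi> X Z n and \<epsilon> :: real assume "\<xi> \<in> S1" "\<forall>n. Z n \<in> S1" "\<epsilon> > 0"
    then show "\<bar>Sc (X n) (Z n) - Sc x \<xi>\<bar> \<le> 2 * M + \<epsilon>"
      using Sc_bound[of \<xi> x] Sc_bound[of "Z n" "X n"] False by auto
  qed
  then have pow: "osc_le (\<kappa> ^ k * (2 * M))" for k
  proof (induction k)
    case (Suc k)
    then show ?case using step[of "\<kappa> ^ k * (2 * M)"] \<kappa>_bounds M0 by (simp add: mult.assoc)
  qed simp
  have "(\<lambda>k. \<kappa> ^ k * (2 * M)) \<longlonglongrightarrow> 0 * (2 * M)"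
    using \<kappa>_bounds by (intro tendsto_intros LIMSEQ_realpow_zero) auto
  then have small: "\<exists>k. \<kappa> ^ k * (2 * M) < \<epsilon>" if "\<epsilon> > 0" for \<epsilon>
    using order_tendstoD(2)[of _ "0 * (2 * M)" sequentially \<epsilon>] that
    by (auto simp: eventually_sequentially)
  show ?thesis unfolding osc_le_def
  proof (intro ballI allI impI)
    fix x \<xi> X Z and \<epsilon> :: real
    assume *: "x \<in> \<Omega>0" "\<xi> \<in> S1" "X \<longlonglongrightarrow> x" "Z \<longlonglongrightarrow> \<xi>" "\<forall>n. Z n \<in> S1" "\<epsilon> > 0"
    obtain k where k: "\<kappa> ^ k * (2 * M) < \<epsilon> / 2" using small[of "\<epsilon> / 2"] * by auto
    have "\<epsilon> / 2 > 0" using * by simp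
    with pow[of k] * have "\<forall>\<^sub>F n in sequentially. \<bar>Sc (X n) (Z n) - Sc x \<xi>\<bar> \<le> \<kappa> ^ k * (2 * M) + \<epsilon> / 2"
      unfolding osc_le_def by blast
    then show "\<forall>\<^sub>F n in sequentially. \<bar>Sc (X n) (Z n) - Sc x \<xi>\<bar> \<le> 0 + \<epsilon>"
      by eventually_elim (use k in linarith)
  qed
qed

end

section \<open>The circle of directions in boundary charts\<close>

text \<open>Passage to the complex plane, where \<open>Arg2pi\<close> provides a polar angle and
  \<open>Ln\<close> its derivative.\<close>

definition cx :: "real^2 \<Rightarrow> complex" where
  "cx v = Complex (v $ 1) (v $ 2)"

lemma cx_simps [simp]: "Re (cx v) = v $ 1" "Im (cx v) = v $ 2"
  by (simp_all add: cx_def)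

lemma bounded_linear_cx: "bounded_linear cx"
proof -
  have "linear cx" by (rule linearI) (simp_all add: complex_eq_iff)
  then show ?thesis by (simp add: linear_conv_bounded_linear)
qed

lemma norm_cx: "cmod (cx v) = norm v"
  by (simp add: cmod_def norm_eq_sqrt_inner inner_vec_def sum_2 power2_eq_square)

lemma dirv_Arg2pi: "v \<noteq> 0 \<Longrightarrow> dirv (Arg2pi (cx v)) = (1 / norm v) *\<^sub>R v"
  using cos_Arg2pi[of "cx v"] sin_Arg2pi[of "cx v"]
  by (simp add: vec_eq_iff forall_2 norm_cx field_simps)

lemma Arg2pi_dirv:
  assumes "0 < t" "0 \<le> \<theta>" "\<theta> < 2 * pi"
  shows "Arg2pi (cx (t *\<^sub>R dirv \<theta>)) = \<theta>"
  by (rule Arg2pi_unique[OF _ assms]) (simp add: complex_eq_iff Re_exp Im_exp)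

text \<open>The direction of travel from \<open>y\<close> to \<open>z\<close>. For \<open>z\<close>
  in the domain and \<open>y\<close> on its boundary it is inverse to \<open>entry_pt\<close>, by
  \<open>entry_dirn\<close> and \<open>dirn_entry\<close>.\<close>

definition dirn :: "real^2 \<Rightarrow> real^2 \<Rightarrow> real^2" where
  "dirn z y = (1 / norm (z - y)) *\<^sub>R (z - y)"

lemma norm_dirn: "z \<noteq> y \<Longrightarrow> norm (dirn z y) = 1"
  by (simp add: dirn_def)

lemma dirn_tendsto:
  assumes "(X \<longlongrightarrow> x) F" "x \<noteq> y"
  shows "((\<lambda>n. dirn (X n) y) \<longlongrightarrow> dirn x y) F"
  unfolding dirn_def by (intro tendsto_intros assms) (use assms in auto)

text \<open>The branch cut of the polar angle is a single direction, which integration does not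
  see.\<close>

lemma cx_nonneg_Reals:
  assumes "cx (z - y) \<in> \<real>\<^sub>\<ge>\<^sub>0" "z \<noteq> y"
  shows "dirn z y = dirv 0"
proof -
  have "Arg2pi (cx (z - y)) = 0"
    using assms(1) by (metis Arg2pi_eq_0 nonneg_Reals_subset_Reals complex_nonneg_Reals_iff subsetD)
  then show ?thesis using dirv_Arg2pi[of "z - y"] assms(2) by (simp add: dirn_def)
qed

context convex_domain
begin

lemma entry_dirn:
  assumes z: "z \<in> \<Omega>" and y: "y \<in> frontier \<Omega>"
  shows "entry_pt \<Omega> z (dirn z y) = y"
proof -
  have yc: "y \<in> closure \<Omega>" "y \<notin> \<Omega>" using y op by (simp_all add: frontier_def interior_open)
  then have ne: "z \<noteq> y" using z by blast
  have eq: "z - norm (z - y) *\<^sub>R dirn z y = y" using ne by (simp add: dirn_def)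
  have "through z (dirn z y)" using norm_dirn[OF ne] z by (intro through_Omega) auto
  then have "norm (z - y) \<le> tau_minus \<Omega> z (dirn z y)" using le_tau_minus eq yc by metis
  moreover have "\<not> norm (z - y) < tau_minus \<Omega> z (dirn z y)"
    using before_tau_minus[of "norm (z - y)" z "dirn z y"] ne eq yc by auto
  ultimately show ?thesis using eq by (simp add: entry_pt_def)
qed

lemma dirn_entry:
  assumes z: "z \<in> \<Omega>" and \<xi>: "\<xi> \<in> S1"
  shows "dirn z (entry_pt \<Omega> z \<xi>) = \<xi>" "0 < tau_minus \<Omega> z \<xi>"
proof -
  have "entry_pt \<Omega> z \<xi> \<notin> \<Omega>" 
    using entry_frontier(1)[OF through_Omega[OF z \<xi>]] op by (simp add: frontier_def interior_open)
  then have "tau_minus \<Omega> z \<xi> \<noteq> 0" using z by (auto simp: entry_pt_def)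
  then show "0 < tau_minus \<Omega> z \<xi>" using tau_minus_nonneg[OF \<xi>, of z] by linarith
  then show "dirn z (entry_pt \<Omega> z \<xi>) = \<xi>" using \<xi> by (simp add: dirn_def entry_pt_def)
qed

end

lemma orthonormal_R2:
  fixes u v y :: "real^2"
  assumes "norm u = 1" "norm v = 1" "u \<bullet> v = 0"
  shows "y = (y \<bullet> u) *\<^sub>R u + (y \<bullet> v) *\<^sub>R v"
proof -
  define w where "w = y - ((y \<bullet> u) *\<^sub>R u + (y \<bullet> v) *\<^sub>R v)"
  have uv: "u \<bullet> u = 1" "v \<bullet> v = 1" using assms by (simp_all add: norm_eq_1)
  have "w \<bullet> u = 0" "w \<bullet> v = 0"
    using uv assms(3) inner_commute[of v u] by (simp_all add: w_def inner_diff_left inner_add_left)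
  then have c: "w $ 1 * u $ 1 + w $ 2 * u $ 2 = 0" "w $ 1 * v $ 1 + w $ 2 * v $ 2 = 0"
    "u $ 1 * u $ 1 + u $ 2 * u $ 2 = 1" "v $ 1 * v $ 1 + v $ 2 * v $ 2 = 1"
    "u $ 1 * v $ 1 + u $ 2 * v $ 2 = 0"
    using uv assms(3) by (simp_all add: inner_vec_def sum_2)
  \<comment> \<open>The determinant of the frame. By Lagrange's identity its square is 1, and
    Cramer's rule then annihilates \<open>w\<close>.\<close>
  define d where "d = u $ 1 * v $ 2 - u $ 2 * v $ 1"
  have "d * d = (u $ 1 * u $ 1 + u $ 2 * u $ 2) * (v $ 1 * v $ 1 + v $ 2 * v $ 2) - (u $ 1 * v $ 1 + u $ 2 * v $ 2)\<^sup>2"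
    by (simp add: d_def algebra_simps power2_eq_square)
  then have "d \<noteq> 0" using c by auto
  moreover have "w $ 1 * d = (w $ 1 * u $ 1 + w $ 2 * u $ 2) * v $ 2 - (w $ 1 * v $ 1 + w $ 2 * v $ 2) * u $ 2"
    "w $ 2 * d = (w $ 1 * v $ 1 + w $ 2 * v $ 2) * u $ 1 - (w $ 1 * u $ 1 + w $ 2 * u $ 2) * v $ 1"
    by (simp_all add: d_def algebra_simps)
  then have "w $ 1 * d = 0" "w $ 2 * d = 0" by (simp_all only: c mult_zero_left diff_self)
  ultimately have "w = 0" by (simp add: vec_eq_iff forall_2)
  then show ?thesis by (simp add: w_def)
qed

definition graph_pt :: "real^2 \<Rightarrow> real^2 \<Rightarrow> (real \<Rightarrow> real) \<Rightarrow> real \<Rightarrow> real^2" where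
  "graph_pt u v g s = s *\<^sub>R u + g s *\<^sub>R v"

text \<open>The derivative in \<open>s\<close> of the polar angle of \<open>z - graph_pt u v g s\<close>.\<close>

definition angle_deriv ::
  "real^2 \<Rightarrow> real^2 \<Rightarrow> (real \<Rightarrow> real) \<Rightarrow> (real \<Rightarrow> real) \<Rightarrow> real^2 \<Rightarrow> real \<Rightarrow> real" where
  "angle_deriv u v g g' z s =
     ((z - graph_pt u v g s) $ 2 * (u + g' s *\<^sub>R v) $ 1 - (z - graph_pt u v g s) $ 1 * (u + g' s *\<^sub>R v) $ 2)
       / (norm (z - graph_pt u v g s))\<^sup>2"

text \<open>The angle turns at most at the rate speed over distance. The speed of the graph is at
  most \<open>1 + G\<close>; the factor 2 comes from estimating the two products separately.\<close>

lemma angle_deriv_bound: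
  assumes "norm u = 1" "norm v = 1" "\<delta> > 0" "\<delta> \<le> norm (z - graph_pt u v g s)" "\<bar>g' s\<bar> \<le> G"
  shows "\<bar>angle_deriv u v g g' z s\<bar> \<le> 2 * (1 + G) / \<delta>"
proof -
  let ?\<zeta> = "z - graph_pt u v g s" and ?d = "u + g' s *\<^sub>R v"
  have d: "norm ?d \<le> 1 + G" using norm_triangle_ineq[of u "g' s *\<^sub>R v"] assms by simp
  have pos: "norm ?\<zeta> > 0" using assms by linarith
  have "\<bar>?\<zeta> $ 2 * ?d $ 1 - ?\<zeta> $ 1 * ?d $ 2\<bar> \<le> \<bar>?\<zeta> $ 2\<bar> * \<bar>?d $ 1\<bar> + \<bar>?\<zeta> $ 1\<bar> * \<bar>?d $ 2\<bar>"
    using abs_triangle_ineq4[of "?\<zeta> $ 2 * ?d $ 1" "?\<zeta> $ 1 * ?d $ 2"] unfolding abs_mult .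
  also have "\<dots> \<le> norm ?\<zeta> * norm ?d + norm ?\<zeta> * norm ?d"
    by (intro add_mono mult_mono component_le_norm_cart) auto
  also have "\<dots> \<le> norm ?\<zeta> * (2 * (1 + G))"
    using mult_left_mono[OF d norm_ge_zero[of ?\<zeta>]] by (simp add: algebra_simps)
  finally have "\<bar>angle_deriv u v g g' z s\<bar> \<le> norm ?\<zeta> * (2 * (1 + G)) / (norm ?\<zeta>)\<^sup>2"
    unfolding angle_deriv_def abs_divide by (simp add: divide_right_mono)
  also have "\<dots> = 2 * (1 + G) / norm ?\<zeta>" using pos by (simp add: power2_eq_square)
  also have "\<dots> \<le> 2 * (1 + G) / \<delta>" using assms(3-5) pos by (intro divide_left_mono mult_pos_pos) auto
  finally show ?thesis .
qed

lemma angle_deriv_tendsto: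
  assumes "(X \<longlongrightarrow> x) F" "x \<noteq> graph_pt u v g s"
  shows "((\<lambda>n. angle_deriv u v g g' (X n) s) \<longlongrightarrow> angle_deriv u v g g' x s) F"
  unfolding angle_deriv_def by (intro tendsto_intros assms) (use assms in auto)

lemma Im_mult_inverse_minus:
  "Im (a * inverse (- b)) = (Im b * Re a - Re b * Im a) / (cmod b)\<^sup>2"
  by (simp add: cmod_power2 diff_divide_distrib mult.commute)

section \<open>A single chart: the polar angle as a change of variables\<close>

locale chart = convex_domain +
  fixes c :: "real^2" and r :: real and u v :: "real^2" and g g' :: "real \<Rightarrow> real"
  assumes chart: "C1_graph_at \<Omega> c r u v g g'"
begin

abbreviation Y :: "real \<Rightarrow> real^2" where "Y \<equiv> graph_pt u v g"

abbreviation angle :: "real^2 \<Rightarrow> real \<Rightarrow> real" where "angle z s \<equiv> Arg2pi (cx (z - Y s))"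

lemma chart': "norm u = 1" "norm v = 1" "u \<bullet> v = 0"
    "(g has_real_derivative g' s) (at s)" "continuous_on UNIV g'"
    "y \<in> ball c r \<Longrightarrow> y \<in> \<Omega> \<longleftrightarrow> y \<bullet> v < g (y \<bullet> u)"
  using chart unfolding C1_graph_at_def by auto

lemma Y_inner [simp]: "Y s \<bullet> u = s" "Y s \<bullet> v = g s"
  using chart'(1-3) inner_commute[of v u] by (simp_all add: graph_pt_def inner_add_left norm_eq_1)

lemma Y_deriv: "(Y has_vector_derivative (u + g' s *\<^sub>R v)) (at s)"
  unfolding graph_pt_def[abs_def]
  by (auto intro!: derivative_eq_intros chart'(4))

lemma continuous_Y: "continuous_on S Y"
  using Y_deriv by (meson continuous_at_imp_continuous_on has_vector_derivative_continuous)

lemma Y_frontier: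
  assumes "Y s \<in> ball c r"
  shows "Y s \<in> frontier \<Omega>"
proof -
  have "Y s \<notin> \<Omega>" using chart'(6)[OF assms] by simp
  moreover have "Y s \<in> closure \<Omega>"
  proof (rule Lim_in_closed_set[OF closed_closure])
    show lim: "((\<lambda>e. Y s - e *\<^sub>R v) \<longlongrightarrow> Y s) (at_right 0)"
    proof -
      have "((\<lambda>e. Y s - e *\<^sub>R v) \<longlongrightarrow> Y s - 0 *\<^sub>R v) (at_right 0)" by (intro tendsto_intros)
      then show ?thesis by simp
    qed
    have "\<forall>\<^sub>F e in at_right (0::real). e > 0" by (simp add: eventually_at_filter)
    with topological_tendstoD[OF lim open_ball assms]
    show "\<forall>\<^sub>F e in at_right 0. Y s - e *\<^sub>R v \<in> closure \<Omega>"
    proof eventually_elim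
      case (elim e)
      have "v \<bullet> v = 1" "v \<bullet> u = 0" using chart'(2,3) by (simp_all add: norm_eq_1 inner_commute)
      then have "Y s - e *\<^sub>R v \<in> \<Omega>" using chart'(6)[OF elim(1)] elim(2) by (simp add: inner_diff_left)
      then show ?case using closure_subset by blast
    qed
  qed auto
  ultimately show ?thesis using op by (simp add: frontier_def interior_open)
qed

lemma frontier_Y:
  assumes "y \<in> frontier \<Omega>" "y \<in> ball c r"
  shows "Y (y \<bullet> u) = y"
  using orthonormal_R2[OF chart'(1-3), of y] C1_graph_frontier[OF op assms(1) chart assms(2)]
  by (simp add: graph_pt_def)

text \<open>Off the nonnegative real axis \<open>Arg2pi w\<close> equals
  \<open>Im (Ln (- w)) + pi\<close>, so the derivative is the imaginary part of a logarithmic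
  derivative. As the axis is closed, the identity holds on a whole neighbourhood of
  \<open>s\<close>.\<close>

lemma angle_has_deriv:
  assumes "cx (z - Y s) \<notin> \<real>\<^sub>\<ge>\<^sub>0"
  shows "(angle z has_field_derivative angle_deriv u v g g' z s) (at s)"
proof -
  let ?\<zeta> = "\<lambda>s. - cx (z - Y s)" and ?d = "u + g' s *\<^sub>R v"
  have "((\<lambda>s. z - Y s) has_vector_derivative - ?d) (at s)"
    using Y_deriv[of s] by (auto intro!: derivative_eq_intros)
  from bounded_linear.has_vector_derivative[OF bounded_linear_cx this]
  have \<zeta>: "(?\<zeta> has_vector_derivative - cx (- ?d)) (at s)"
    by (rule has_vector_derivative_minus)
  have "?\<zeta> s \<notin> \<real>\<^sub>\<le>\<^sub>0" using assms by simp
  then have "((Ln \<circ> ?\<zeta>) has_vector_derivative (- cx (- ?d) * inverse (?\<zeta> s))) (at s)"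
    by (intro field_vector_diff_chain_at[OF \<zeta>] has_field_derivative_Ln)
  from bounded_linear.has_vector_derivative[OF bounded_linear_Im this]
  have "((\<lambda>s. Im (Ln (?\<zeta> s)) + pi) has_field_derivative Im (- cx (- ?d) * inverse (?\<zeta> s))) (at s)"
    by (auto simp: has_real_derivative_iff_has_vector_derivative o_def intro!: derivative_eq_intros)
  moreover have "Im (- cx (- ?d) * inverse (?\<zeta> s)) = angle_deriv u v g g' z s"
    using Im_mult_inverse_minus[of "cx ?d" "cx (z - Y s)"] linear_neg[OF bounded_linear.linear[OF bounded_linear_cx], of ?d]
    by (simp add: angle_deriv_def norm_cx)
  moreover have "open {s. cx (z - Y s) \<notin> \<real>\<^sub>\<ge>\<^sub>0}"
  proof -
    have "continuous_on UNIV (\<lambda>s. cx (z - Y s))"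
      by (intro bounded_linear.continuous_on[OF bounded_linear_cx] continuous_intros continuous_Y)
    from open_vimage[OF _ this, of "- \<real>\<^sub>\<ge>\<^sub>0"] closed_nonneg_Reals_complex
    show ?thesis by (simp add: vimage_def open_Compl)
  qed
  moreover have "Im (Ln (?\<zeta> s)) + pi = angle z s" if "s \<in> {s. cx (z - Y s) \<notin> \<real>\<^sub>\<ge>\<^sub>0}" for s
    using that by (simp add: Arg2pi_Ln Arg2pi_gt_0)
  ultimately show ?thesis
    using assms by (auto intro: has_field_derivative_transform_within_open)
qed

lemma dirn_Y_inj:
  assumes z: "z \<in> \<Omega>"
  shows "inj_on (\<lambda>s. dirn z (Y s)) {s. Y s \<in> ball c r}"
proof (rule inj_onI)
  fix s t assume *: "s \<in> {s. Y s \<in> ball c r}" "t \<in> {s. Y s \<in> ball c r}" "dirn z (Y s) = dirn z (Y t)"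
  then have "Y s = Y t" using entry_dirn[OF z Y_frontier] by (metis mem_Collect_eq)
  then show "s = t" using Y_inner(1) by metis
qed

lemma ne_Y: "z \<in> \<Omega> \<Longrightarrow> Y s \<in> ball c r \<Longrightarrow> z \<noteq> Y s"
  using chart'(6)[of "Y s"] by auto

lemma dirv_angle: "z \<in> \<Omega> \<Longrightarrow> Y s \<in> ball c r \<Longrightarrow> dirv (angle z s) = dirn z (Y s)"
  using ne_Y dirv_Arg2pi[of "z - Y s"] by (auto simp: dirn_def)

definition piece :: "real set \<Rightarrow> real^2 \<Rightarrow> real set" where
  "piece T z = {s \<in> T. cx (z - Y s) \<notin> \<real>\<^sub>\<ge>\<^sub>0}"

lemma piece_measurable:
  assumes "T \<in> sets lebesgue"
  shows "piece T z \<in> sets lebesgue"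
proof -
  have "continuous_on UNIV (\<lambda>s. cx (z - Y s))"
    by (intro bounded_linear.continuous_on[OF bounded_linear_cx] continuous_intros continuous_Y)
  from open_vimage[OF _ this, of "- \<real>\<^sub>\<ge>\<^sub>0"] closed_nonneg_Reals_complex
  have "open {s. cx (z - Y s) \<notin> \<real>\<^sub>\<ge>\<^sub>0}" by (simp add: vimage_def open_Compl)
  then have "{s. cx (z - Y s) \<notin> \<real>\<^sub>\<ge>\<^sub>0} \<in> sets lebesgue" by auto
  moreover have "piece T z = T \<inter> {s. cx (z - Y s) \<notin> \<real>\<^sub>\<ge>\<^sub>0}" by (auto simp: piece_def)
  ultimately show ?thesis using assms by auto
qed

text \<open>Entry point and direction determine each other, which gives both inclusions. The angle 0
  is missing on both sides because \<open>piece\<close> leaves out the branch cut.\<close>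

lemma angle_image:
  assumes z: "z \<in> \<Omega>" and T: "T \<subseteq> {s. Y s \<in> ball c r}"
  shows "angle z ` piece T z = {\<theta> \<in> {0<..<2*pi}. entry_pt \<Omega> z (dirv \<theta>) \<in> Y ` T}"
proof (intro equalityI subsetI)
  fix \<theta> assume "\<theta> \<in> angle z ` piece T z"
  then obtain s where s: "s \<in> T" "cx (z - Y s) \<notin> \<real>\<^sub>\<ge>\<^sub>0" "\<theta> = angle z s" by (auto simp: piece_def)
  have "Y s \<in> ball c r" using s T by auto
  then have "entry_pt \<Omega> z (dirv \<theta>) = Y s"
    using s dirv_angle[OF z] entry_dirn[OF z Y_frontier] by simp
  moreover have "0 < \<theta>" "\<theta> < 2 * pi" using s Arg2pi_gt_0 Arg2pi_lt_2pi by auto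
  ultimately show "\<theta> \<in> {\<theta> \<in> {0<..<2*pi}. entry_pt \<Omega> z (dirv \<theta>) \<in> Y ` T}" using s by auto
next
  fix \<theta> assume \<theta>: "\<theta> \<in> {\<theta> \<in> {0<..<2*pi}. entry_pt \<Omega> z (dirv \<theta>) \<in> Y ` T}"
  then obtain s where s: "s \<in> T" "entry_pt \<Omega> z (dirv \<theta>) = Y s" by auto
  have "z - Y s = tau_minus \<Omega> z (dirv \<theta>) *\<^sub>R dirv \<theta>"
    unfolding s(2)[symmetric] by (simp add: entry_pt_def)
  then have a: "angle z s = \<theta>"
    using Arg2pi_dirv[OF dirn_entry(2)[OF z dirv_S1], of \<theta>] \<theta> by simp
  then have "angle z s \<noteq> 0" using \<theta> by auto
  then have "cx (z - Y s) \<notin> \<real>\<^sub>\<ge>\<^sub>0"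
    by (metis Arg2pi_eq_0 nonneg_Reals_subset_Reals complex_nonneg_Reals_iff subsetD)
  then show "\<theta> \<in> angle z ` piece T z" using s a by (auto simp: piece_def intro!: image_eqI[of _ _ s])
qed

definition weight :: "real set \<Rightarrow> real^2 \<Rightarrow> real \<Rightarrow> real" where
  "weight T z s = indicator (piece T z) s * \<bar>angle_deriv u v g g' z s\<bar>"

text \<open>Change of variables for an injective differentiable map on a merely measurable set, with
  \<open>weight\<close> as Jacobian; hence the boundary may be cut into pieces without regard to
  their shape.\<close>

lemma piece_integral:
  fixes f :: "real^2 \<Rightarrow> real"
  assumes z: "z \<in> \<Omega>" and T: "T \<subseteq> {s. Y s \<in> ball c r}" "T \<in> sets lebesgue"
    and f: "integrable circle_measure f"
  shows "integrable lebesgue (\<lambda>s. weight T z s * f (dirn z (Y s)))"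
    and "(\<integral>s. weight T z s * f (dirn z (Y s)) \<partial>lebesgue) = (LINT \<theta>:angle z ` piece T z|lebesgue. f (dirv \<theta>))"
    and "angle z ` piece T z \<in> sets lebesgue"
    and "(\<lambda>\<theta>. f (dirv \<theta>)) absolutely_integrable_on angle z ` piece T z"
proof -
  let ?P = "piece T z" and ?D = "angle_deriv u v g g' z"
  note P = piece_measurable[OF T(2), of z]
  have D: "(angle z has_field_derivative ?D s) (at s within ?P)" if "s \<in> ?P" for s
    using that by (intro has_field_derivative_at_within[OF angle_has_deriv]) (auto simp: piece_def)
  have "inj_on (\<lambda>s. dirv (angle z s)) ?P"
    using dirn_Y_inj[OF z] T(1) by (auto simp: inj_on_def piece_def subset_iff dirv_angle[OF z])
  then have inj: "inj_on (angle z) ?P" by (auto simp: inj_on_def)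
  show m: "angle z ` ?P \<in> sets lebesgue"
  proof (rule differentiable_image_in_sets_lebesgue[OF P])
    show "angle z differentiable_on ?P" unfolding differentiable_on_def
      using D has_field_derivative_imp_has_derivative differentiableI by blast
  qed simp
  show ai: "(\<lambda>\<theta>. f (dirv \<theta>)) absolutely_integrable_on angle z ` ?P"
    using angle_image[OF z T(1)] by (intro set_integrable_subset[OF circle_measure_integral(1)[OF f]] m) auto
  have "(\<lambda>s. \<bar>?D s\<bar> * f (dirv (angle z s))) absolutely_integrable_on ?P \<and>
     integral ?P (\<lambda>s. \<bar>?D s\<bar> * f (dirv (angle z s))) = integral (angle z ` ?P) (\<lambda>\<theta>. f (dirv \<theta>))"
    using has_absolute_integral_change_of_variables_1'[OF P D inj, of "\<lambda>\<theta>. f (dirv \<theta>)"] ai by blast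
  then have *: "(\<lambda>s. \<bar>?D s\<bar> * f (dirv (angle z s))) absolutely_integrable_on ?P"
    "(LINT s:?P|lebesgue. \<bar>?D s\<bar> * f (dirv (angle z s))) = (LINT \<theta>:angle z ` ?P|lebesgue. f (dirv \<theta>))"
    using ai by (simp_all add: set_lebesgue_integral_eq_integral)
  have eq: "indicator ?P s *\<^sub>R (\<bar>?D s\<bar> * f (dirv (angle z s))) = weight T z s * f (dirn z (Y s))" for s
    using dirv_angle[OF z, of s] T(1) by (auto simp: weight_def indicator_def piece_def)
  show "integrable lebesgue (\<lambda>s. weight T z s * f (dirn z (Y s)))"
    "(\<integral>s. weight T z s * f (dirn z (Y s)) \<partial>lebesgue) = (LINT \<theta>:angle z ` ?P|lebesgue. f (dirv \<theta>))"
    using * unfolding set_integrable_def set_lebesgue_integral_def eq by auto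
qed

end

section \<open>Covering the boundary by finitely many charts\<close>

lemma (in C1_convex_domain) finite_chart_cover:
  obtains m :: nat and c r u v g g' where
    "\<And>k. k < m \<Longrightarrow> C1_graph_at \<Omega> (c k) (r k) (u k) (v k) (g k) (g' k)"
    "\<And>k. k < m \<Longrightarrow> c k \<in> frontier \<Omega>"
    "frontier \<Omega> \<subseteq> (\<Union>k<m. ball (c k) (r k))"
proof -
  obtain r u v g g' where ch: "\<forall>x\<in>frontier \<Omega>. C1_graph_at \<Omega> x (r x) (u x) (v x) (g x) (g' x)"
    using C1 unfolding C1_boundary_def bchoice_iff by blast
  then have r: "r x > 0" if "x \<in> frontier \<Omega>" for x using that unfolding C1_graph_at_def by blast
  obtain A where A: "A \<subseteq> frontier \<Omega>" "finite A" "frontier \<Omega> \<subseteq> (\<Union>x\<in>A. ball x (r x))"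
  proof (rule compactE_image[OF compact_frontier_bounded[OF bdd]])
    show "frontier \<Omega> \<subseteq> (\<Union>x\<in>frontier \<Omega>. ball x (r x))" using r by (auto intro!: bexI)
  qed auto
  obtain m :: nat and h where h: "A = h ` {i. i < m}"
    using finite_imp_nat_seg_image_inj_on[OF A(2)] by blast
  show thesis
    by (rule that[of m h "r \<circ> h" "u \<circ> h" "v \<circ> h" "g \<circ> h" "g' \<circ> h"]) (use ch A h in auto)
qed

locale chart_family = C1_convex_domain +
  fixes m :: nat and c :: "nat \<Rightarrow> real^2" and r :: "nat \<Rightarrow> real" and u v :: "nat \<Rightarrow> real^2"
    and g g' :: "nat \<Rightarrow> real \<Rightarrow> real"
  assumes charts: "\<And>k. k < m \<Longrightarrow> C1_graph_at \<Omega> (c k) (r k) (u k) (v k) (g k) (g' k)"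
    and cover: "frontier \<Omega> \<subseteq> (\<Union>k<m. ball (c k) (r k))"
begin

abbreviation Yk :: "nat \<Rightarrow> real \<Rightarrow> real^2" where "Yk k \<equiv> graph_pt (u k) (v k) (g k)"

text \<open>Each boundary point is assigned to the first chart that contains it, so that the sum
  over the charts counts it once.\<close>

definition T :: "nat \<Rightarrow> real set" where
  "T k = {s. Yk k s \<in> ball (c k) (r k) \<and> (\<forall>i<k. Yk k s \<notin> ball (c i) (r i))}"

text \<open>This is \<open>weight (T k)\<close> of the \<open>k\<close>-th chart, restated outside
  \<open>chart\<close> so that different charts can occur in one sum.\<close>

definition wt :: "nat \<Rightarrow> real^2 \<Rightarrow> real \<Rightarrow> real" where
  "wt k z s = indicator {s \<in> T k. cx (z - Yk k s) \<notin> \<real>\<^sub>\<ge>\<^sub>0} s * \<bar>angle_deriv (u k) (v k) (g k) (g' k) z s\<bar>"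

lemma chart_k: "k < m \<Longrightarrow> chart \<Omega> (c k) (r k) (u k) (v k) (g k) (g' k)"
  using charts by unfold_locales

lemma T_measurable:
  assumes "k < m"
  shows "T k \<in> sets lebesgue"
proof -
  interpret chart \<Omega> "c k" "r k" "u k" "v k" "g k" "g' k" by (rule chart_k[OF assms])
  have "open {s. Yk k s \<in> ball a b}" for a b
    using open_vimage[OF open_ball continuous_Y, of a b] by (simp add: vimage_def)
  then have m: "{s. Yk k s \<in> ball a b} \<in> sets lebesgue" for a b by auto
  have "T k = {s. Yk k s \<in> ball (c k) (r k)} - (\<Union>i<k. {s. Yk k s \<in> ball (c i) (r i)})"
    by (auto simp: T_def)
  then show ?thesis using m by auto
qed

lemma T_frontier: "k < m \<Longrightarrow> s \<in> T k \<Longrightarrow> Yk k s \<in> frontier \<Omega>"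
  using chart.Y_frontier[OF chart_k] by (simp add: T_def)

lemma T_disjoint: "s \<in> T k \<Longrightarrow> t \<in> T j \<Longrightarrow> Yk k s = Yk j t \<Longrightarrow> k = j"
  unfolding T_def by (metis (mono_tags, lifting) mem_Collect_eq linorder_neqE_nat)

lemma T_cover:
  assumes "y \<in> frontier \<Omega>"
  shows "\<exists>k<m. \<exists>s\<in>T k. y = Yk k s"
proof -
  define k where "k = (LEAST k. y \<in> ball (c k) (r k))"
  obtain j where j: "j < m" "y \<in> ball (c j) (r j)" using assms cover by blast
  have k: "y \<in> ball (c k) (r k)" unfolding k_def by (rule LeastI[of _ j]) (rule j)
  have "k \<le> j" unfolding k_def by (rule Least_le) (rule j)
  then have km: "k < m" using j by simp
  have "Yk k (y \<bullet> u k) = y" using chart.frontier_Y[OF chart_k[OF km] assms k] .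
  moreover have "y \<notin> ball (c i) (r i)" if "i < k" for i
    using not_less_Least that unfolding k_def by blast
  ultimately show ?thesis using km k by (intro exI[of _ k] conjI bexI[of _ "y \<bullet> u k"]) (simp_all add: T_def)
qed

text \<open>The sets \<open>J k\<close> of angles whose entry point lies in the \<open>k\<close>-th
  boundary piece partition the open interval of angles, and \<open>piece_integral\<close> transforms
  each part.\<close>

lemma circle_integral_charts:
  fixes f :: "real^2 \<Rightarrow> real"
  assumes z: "z \<in> \<Omega>" and f: "integrable circle_measure f"
  shows "k < m \<Longrightarrow> integrable lebesgue (\<lambda>s. wt k z s * f (dirn z (Yk k s)))"
    and "(\<integral>\<xi>. f \<xi> \<partial>circle_measure) = (\<Sum>k<m. \<integral>s. wt k z s * f (dirn z (Yk k s)) \<partial>lebesgue)"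
proof -
  define J where "J k = {\<theta> \<in> {0<..<2*pi}. entry_pt \<Omega> z (dirv \<theta>) \<in> Yk k ` T k}" for k
  have piece: "integrable lebesgue (\<lambda>s. wt k z s * f (dirn z (Yk k s)))"
    "(\<integral>s. wt k z s * f (dirn z (Yk k s)) \<partial>lebesgue) = (LINT \<theta>:J k|lebesgue. f (dirv \<theta>))"
    "J k \<in> sets lebesgue" "(\<lambda>\<theta>. f (dirv \<theta>)) absolutely_integrable_on J k" if k: "k < m" for k
  proof -
    interpret chart \<Omega> "c k" "r k" "u k" "v k" "g k" "g' k" by (rule chart_k[OF k])
    have sub: "T k \<subseteq> {s. Yk k s \<in> ball (c k) (r k)}" by (auto simp: T_def)
    have w: "weight (T k) z = wt k z" by (auto simp: fun_eq_iff weight_def wt_def piece_def)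
    from piece_integral[OF z sub T_measurable[OF k] f]
    show "integrable lebesgue (\<lambda>s. wt k z s * f (dirn z (Yk k s)))"
      "(\<integral>s. wt k z s * f (dirn z (Yk k s)) \<partial>lebesgue) = (LINT \<theta>:J k|lebesgue. f (dirv \<theta>))"
      "J k \<in> sets lebesgue" "(\<lambda>\<theta>. f (dirv \<theta>)) absolutely_integrable_on J k"
      unfolding w angle_image[OF z sub] J_def by auto
  qed
  show "k < m \<Longrightarrow> integrable lebesgue (\<lambda>s. wt k z s * f (dirn z (Yk k s)))" by (rule piece(1))
  have U: "{0<..<2*pi} = (\<Union>k<m. J k)"
  proof -
    have "\<exists>k<m. \<theta> \<in> J k" if \<theta>: "\<theta> \<in> {0<..<2*pi}" for \<theta>
      using T_cover[OF entry_frontier(1)[OF through_Omega[OF z dirv_S1]], of \<theta>] \<theta>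
      unfolding J_def by blast
    then have "{0<..<2*pi} \<subseteq> (\<Union>k<m. J k)" by blast
    then show ?thesis by (auto simp: J_def)
  qed
  have "disjoint_family_on J {..<m}"
    unfolding disjoint_family_on_def J_def using T_disjoint by (auto; metis)
  then have "(LINT \<theta>:(\<Union>k<m. J k)|lebesgue. f (dirv \<theta>)) = (\<Sum>k<m. LINT \<theta>:J k|lebesgue. f (dirv \<theta>))"
    by (intro set_integral_finite_Union) (use piece in auto)
  moreover have "(LINT \<theta>:{0<..<2*pi}|lebesgue. f (dirv \<theta>)) = (\<integral>\<xi>. f \<xi> \<partial>circle_measure)"
    using circle_measure_integral[OF f] by (simp add: set_lebesgue_integral_eq_integral)
  ultimately show "(\<integral>\<xi>. f \<xi> \<partial>circle_measure) = (\<Sum>k<m. \<integral>s. wt k z s * f (dirn z (Yk k s)) \<partial>lebesgue)"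
    using piece(2) by (simp add: U)
qed

text \<open>Supplies the dominating function for moving \<open>z\<close>. A chart point has first
  coordinate \<open>s\<close>, so its parameter is within the chart radius of the coordinate of the
  centre, and on this compact interval the slope is bounded by continuity.\<close>

lemma wt_bound:
  assumes k: "k < m" and \<delta>: "\<delta> > 0"
  shows "\<exists>B. integrable lebesgue B \<and>
    (\<forall>z s. (\<forall>y\<in>frontier \<Omega>. \<delta> \<le> norm (z - y)) \<longrightarrow> \<bar>wt k z s\<bar> \<le> B s)"
proof -
  interpret chart \<Omega> "c k" "r k" "u k" "v k" "g k" "g' k" by (rule chart_k[OF k])
  let ?J = "{c k \<bullet> u k - r k .. c k \<bullet> u k + r k}"
  have "compact (g' k ` ?J)"
    by (intro compact_continuous_image continuous_on_subset[OF chart'(5)]) auto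
  then obtain G where G: "\<forall>s\<in>?J. \<bar>g' k s\<bar> \<le> G"
    using compact_imp_bounded[of "g' k ` ?J"] unfolding bounded_iff by auto
  let ?B = "\<lambda>s. indicator ?J s * (2 * (1 + \<bar>G\<bar>) / \<delta>)"
  have "\<bar>wt k z s\<bar> \<le> ?B s" if z: "\<forall>y\<in>frontier \<Omega>. \<delta> \<le> norm (z - y)" for z s
  proof (cases "s \<in> T k")
    case True
    have "s \<in> ?J"
    proof -
      have "\<bar>(c k - Yk k s) \<bullet> u k\<bar> \<le> norm (c k - Yk k s) * norm (u k)" by (rule Cauchy_Schwarz_ineq2)
      also have "\<dots> \<le> r k" using True chart'(1) by (simp add: T_def dist_norm)
      finally show ?thesis by (auto simp: inner_diff_left)
    qed
    moreover have "\<bar>angle_deriv (u k) (v k) (g k) (g' k) z s\<bar> \<le> 2 * (1 + \<bar>G\<bar>) / \<delta>"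
      using z T_frontier[OF k True] bspec[OF G \<open>s \<in> ?J\<close>]
      by (intro angle_deriv_bound chart'(1,2) \<delta>) auto
    ultimately show ?thesis using \<delta> by (simp add: wt_def indicator_def)
  next
    case False
    then show ?thesis using \<delta> by (simp add: wt_def)
  qed
  then show ?thesis using integrable_indicator_const by blast
qed

end

section \<open>Contraction for data that are continuous in the direction\<close>

context transport
begin

text \<open>Parametrising the circle of directions at \<open>z\<close> by the boundary point they come from fixes the
  first argument of \<open>I0\<close> while \<open>z\<close> moves, so continuity of \<open>I0\<close> in the direction suffices.\<close>

lemma osc_step_pt:
  assumes I0: "boundary_null \<Omega>
       {x \<in> frontier \<Omega>. \<not> continuous_on (Gamma_minus_pt \<Omega> x) (\<lambda>\<xi>. I0 (x, \<xi>))}"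
    and W: "osc_le W" "0 \<le> W"
  shows "osc_le (\<kappa> * W)"
proof (rule osc_leI)
  fix x \<xi> assume x: "x \<in> \<Omega>0" and \<xi>: "\<xi> \<in> S1"
  obtain m :: nat and c r u v g g' where fam:
    "\<And>k. k < m \<Longrightarrow> C1_graph_at \<Omega> (c k) (r k) (u k) (v k) (g k) (g' k)"
    "\<And>k. k < m \<Longrightarrow> c k \<in> frontier \<Omega>"
    "frontier \<Omega> \<subseteq> (\<Union>k<m. ball (c k) (r k))"
    by (rule finite_chart_cover) (rule that)
  interpret chart_family \<Omega> m c r u v g g' using fam(1,3) by unfold_locales
  have x\<Omega>: "x \<in> \<Omega>" using x Omega0(2) by blast
  obtain d where d: "d > 0" "ball x d \<subseteq> \<Omega>" using openE[OF op x\<Omega>] by blast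
  \<comment> \<open>Half the radius of a ball inside the domain: points within the other half stay
    at least \<delta> away from the boundary.\<close>
  define \<delta> where "\<delta> = d / 2"
  have \<delta>: "\<delta> > 0" "ball x (2 * \<delta>) \<subseteq> \<Omega>" using d by (simp_all add: \<delta>_def)
  have far: "\<forall>y\<in>frontier \<Omega>. \<delta> \<le> norm (z - y)" if "z \<in> ball x \<delta>" for z
  proof
    fix y assume "y \<in> frontier \<Omega>"
    then have "y \<notin> ball x (2 * \<delta>)" using \<delta>(2) op by (auto simp: frontier_def interior_open)
    then show "\<delta> \<le> norm (z - y)" using that dist_triangle[of x y z] by (simp add: dist_norm)
  qed
  show "\<exists>U. open U \<and> x \<in> U \<and> (\<forall>X Z \<epsilon>. (\<forall>n. X n \<in> U) \<longrightarrow> X \<longlonglongrightarrow> x \<longrightarrow>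
      (\<forall>n. Z n \<in> S1) \<longrightarrow> Z \<longlonglongrightarrow> \<xi> \<longrightarrow> \<epsilon> > 0 \<longrightarrow>
      (\<forall>\<^sub>F n in sequentially. \<bar>Sc (X n) (Z n) - Sc x \<xi>\<bar> \<le> \<kappa> * W + \<epsilon>))"
  proof (intro exI[of _ "\<Omega>0 \<inter> ball x \<delta>"] conjI allI impI open_Int Omega0(1) open_ball IntI x)
    show "x \<in> ball x \<delta>" using \<delta> by simp
    fix X Z and \<epsilon> :: real
    assume X: "\<forall>n. X n \<in> \<Omega>0 \<inter> ball x \<delta>" "X \<longlonglongrightarrow> x" "\<forall>n. Z n \<in> S1" "Z \<longlonglongrightarrow> \<xi>" and \<epsilon>: "\<epsilon> > 0"
    have X\<Omega>: "X n \<in> \<Omega>" for n using X(1) Omega0(2) by auto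
    define a where "a n k = (\<integral>s. wt k (X n) s * (p (X n) (Z n) (dirn (X n) (Yk k s)) * I (X n, dirn (X n) (Yk k s))) \<partial>lebesgue)" for n k
    define a0 where "a0 k = (\<integral>s. wt k x s * (p x \<xi> (dirn x (Yk k s)) * I (x, dirn x (Yk k s))) \<partial>lebesgue)" for k
    define b where "b k = (\<integral>s. wt k x s * p x \<xi> (dirn x (Yk k s)) \<partial>lebesgue)" for k
    have Sc_sum: "Sc (X n) (Z n) = (\<Sum>k<m. a n k)" "Sc x \<xi> = (\<Sum>k<m. a0 k)" for n
      unfolding scattering_def a_def a0_def
      using circle_integral_charts(2)[OF X\<Omega> pI_integrable[OF X\<Omega> X(3)[rule_format]], of n n]
        circle_integral_charts(2)[OF x\<Omega> pI_integrable[OF x\<Omega> \<xi>]] by auto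
    have b_sum: "(\<Sum>k<m. b k) = 1"
      using circle_integral_charts(2)[OF x\<Omega> p_integrable[OF x \<xi>]] p(5)[OF x \<xi>] by (simp add: b_def)
    \<comment> \<open>An equal share of the error for each of the \<open>m\<close> charts; the added
      1 keeps the denominator positive whatever \<open>m\<close> is.\<close>
    define e where "e = \<epsilon> / (real m + 1)"
    have e: "e > 0" "real m * e \<le> \<epsilon>" using \<epsilon> by (auto simp: e_def field_simps)
    have est: "\<forall>\<^sub>F n in sequentially. \<bar>a n k - a0 k\<bar> \<le> \<kappa> * W * b k + e" if k: "k < m" for k
    proof -
      interpret ch: chart \<Omega> "c k" "r k" "u k" "v k" "g k" "g' k" by (rule chart_k[OF k])
      obtain B where B: "integrable lebesgue B"
        "\<And>z s. \<forall>y\<in>frontier \<Omega>. \<delta> \<le> norm (z - y) \<Longrightarrow> \<bar>wt k z s\<bar> \<le> B s"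
        using wt_bound[OF k \<delta>(1)] by blast
      let ?N = "{x \<in> frontier \<Omega>. \<not> continuous_on (Gamma_minus_pt \<Omega> x) (\<lambda>\<xi>. I0 (x, \<xi>))}"
      have T_ball: "T k \<subseteq> {s. Yk k s \<in> ball (c k) (r k)}" by (auto simp: T_def)
      have "negligible {s. Yk k s \<in> ?N \<inter> ball (c k) (r k)}"
        using I0 charts[OF k] fam(2)[OF k] unfolding boundary_null_def graph_pt_def by blast
      \<comment> \<open>The direction \<open>dirv 0\<close> joins the excluded ones because the
        indicator in \<open>wt\<close> may jump when the branch cut is crossed. Injectivity turns
        finitely many directions into finitely many parameters.\<close>
      moreover have "negligible {s \<in> T k. dirn x (Yk k s) \<in> insert (dirv 0) bad_dirs}"
      proof (rule negligible_finite)
        have "inj_on (\<lambda>s. dirn x (Yk k s)) (T k)"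
          using ch.dirn_Y_inj[OF x\<Omega>] T_ball inj_on_subset by blast
        then have "finite ((\<lambda>s. dirn x (Yk k s)) -` insert (dirv 0) bad_dirs \<inter> T k)"
          by (intro finite_vimage_IntI) (simp_all add: finite_bad_dirs)
        then show "finite {s \<in> T k. dirn x (Yk k s) \<in> insert (dirv 0) bad_dirs}"
          by (rule rev_finite_subset) auto
      qed
      ultimately have "negligible ({s. Yk k s \<in> ?N \<inter> ball (c k) (r k)} \<union> {s \<in> T k. dirn x (Yk k s) \<in> insert (dirv 0) bad_dirs})"
        by (rule negligible_Un)
      then have good: "AE s in lebesgue. s \<in> T k \<longrightarrow>
          continuous_on (Gamma_minus_pt \<Omega> (Yk k s)) (\<lambda>\<xi>. I0 (Yk k s, \<xi>)) \<and>
          dirn x (Yk k s) \<noteq> dirv 0 \<and> dirn x (Yk k s) \<notin> bad_dirs"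
        unfolding eventually_ae_filter_negligible
          by (intro exI conjI, assumption) (use T_ball T_frontier[OF k] in blast)
      show ?thesis unfolding a_def a0_def b_def
      proof (rule scattering_limsup[where B=B, OF x _ X(2) \<xi> X(3)[rule_format] X(4) _ _ _ _ _ _ W e(1)])
        show "X n \<in> \<Omega>0" for n using X(1) by blast
        show "integrable lebesgue (\<lambda>s. wt k (X n) s * (p (X n) (Z n) (dirn (X n) (Yk k s)) * I (X n, dirn (X n) (Yk k s))))" for n
          using circle_integral_charts(1)[OF X\<Omega> pI_integrable[OF X\<Omega> X(3)[rule_format]] k] .
        show "integrable lebesgue (\<lambda>s. wt k x s * (p x \<xi> (dirn x (Yk k s)) * I (x, dirn x (Yk k s))))"
          using circle_integral_charts(1)[OF x\<Omega> pI_integrable[OF x\<Omega> \<xi>] k] .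
        show "integrable lebesgue (\<lambda>s. wt k x s * p x \<xi> (dirn x (Yk k s)))"
          using circle_integral_charts(1)[OF x\<Omega> p_integrable[OF x \<xi>] k] .
        show "integrable lebesgue B" by (rule B(1))
        have dirS1: "dirn z (Yk k s) \<in> S1" if "z \<in> \<Omega>" "s \<in> T k" for z s
          using norm_dirn ch.ne_Y[OF that(1), of s] that(2) T_ball by auto
        show "AE s in lebesgue. \<bar>wt k (X n) s\<bar> \<le> B s \<and> (wt k (X n) s \<noteq> 0 \<longrightarrow> dirn (X n) (Yk k s) \<in> S1)" for n
        proof (intro AE_I2 conjI impI)
          fix s
          show "\<bar>wt k (X n) s\<bar> \<le> B s" using X(1) by (intro B(2) far) auto
          assume "wt k (X n) s \<noteq> 0"
          then have "s \<in> T k" by (auto simp: wt_def indicator_def split: if_splits)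
          then show "dirn (X n) (Yk k s) \<in> S1" by (rule dirS1[OF X\<Omega>])
        qed
        show "AE s in lebesgue. (\<forall>n. wt k (X n) s = 0) \<and> wt k x s = 0 \<or>
          (\<lambda>n. wt k (X n) s) \<longlonglongrightarrow> wt k x s \<and> 0 \<le> wt k x s \<and> (\<forall>n. dirn (X n) (Yk k s) \<in> S1) \<and>
          (\<lambda>n. dirn (X n) (Yk k s)) \<longlonglongrightarrow> dirn x (Yk k s) \<and> dirn x (Yk k s) \<notin> bad_dirs \<and>
          (\<lambda>n. I0 (entry (X n) (dirn (X n) (Yk k s)), dirn (X n) (Yk k s))) \<longlonglongrightarrow> I0 (entry x (dirn x (Yk k s)), dirn x (Yk k s))"
          using good
        proof eventually_elim
          case (elim s)
          show ?case
          proof (cases "s \<in> T k")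
            case False
            then show ?thesis by (auto simp: wt_def)
          next
            case True
            let ?y = "Yk k s"
            have y: "?y \<in> frontier \<Omega>" by (rule T_frontier[OF k True])
            have ne: "x \<noteq> ?y" using ch.ne_Y[OF x\<Omega>, of s] True T_ball by auto
            have lim: "(\<lambda>n. dirn (X n) ?y) \<longlonglongrightarrow> dirn x ?y" by (rule dirn_tendsto[OF X(2) ne])
            have gam: "dirn z ?y \<in> Gamma_minus_pt \<Omega> ?y" if z: "z \<in> \<Omega>" for z
            proof -
              have "(entry z (dirn z ?y), dirn z ?y) \<in> Gamma_minus \<Omega>"
                by (rule entry_Gamma_minus[OF through_Omega[OF z dirS1[OF z True]]])
              then show ?thesis unfolding entry_dirn[OF z y] Gamma_minus_def Gamma_minus_pt_def by auto
            qed
            \<comment> \<open>The complement of the branch cut is open, so from some index on the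
              indicator in \<open>wt\<close> is 1 and only the continuous Jacobian remains.\<close>
            have "cx (x - ?y) \<in> - \<real>\<^sub>\<ge>\<^sub>0" using cx_nonneg_Reals[OF _ ne] elim True by auto
            moreover have "(\<lambda>n. cx (X n - ?y)) \<longlonglongrightarrow> cx (x - ?y)"
              by (intro bounded_linear.tendsto[OF bounded_linear_cx] tendsto_intros X)
            ultimately have "\<forall>\<^sub>F n in sequentially. cx (X n - ?y) \<in> - \<real>\<^sub>\<ge>\<^sub>0"
              using topological_tendstoD closed_nonneg_Reals_complex by (metis open_Compl)
            then have ev: "\<forall>\<^sub>F n in sequentially. \<bar>angle_deriv (u k) (v k) (g k) (g' k) (X n) s\<bar> = wt k (X n) s"
              by eventually_elim (use True in \<open>simp add: wt_def\<close>)
            have "(\<lambda>n. \<bar>angle_deriv (u k) (v k) (g k) (g' k) (X n) s\<bar>) \<longlonglongrightarrow> \<bar>angle_deriv (u k) (v k) (g k) (g' k) x s\<bar>"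
              by (intro tendsto_rabs angle_deriv_tendsto[OF X(2) ne])
            then have "(\<lambda>n. wt k (X n) s) \<longlonglongrightarrow> wt k x s"
              using Lim_transform_eventually[OF _ ev] \<open>cx (x - ?y) \<in> - \<real>\<^sub>\<ge>\<^sub>0\<close> True by (simp add: wt_def)
            moreover have "(\<lambda>n. I0 (?y, dirn (X n) ?y)) \<longlonglongrightarrow> I0 (?y, dirn x ?y)"
              using elim True gam[OF X\<Omega>] gam[OF x\<Omega>]
              by (intro continuous_on_tendsto_compose[OF _ lim, of _ "\<lambda>\<xi>. I0 (?y, \<xi>)"]) auto
            moreover have "0 \<le> wt k x s" by (simp add: wt_def)
            ultimately show ?thesis
              using lim elim True dirS1[OF X\<Omega> True] entry_dirn[OF X\<Omega> y] entry_dirn[OF x\<Omega> y] by auto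
          qed
        qed
      qed
    qed
    have "\<forall>\<^sub>F n in sequentially. \<forall>k\<in>{..<m}. \<bar>a n k - a0 k\<bar> \<le> \<kappa> * W * b k + e"
      using est by (intro eventually_ball_finite) auto
    then show "\<forall>\<^sub>F n in sequentially. \<bar>Sc (X n) (Z n) - Sc x \<xi>\<bar> \<le> \<kappa> * W + \<epsilon>"
    proof eventually_elim
      case (elim n)
      have "\<bar>Sc (X n) (Z n) - Sc x \<xi>\<bar> = \<bar>\<Sum>k<m. a n k - a0 k\<bar>" by (simp add: Sc_sum sum_subtractf)
      also have "\<dots> \<le> (\<Sum>k<m. \<bar>a n k - a0 k\<bar>)" by (rule sum_abs)
      also have "\<dots> \<le> (\<Sum>k<m. \<kappa> * W * b k + e)" using elim by (intro sum_mono) auto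
      also have "\<dots> = \<kappa> * W * (\<Sum>k<m. b k) + real m * e" by (simp add: sum.distrib sum_distrib_left)
      \<comment> \<open>The masses \<open>b k\<close> add up to the integral of \<open>p\<close>,
        which is 1, so splitting the circle does not worsen the factor \<kappa>.\<close>
      also have "\<dots> \<le> \<kappa> * W + \<epsilon>" using b_sum e by simp
      finally show ?case .
    qed
  qed
qed

end

section \<open>Continuity of the extended solution\<close>

context transport
begin

context
  assumes osc0: "osc_le 0"
begin

lemma Sc_tendsto:
  assumes "x \<in> \<Omega>0" "X \<longlonglongrightarrow> x" "\<And>n. Z n \<in> S1" "Z \<longlonglongrightarrow> \<xi>"
  shows "(\<lambda>n. Sc (X n) (Z n)) \<longlonglongrightarrow> Sc x \<xi>"
proof (rule tendstoI)
  fix e :: real assume e: "e > 0"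
  have "\<xi> \<in> S1" using closed_sequentially[OF closed_sphere _ assms(4)] assms(3) by blast
  moreover have "e / 2 > 0" using e by simp
  ultimately have "\<forall>\<^sub>F n in sequentially. \<bar>Sc (X n) (Z n) - Sc x \<xi>\<bar> \<le> 0 + e / 2"
    using osc0 assms unfolding osc_le_def by blast
  then show "\<forall>\<^sub>F n in sequentially. dist (Sc (X n) (Z n)) (Sc x \<xi>) < e"
    by eventually_elim (use e in \<open>simp add: dist_real_def\<close>)
qed

text \<open>At outgoing boundary points the notion of solution provides no integrability. Continuity
  of \<open>Sc\<close> on \<open>\<Omega>0\<close> yields measurability along the part of the ray
  inside \<open>\<Omega>0\<close>, and on the rest the kernel vanishes.\<close>

lemma mildable_through:
  assumes th: "through x \<xi>"
  shows "mildable x \<xi>"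
proof -
  have S1: "\<xi> \<in> S1" and ne: "\<Omega> \<noteq> {}" using th unfolding through_def by auto
  let ?V = "{s. x - s *\<^sub>R \<xi> \<in> \<Omega>0}" and ?S = "\<lambda>s. Sc (x - s *\<^sub>R \<xi>) \<xi>"
  have V: "open ?V"
    using open_vimage[OF Omega0(1), of "\<lambda>s. x - s *\<^sub>R \<xi>"] by (simp add: vimage_def continuous_intros)
  have "continuous_on ?V ?S"
    unfolding continuous_on_sequentially o_def
  proof (intro allI ballI impI, elim conjE)
    fix \<sigma> s assume "s \<in> ?V" "\<forall>n. \<sigma> n \<in> ?V" "\<sigma> \<longlonglongrightarrow> s"
    then show "(\<lambda>n. Sc (x - \<sigma> n *\<^sub>R \<xi>) \<xi>) \<longlonglongrightarrow> Sc (x - s *\<^sub>R \<xi>) \<xi>"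
      using S1 by (intro Sc_tendsto tendsto_intros) auto
  qed
  then have "(\<lambda>s. indicator ?V s *\<^sub>R ?S s) \<in> borel_measurable borel"
    using V by (intro borel_measurable_continuous_on_indicator) auto
  then have m: "(\<lambda>s. indicator ?V s *\<^sub>R ?S s) \<in> borel_measurable lebesgue"
    by (simp add: measurable_completion)
  have eq: "kernel x \<xi> s * ?S s = kernel x \<xi> s * (indicator ?V s *\<^sub>R ?S s)" for s
    using mus'(2) by (auto simp: kernel_def indicator_def)
  show ?thesis unfolding mildable_def
  proof (rule Bochner_Integration.integrable_bound[OF integrable_indicator_const[of 0 R "C * M"]])
    show "(\<lambda>s. kernel x \<xi> s * ?S s) \<in> borel_measurable lebesgue"
      unfolding eq by (intro borel_measurable_times kernel_measurable m)
    have "\<bar>kernel x \<xi> s * ?S s\<bar> \<le> (indicator {0..R} s * C) * M" for s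
      unfolding abs_mult using kernel_bounds[of x \<xi> s] Sc_bound[OF S1 ne, of "x - s *\<^sub>R \<xi>"] C_nonneg
      by (intro mult_mono) auto
    then show "AE s in lebesgue. norm (kernel x \<xi> s * ?S s) \<le> norm (indicator {0..R} s * (C * M))"
      by (intro AE_I2) (simp add: mult.assoc order_trans[OF _ abs_ge_self])
  qed
qed

lemma mild_tendsto:
  assumes th: "through x \<xi>" "\<And>n. through (X n) (Z n)"
    and X: "X \<longlonglongrightarrow> x" "Z \<longlonglongrightarrow> \<xi>"
    and leave: "AE s in lebesgue. 0 \<le> s \<longrightarrow> x - s *\<^sub>R \<xi> \<notin> \<Omega>0 \<longrightarrow> (\<forall>\<^sub>F n in sequentially. X n - s *\<^sub>R Z n \<notin> \<Omega>0)"
    and I0: "(\<lambda>n. I0 (entry (X n) (Z n), Z n)) \<longlonglongrightarrow> I0 (entry x \<xi>, \<xi>)"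
  shows "(\<lambda>n. mild (X n) (Z n)) \<longlonglongrightarrow> mild x \<xi>"
proof (rule tendstoI)
  fix e :: real assume e: "e > 0"
  then have "\<forall>\<^sub>F n in sequentially. \<bar>mild (X n) (Z n) - mild x \<xi>\<bar> \<le> \<kappa> * 0 + e / 2"
    by (intro mild_limsup[OF th X leave I0 _ _ osc0]) (simp_all add: mildable_through th)
  then show "\<forall>\<^sub>F n in sequentially. dist (mild (X n) (Z n)) (mild x \<xi>) < e"
    by eventually_elim (use e in \<open>simp add: dist_real_def\<close>)
qed

text \<open>Along a line that contains an interface segment the coefficients vanish near almost every point
  of the segment, so moving along the line is harmless even for directions excluded by \<open>disc_C\<close>.\<close>

lemma leave_along_line:
  assumes th: "through x \<xi>" and \<sigma>: "\<sigma> \<longlonglongrightarrow> 0"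
  shows "AE s in lebesgue. 0 \<le> s \<longrightarrow> x - s *\<^sub>R \<xi> \<notin> \<Omega>0 \<longrightarrow>
    (\<forall>\<^sub>F n in sequentially. (x - \<sigma> n *\<^sub>R \<xi>) - s *\<^sub>R \<xi> \<notin> \<Omega>0)"
proof -
  have S1: "\<xi> \<in> S1" using th unfolding through_def by auto
  define A where "A j = {t. x - t *\<^sub>R \<xi> \<in> L j}" for j
  \<comment> \<open>The parameters at which the line is on the segment form a convex set of reals,
    so only its end points, if any, have to be discarded.\<close>
  have "negligible (frontier (A j))" if j: "j \<in> {1..K}" for j
  proof (rule negligible_convex_frontier, rule convexI)
    obtain a b where "L j = open_segment a b" using segments j unfolding segments_of_def by blast
    then have conv: "convex (L j)" by simp
    fix s t \<alpha> \<beta> :: real assume *: "s \<in> A j" "t \<in> A j" "0 \<le> \<alpha>" "0 \<le> \<beta>" "\<alpha> + \<beta> = 1"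
    have "x - (\<alpha> * s + \<beta> * t) *\<^sub>R \<xi> = (\<alpha> + \<beta>) *\<^sub>R x - (\<alpha> * s + \<beta> * t) *\<^sub>R \<xi>" using * by simp
    also have "\<dots> = \<alpha> *\<^sub>R (x - s *\<^sub>R \<xi>) + \<beta> *\<^sub>R (x - t *\<^sub>R \<xi>)" by (simp add: algebra_simps)
    also have "\<dots> \<in> L j" using * conv by (auto simp: A_def intro: convexD)
    finally show "\<alpha> *\<^sub>R s + \<beta> *\<^sub>R t \<in> A j" by (simp add: A_def)
  qed
  then have "negligible (\<Union>j\<in>{1..K}. frontier (A j))" by (intro negligible_Union) auto
  with negligible_curved[OF S1, of x]
  have "negligible ({t. x - t *\<^sub>R \<xi> \<in> curved} \<union> {0, tau_minus \<Omega> x \<xi>} \<union> (\<Union>j\<in>{1..K}. frontier (A j)))"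
    by (intro negligible_Un) auto
  then have "AE s in lebesgue. x - s *\<^sub>R \<xi> \<notin> curved \<and> s \<notin> {0, tau_minus \<Omega> x \<xi>} \<and> (\<forall>j\<in>{1..K}. s \<notin> frontier (A j))"
    unfolding eventually_ae_filter_negligible
    by (intro exI conjI, assumption) blast
  then show ?thesis
  proof eventually_elim
    case (elim s)
    have lim: "(\<lambda>n. s + \<sigma> n) \<longlonglongrightarrow> s" using tendsto_add[OF tendsto_const \<sigma>, of s] by simp
    have eq: "(x - \<sigma> n *\<^sub>R \<xi>) - s *\<^sub>R \<xi> = x - (s + \<sigma> n) *\<^sub>R \<xi>" for n by (simp add: algebra_simps)
    show ?case
    proof (intro impI)
      assume s: "0 \<le> s" "x - s *\<^sub>R \<xi> \<notin> \<Omega>0"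
      show "\<forall>\<^sub>F n in sequentially. (x - \<sigma> n *\<^sub>R \<xi>) - s *\<^sub>R \<xi> \<notin> \<Omega>0"
      proof (cases "x - s *\<^sub>R \<xi> \<in> frontier \<Omega>0")
        case False
        then have "x - s *\<^sub>R \<xi> \<in> - closure \<Omega>0" using s Omega0(1) by (simp add: frontier_def interior_open)
        moreover have "(\<lambda>n. x - (s + \<sigma> n) *\<^sub>R \<xi>) \<longlonglongrightarrow> x - s *\<^sub>R \<xi>" by (intro tendsto_intros lim)
        ultimately have "\<forall>\<^sub>F n in sequentially. x - (s + \<sigma> n) *\<^sub>R \<xi> \<in> - closure \<Omega>0"
          using topological_tendstoD[of _ _ sequentially "- closure \<Omega>0"] by auto
        then show ?thesis unfolding eq by eventually_elim (use closure_subset in auto)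
      next
        case True
        then obtain j where j: "j \<in> {1..K}" "x - s *\<^sub>R \<xi> \<in> L j"
          using elim hits_frontier[OF th s(1)] by (auto simp: curved_def)
        then have "s \<in> closure (A j)" using closure_subset by (fastforce simp: A_def)
        \<comment> \<open>Small shifts of an interior parameter stay on the same segment, which lies
          in the frontier of the open set \<open>\<Omega>0\<close> and therefore outside
          \<open>\<Omega>0\<close>.\<close>
        then have "s \<in> interior (A j)" using elim j(1) by (auto simp: frontier_def)
        with lim have "\<forall>\<^sub>F n in sequentially. s + \<sigma> n \<in> interior (A j)"
          by (rule topological_tendstoD[OF _ open_interior])
        then show ?thesis unfolding eq
        proof eventually_elim
          case (elim n)
          then have "x - (s + \<sigma> n) *\<^sub>R \<xi> \<in> L j" using interior_subset by (auto simp: A_def)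
          then have "x - (s + \<sigma> n) *\<^sub>R \<xi> \<in> frontier \<Omega>0"
            using segments j(1) unfolding segments_of_def by blast
          then show ?case using Omega0(1) by (simp add: frontier_def interior_open)
        qed
      qed
    qed
  qed
qed

lemma entry_shift:
  assumes th: "through x \<xi>" "through (x - t *\<^sub>R \<xi>) \<xi>"
  shows "entry (x - t *\<^sub>R \<xi>) \<xi> = entry x \<xi>"
proof -
  have cl: "entry (x - t *\<^sub>R \<xi>) \<xi> \<in> closure \<Omega>" "entry x \<xi> \<in> closure \<Omega>"
    using entry_frontier(1)[OF th(1)] entry_frontier(1)[OF th(2)] by (auto simp: frontier_def)
  have "tau_minus \<Omega> x \<xi> - t \<le> tau_minus \<Omega> (x - t *\<^sub>R \<xi>) \<xi>"
    using cl(2) by (intro le_tau_minus[OF th(2)]) (simp add: entry_pt_def algebra_simps)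
  moreover have "t + tau_minus \<Omega> (x - t *\<^sub>R \<xi>) \<xi> \<le> tau_minus \<Omega> x \<xi>"
    using cl(1) by (intro le_tau_minus[OF th(1)]) (simp add: entry_pt_def algebra_simps)
  ultimately have eq: "tau_minus \<Omega> x \<xi> = t + tau_minus \<Omega> (x - t *\<^sub>R \<xi>) \<xi>" by linarith
  show ?thesis unfolding entry_pt_def eq by (simp add: algebra_simps)
qed

text \<open>No direction is exceptional here. The entry point, and with it the value of
  \<open>I0\<close>, is constant along the ray, and \<open>leave_along_line\<close> covers rays that
  contain a segment.\<close>

lemma limit_Gamma_plus:
  assumes "(x, \<xi>) \<in> Gamma_plus \<Omega>"
  shows "((\<lambda>t. I (x - t *\<^sub>R \<xi>, \<xi>)) \<longlongrightarrow> mild x \<xi>) (at_right 0)"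
proof -
  have th: "through x \<xi>" using assms phase_D_bar_eq by (auto simp: phase_D_bar_def)
  have S1: "\<xi> \<in> S1" using th unfolding through_def by auto
  obtain t where t: "t > 0" "x - t *\<^sub>R \<xi> \<in> \<Omega>" using assms Gamma_plus_iff by blast
  then have pos: "0 < tau_minus \<Omega> x \<xi>" using le_tau_minus[OF th, of t] closure_subset by fastforce
  show ?thesis
  proof (rule tendsto_at_right_sequentially[OF pos])
    fix \<sigma> assume \<sigma>: "\<And>n. 0 < \<sigma> n" "\<And>n. \<sigma> n < tau_minus \<Omega> x \<xi>" "\<sigma> \<longlonglongrightarrow> 0"
    have in\<Omega>: "x - \<sigma> n *\<^sub>R \<xi> \<in> \<Omega>" for n using before_tau_minus[OF \<sigma>(1,2)] .
    have th': "through (x - \<sigma> n *\<^sub>R \<xi>) \<xi>" for n using through_Omega[OF in\<Omega> S1] .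
    have "(\<lambda>n. x - \<sigma> n *\<^sub>R \<xi>) \<longlonglongrightarrow> x - 0 *\<^sub>R \<xi>" by (intro tendsto_intros \<sigma>)
    then have lim: "(\<lambda>n. x - \<sigma> n *\<^sub>R \<xi>) \<longlonglongrightarrow> x" by simp
    have "(\<lambda>n. mild (x - \<sigma> n *\<^sub>R \<xi>) \<xi>) \<longlonglongrightarrow> mild x \<xi>"
      by (rule mild_tendsto[OF th th' lim tendsto_const leave_along_line[OF th \<sigma>(3)]])
         (simp add: entry_shift[OF th th'])
    then show "(\<lambda>n. I (x - \<sigma> n *\<^sub>R \<xi>, \<xi>)) \<longlonglongrightarrow> mild x \<xi>"
      using solution_mild(1)[OF in_D[OF in\<Omega> S1]] by simp
  qed
qed

text \<open>Reduces continuity of the extension to that of \<open>mild\<close>, for which boundary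
  and interior points need not be distinguished.\<close>

lemma extension_mild:
  assumes "(x, \<xi>) \<in> phase_D_bar \<Omega>"
  shows "extension \<Omega> I (x, \<xi>) = mild x \<xi>"
proof (cases "(x, \<xi>) \<in> phase_D \<Omega>")
  case True
  then show ?thesis using solution_mild(1) by (simp add: extension_def)
next
  case False
  then have "(x, \<xi>) \<in> Gamma_plus \<Omega>" using assms by (simp add: phase_D_bar_def)
  from tendsto_Lim[OF trivial_limit_at_right_real limit_Gamma_plus[OF this]]
  show ?thesis using False by (simp add: extension_def)
qed

text \<open>By contraposition: outside \<open>disc_C\<close> the ray is \<open>good\<close>, and
  outside \<open>disc_B\<close> its entry point is a continuity point of \<open>I0\<close>. These
  supply the two assumptions of \<open>mild_tendsto\<close> that concern interfaces and boundary
  data.\<close>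

lemma disc_extension:
  "disc (phase_D_bar \<Omega>) (extension \<Omega> I) \<subseteq> disc_B \<Omega> I0 \<union> disc_C \<Omega> K L \<xi>p"
proof
  fix w assume w: "w \<in> disc (phase_D_bar \<Omega>) (extension \<Omega> I)"
  obtain x \<xi> where wx: "w = (x, \<xi>)" by (cases w)
  have D: "(x, \<xi>) \<in> phase_D_bar \<Omega>" and nc: "\<not> continuous (at (x, \<xi>) within phase_D_bar \<Omega>) (extension \<Omega> I)"
    using w unfolding wx disc_def by auto
  have th: "through x \<xi>" using D phase_D_bar_eq by blast
  show "w \<in> disc_B \<Omega> I0 \<union> disc_C \<Omega> K L \<xi>p"
  proof (rule ccontr)
    assume not: "w \<notin> disc_B \<Omega> I0 \<union> disc_C \<Omega> K L \<xi>p"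
    have good: "good x \<xi>" using good_line[OF th] not wx by blast
    have "(entry x \<xi>, \<xi>) \<notin> disc (Gamma_minus \<Omega>) I0"
    proof
      assume d: "(entry x \<xi>, \<xi>) \<in> disc (Gamma_minus \<Omega>) I0"
      have "x = entry x \<xi> + tau_minus \<Omega> x \<xi> *\<^sub>R \<xi>" by (simp add: entry_pt_def)
      moreover have "0 \<le> tau_minus \<Omega> x \<xi>" using th tau_minus_nonneg unfolding through_def by blast
      ultimately have "(x, \<xi>) \<in> disc_B \<Omega> I0"
        unfolding disc_B_def using d tau_minus_le_tau_plus[OF th] by blast
      then show False using not wx by blast
    qed
    then have cont: "continuous (at (entry x \<xi>, \<xi>) within Gamma_minus \<Omega>) I0"
      using entry_Gamma_minus[OF th] unfolding disc_def by blast
    have "continuous (at (x, \<xi>) within phase_D_bar \<Omega>) (extension \<Omega> I)"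
      unfolding continuous_within_sequentially o_def
    proof (intro allI impI, elim conjE)
      fix s assume s: "\<forall>n::nat. s n \<in> phase_D_bar \<Omega>" "s \<longlonglongrightarrow> (x, \<xi>)"
      define X Z where "X n = fst (s n)" and "Z n = snd (s n)" for n
      have sX: "s n = (X n, Z n)" for n by (simp add: X_def Z_def)
      have th': "through (X n) (Z n)" for n using s(1) phase_D_bar_eq sX by metis
      have lim: "X \<longlonglongrightarrow> x" "Z \<longlonglongrightarrow> \<xi>"
        using tendsto_fst[OF s(2)] tendsto_snd[OF s(2)] by (simp_all add: X_def[abs_def] Z_def[abs_def])
      have "(\<lambda>n. (entry (X n) (Z n), Z n)) \<longlonglongrightarrow> (entry x \<xi>, \<xi>)"
        by (intro tendsto_Pair entry_pt_tendsto[OF th th'] lim)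
      then have I0: "(\<lambda>n. I0 (entry (X n) (Z n), Z n)) \<longlonglongrightarrow> I0 (entry x \<xi>, \<xi>)"
        using entry_Gamma_minus[OF th']
        by (intro cont[unfolded continuous_within_sequentially o_def, rule_format]) auto
      have "(\<lambda>n. mild (X n) (Z n)) \<longlonglongrightarrow> mild x \<xi>"
        by (rule mild_tendsto[OF th th' lim good_leave[OF good lim] I0])
      then show "(\<lambda>n. extension \<Omega> I (s n)) \<longlonglongrightarrow> extension \<Omega> I (x, \<xi>)"
        using s(1) D by (simp add: sX extension_mild)
    qed
    then show False using nc by blast
  qed
qed

end

end

section \<open>From the given hypotheses to the setting of \<open>transport\<close>\<close>

theorem theorem3p2:
  fixes \<Omega> \<Omega>0 :: "(real^2) set"
    and Om :: "nat \<Rightarrow> (real^2) set" and N :: nat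
    and L :: "nat \<Rightarrow> (real^2) set" and K :: nat and \<xi>p :: "nat \<Rightarrow> real^2"
    and \<mu>t \<mu>s :: "real^2 \<Rightarrow> real"
    and p :: "real^2 \<Rightarrow> real^2 \<Rightarrow> real^2 \<Rightarrow> real"
    and I0 I :: "(real^2) \<times> (real^2) \<Rightarrow> real"
  assumes domain: "open \<Omega>" "\<Omega> \<noteq> {}" "bounded \<Omega>" "convex \<Omega>" "C1_boundary \<Omega>"
    and subdomains: "\<And>j. j \<in> {1..N} \<Longrightarrow> open (Om j) \<and> connected (Om j) \<and> Om j \<noteq> {} \<and>
          Om j \<subseteq> \<Omega> \<and> piecewise_C1_boundary (Om j)"
    and disjoint: "disjoint_family_on Om {1..N}"
    and cover: "closure \<Omega> = (\<Union>j\<in>{1..N}. closure (Om j))"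
    and Omega0: "\<Omega>0 = (\<Union>j\<in>{1..N}. Om j)"
    and K: "K \<ge> 1"
    and segments: "segments_of (frontier \<Omega>0 - frontier \<Omega>) K L"
    and straight_parts: "no_other_straight_parts (frontier \<Omega>0 - frontier \<Omega>) K L"
    and directions: "\<And>j. j \<in> {1..K} \<Longrightarrow> direction_of (L j) (\<xi>p j)"
    and mut: "\<And>x. \<mu>t x \<ge> 0" "bounded (range \<mu>t)" "disc \<Omega> \<mu>t \<subseteq> frontier \<Omega>0"
          "\<And>x. x \<notin> \<Omega>0 \<Longrightarrow> \<mu>t x = 0"
    and mus: "\<And>x. \<mu>s x \<ge> 0" "bounded (range \<mu>s)" "disc \<Omega> \<mu>s \<subseteq> frontier \<Omega>0"
          "\<And>x. x \<notin> \<Omega>0 \<Longrightarrow> \<mu>s x = 0"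
    and mus_le_mut: "\<And>x. x \<in> \<Omega> \<Longrightarrow> \<mu>s x \<le> \<mu>t x"
    and p: "\<And>x \<xi> \<xi>'. \<xi> \<in> S1 \<Longrightarrow> \<xi>' \<in> S1 \<Longrightarrow> p x \<xi> \<xi>' \<ge> 0"
          "bounded ((\<lambda>(x, \<xi>, \<xi>'). p x \<xi> \<xi>') ` (UNIV \<times> S1 \<times> S1))"
          "continuous_on (\<Omega>0 \<times> S1 \<times> S1) (\<lambda>(x, \<xi>, \<xi>'). p x \<xi> \<xi>')"
          "\<And>x \<xi> \<xi>'. x \<notin> \<Omega>0 \<Longrightarrow> \<xi> \<in> S1 \<Longrightarrow> \<xi>' \<in> S1 \<Longrightarrow> p x \<xi> \<xi>' = 0"
          "\<And>x \<xi>. x \<in> \<Omega>0 \<Longrightarrow> \<xi> \<in> S1 \<Longrightarrow> (LINT \<xi>'|circle_measure. p x \<xi> \<xi>') = 1"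
    and I0_bounded: "bounded (I0 ` Gamma_minus \<Omega>)"
    and I0_continuous:
          "boundary_null \<Omega>
             {x \<in> frontier \<Omega>. \<not> continuous_on (Gamma_minus_pt \<Omega> x) (\<lambda>\<xi>. I0 (x, \<xi>))} \<or>
           (AE \<xi> in circle_measure. continuous_on (Gamma_minus_dir \<Omega> \<xi>) (\<lambda>x. I0 (x, \<xi>)))"
    and solution: "is_solution \<Omega> \<mu>t \<mu>s p I0 I"
  shows "(\<forall>(x, \<xi>)\<in>Gamma_plus \<Omega>. \<exists>l. ((\<lambda>t. I (x - t *\<^sub>R \<xi>, \<xi>)) \<longlongrightarrow> l) (at_right 0)) \<and>
         disc (phase_D_bar \<Omega>) (extension \<Omega> I) \<subseteq> disc_B \<Omega> I0 \<union> disc_C \<Omega> K L \<xi>p"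
proof -
  have "open \<Omega>0" unfolding Omega0 using subdomains by (intro open_UN) auto
  moreover have "\<Omega>0 \<subseteq> \<Omega>" unfolding Omega0 using subdomains by (intro UN_least) auto
  ultimately have \<Omega>0: "open \<Omega>0" "\<Omega>0 \<subseteq> \<Omega>" .
  interpret C1_convex_domain \<Omega> using domain by unfold_locales
  define R where "R = diameter \<Omega>"
  have R: "\<And>y z. y \<in> \<Omega> \<Longrightarrow> z \<in> \<Omega> \<Longrightarrow> dist y z \<le> R" "0 \<le> R"
    unfolding R_def using diameter_bounded_bound[OF domain(3)] diameter_ge_0[OF domain(3)] by auto
  obtain C where C: "\<And>x. \<bar>\<mu>t x\<bar> \<le> C" using mut(2) by (auto simp: bounded_iff)
  obtain Cp where Cp: "\<forall>y\<in>(\<lambda>(x, \<xi>, \<xi>'). p x \<xi> \<xi>') ` (UNIV \<times> S1 \<times> S1). \<bar>y\<bar> \<le> Cp"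
    using p(2) unfolding bounded_iff real_norm_def by blast
  have Cp: "\<bar>p x \<xi> \<xi>'\<bar> \<le> Cp" if "\<xi> \<in> S1" "\<xi>' \<in> S1" for x \<xi> \<xi>'
    using bspec[OF Cp image_eqI[of _ _ "(x, \<xi>, \<xi>')"]] that by simp
  have "bounded (I ` phase_D \<Omega>)" using solution unfolding is_solution_def by (rule conjunct1)
  then obtain M where M: "\<And>z. z \<in> phase_D \<Omega> \<Longrightarrow> \<bar>I z\<bar> \<le> M"
    unfolding bounded_iff real_norm_def by (blast intro: imageI)
  have cont: "isCont f x" if "disc \<Omega> f \<subseteq> frontier \<Omega>0" "x \<in> \<Omega>0" for f :: "real^2 \<Rightarrow> real" and x
  proof -
    have "x \<in> \<Omega>" "x \<notin> frontier \<Omega>0" using that(2) \<Omega>0 by (auto simp: frontier_def interior_open)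
    then have "continuous (at x within \<Omega>) f" using that(1) unfolding disc_def by blast
    then show ?thesis by (simp only: at_within_open[OF \<open>x \<in> \<Omega>\<close> domain(1)])
  qed
  interpret transport \<Omega> \<Omega>0 L K \<xi>p \<mu>t \<mu>s p I0 I R C Cp M
  proof
    show "\<mu>t x \<le> C" for x using C[of x] by linarith
    show "\<mu>s x \<le> \<mu>t x" for x using mus_le_mut[of x] mus(4)[of x] mut(4)[of x] \<Omega>0(2) by (cases "x \<in> \<Omega>0") auto
    show "isCont \<mu>t x" "isCont \<mu>s x" if "x \<in> \<Omega>0" for x
      using cont[OF mut(3) that] cont[OF mus(3) that] by auto
    show "p x \<xi> \<xi>' \<le> Cp" if "\<xi> \<in> S1" "\<xi>' \<in> S1" for x \<xi> \<xi>' using Cp[OF that, of x] by linarith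
  qed (fact \<Omega>0 segments straight_parts directions R mut(1) mut(4) mus(1) p(1) p(3) p(4) p(5) M solution)+
  \<comment> \<open>The only place where the two alternatives for \<open>I0\<close> are
    distinguished; everything after it depends on the continuity of the scattering term
    alone.\<close>
  have "osc_le 0"
  proof (rule osc_zero)
    fix W :: real assume "osc_le W" "0 \<le> W"
    then show "osc_le (\<kappa> * W)" using I0_continuous osc_step_pt osc_step_dir by blast
  qed
  from limit_Gamma_plus[OF this] disc_extension[OF this] show ?thesis by blast
qed

end
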